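(* Consider the weighted stochastic block model SBM$(p,q,\alpha_n)$ on $n$ nodes with $d$-uniform hyperedges and $k$ groups, and suppose that $n_{\max}/n_{\min}=O(1)$ as $n\to\infty$. Let $\Phi_{\mathrm{HSC}}$ be the output of the algorithm HSC. Then there exist constants $c_0,c_1>0$ not depending on $n$ (where $c_1$ depends on $p$ and $q$) such that, if $\binom{n}{d}\alpha_n\ge c_0 n$, then with probability $1-O(n^{-1})$ $$\mathrm{err}(\Phi_{\mathrm{HSC}})\le c_1\,k\,\frac{n^3}{d(d-1)\,n_{\min}^2\binom{n}{d}\alpha_n},$$ provided that $c_1 k\frac{n^3}{d(d-1)n_{\min}^2\binom{n}{d}\alpha_n}<1$.
   Context: Model. The integers $d\ge 2$ (edge size) and $k$ (number of groups) and the real constants $p>q\ge 0$ are fixed; $n\to\infty$. Nodes are $[n]=\{1,\dots,n\}$ and $\mathcal{E}=\binom{[n]}{d}$ is the set of all $d$-subsets of $[n]$. A hidden partition $\Psi:[n]\to[k]$ has group sizes $n_j=|\Psi^{-1}(j)|$, with $n_{\min}=\min_j n_j$, $n_{\max}=\max_j n_j$. An edge $e\in\mathcal{E}$ is homogeneous if $\Psi$ is constant on $e$, heterogeneous otherwise. In the weighted SBM$(p,q,\alpha_n)$, independent random weights $W_e\in[0,1]$, $e\in\mathcal{E}$, satisfy $\mathbb{E}[W_e]=p\alpha_n$ for homogeneous $e$ and $\mathbb{E}[W_e]=q\alpha_n$ for heterogeneous $e$; $\alpha_n>0$ may depend on $n$. Nothing else is assumed about the weight distributions. Error fraction. For $\Phi:[n]\to[k]$,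 $\mathrm{err}(\Phi)=\frac1n\min_{\Pi}|\{i:\Psi(i)\ne\Pi(\Phi(i))\}|$, the minimum being over all permutations $\Pi$ of $[k]$. Algorithm HSC (input: $\{W_e\}_{e\in\mathcal{E}}$ and $k$). (1) Compute the similarity matrix $\mathbf{A}\in\mathbb{R}^{n\times n}$: $\mathbf{A}_{ij}=\sum_{e:\{i,j\}\subset e}W_e$ for $i\ne j$, $\mathbf{A}_{ii}=0$. (2) Obtain the processed similarity matrix $\mathbf{A}^0$ from $\mathbf{A}$ by zeroing out row $i$ and column $i$ for every $i$ with $\sum_j\mathbf{A}_{ij}>c_{\mathrm{thr}}\frac1n\sum_{i',j'}\mathbf{A}_{i'j'}$, where $c_{\mathrm{thr}}>0$ is a suitable constant depending only on $d$. (3) Let $\mathbf{U}^0\in\mathbb{R}^{n\times k}$ have as columns the (orthonormal) eigenvectors of $\mathbf{A}^0$ for its $k$ largest eigenvalues, and cluster the rows of $\mathbf{U}^0$ by a $(1+\epsilon)$-approximate solution of the $k$-means problem, $\epsilon>0$ a fixed constant: i.e. output $\Phi:[n]\to[k]$ with $\mathrm{cost}(\Phi)\le(1+\epsilon)\min_{\Phi'}\mathrm{cost}(\Phi')$, where $\mathrm{cost}(\Phi)=\sum_{j=1}^k\sum_{i\in\Phi^{-1}(j)}\big\|\mathbf{U}^0_{i*}-\frac{1}{|\Phi^{-1}(j)|}\sum_{\ell\in\Phi^{-1}(j)}\mathbf{U}^0_{\ell *}\big\|^2$ and $\mathbf{U}^0_{i*}$ is the $i$-th row. "Constant" means independent of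 $n$; constants may depend on the fixed quantities $d,k,p,q,\epsilon$ and the bound on $n_{\max}/n_{\min}$.
   Formalization: The threshold constant c_thr may depend on d and on the bound for n_max/n_min, rather than on d alone; with c_thr depending only on d the claim fails, e.g. for d=2 one large group among many small groups is zeroed out entirely. *)

theory Defs
  imports
    "HOL-Probability.Probability"
    "HOL-Combinatorics.Permutations"
    "Jordan_Normal_Form.Char_Poly"
begin

text \<open>
  Nodes, groups and matrix indices are counted from 0: the node set is \<open>{..<n}\<close> and the groups are
  \<open>{..<k}\<close>.  Membership functions \<open>\<Psi>, \<Phi> :: nat \<Rightarrow> nat\<close> matter only on \<open>{..<n}\<close>.
\<close>

definition hyperedges :: "nat \<Rightarrow> nat \<Rightarrow> nat set set" where
  "hyperedges n d = {e. e \<subseteq> {..<n} \<and> card e = d}"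

definition homogeneous :: "(nat \<Rightarrow> nat) \<Rightarrow> nat set \<Rightarrow> bool" where
  "homogeneous \<Psi> e \<longleftrightarrow> (\<forall>i\<in>e. \<forall>j\<in>e. \<Psi> i = \<Psi> j)"

definition cluster :: "nat \<Rightarrow> (nat \<Rightarrow> nat) \<Rightarrow> nat \<Rightarrow> nat set" where
  "cluster n \<Phi> j = {i. i < n \<and> \<Phi> i = j}"

definition n_min :: "nat \<Rightarrow> nat \<Rightarrow> (nat \<Rightarrow> nat) \<Rightarrow> nat" where
  "n_min n k \<Psi> = Min ((\<lambda>j. card (cluster n \<Psi> j)) ` {..<k})"

definition n_max :: "nat \<Rightarrow> nat \<Rightarrow> (nat \<Rightarrow> nat) \<Rightarrow> nat" where
  "n_max n k \<Psi> = Max ((\<lambda>j. card (cluster n \<Psi> j)) ` {..<k})"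

locale weighted_SBM = prob_space M
  for M :: "'a measure" +
  fixes n d k :: nat and p q \<alpha> :: real
    and \<Psi> :: "nat \<Rightarrow> nat" and W :: "nat set \<Rightarrow> 'a \<Rightarrow> real"
  assumes partition: "\<Psi> \<in> {..<n} \<rightarrow> {..<k}"
    and scale_pos: "\<alpha> > 0"
    and indep_weights: "indep_vars (\<lambda>_. borel) W (hyperedges n d)"
    and weight_range: "\<And>e. e \<in> hyperedges n d \<Longrightarrow> AE \<omega> in M. W e \<omega> \<in> {0..1}"
    and mean_homogeneous:
      "\<And>e. e \<in> hyperedges n d \<Longrightarrow> homogeneous \<Psi> e \<Longrightarrow> expectation (W e) = p * \<alpha>"
    and mean_heterogeneous:
      "\<And>e. e \<in> hyperedges n d \<Longrightarrow> \<not> homogeneous \<Psi> e \<Longrightarrow> expectation (W e) = q * \<alpha>"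

definition err :: "nat \<Rightarrow> nat \<Rightarrow> (nat \<Rightarrow> nat) \<Rightarrow> (nat \<Rightarrow> nat) \<Rightarrow> real" where
  "err n k \<Psi> \<Phi> =
     real (Min ((\<lambda>\<pi>. card {i. i < n \<and> \<Psi> i \<noteq> \<pi> (\<Phi> i)}) ` {\<pi>. \<pi> permutes {..<k}})) / real n"

definition similarity_matrix :: "nat \<Rightarrow> nat \<Rightarrow> (nat set \<Rightarrow> real) \<Rightarrow> real mat" where
  "similarity_matrix n d w = mat n n (\<lambda>(i, j).
     if i = j then 0 else (\<Sum>e\<in>{e \<in> hyperedges n d. {i, j} \<subseteq> e}. w e))"

definition row_sum :: "real mat \<Rightarrow> nat \<Rightarrow> real" where
  "row_sum A i = (\<Sum>j<dim_col A. A $$ (i, j))"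

definition exceeds_threshold :: "real \<Rightarrow> real mat \<Rightarrow> nat \<Rightarrow> bool" where
  "exceeds_threshold c A i \<longleftrightarrow> row_sum A i > c * (1 / real (dim_row A)) * (\<Sum>i'<dim_row A. row_sum A i')"

definition processed_matrix :: "real \<Rightarrow> real mat \<Rightarrow> real mat" where
  "processed_matrix c A = mat (dim_row A) (dim_col A) (\<lambda>(i, j).
     if exceeds_threshold c A i \<or> exceeds_threshold c A j then 0 else A $$ (i, j))"

text \<open>
  The columns of \<open>U\<close> are the first \<open>k\<close> members of an orthonormal eigenbasis sorted by decreasing
  (signed) eigenvalue, counted with multiplicity.  Neither signs nor bases of eigenspaces make \<open>U\<close>
  unique, so this is a relation.
\<close>

definition top_eigenvectors :: "nat \<Rightarrow> real mat \<Rightarrow> real mat \<Rightarrow> bool" where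
  "top_eigenvectors k A U \<longleftrightarrow>
     k \<le> dim_row A \<and> U \<in> carrier_mat (dim_row A) k \<and>
     (\<exists>(v :: nat \<Rightarrow> real vec) (ev :: nat \<Rightarrow> real).
        (\<forall>i < dim_row A. eigenvector A (v i) (ev i)) \<and>
        (\<forall>i < dim_row A. \<forall>j < dim_row A. scalar_prod (v i) (v j) = (if i = j then 1 else 0)) \<and>
        (\<forall>i j. i \<le> j \<and> j < dim_row A \<longrightarrow> ev j \<le> ev i) \<and>
        (\<forall>l < k. col U l = v l))"

definition centroid :: "real mat \<Rightarrow> (nat \<Rightarrow> nat) \<Rightarrow> nat \<Rightarrow> real vec" where
  "centroid U \<Phi> j = vec (dim_col U) (\<lambda>l.
     (\<Sum>i\<in>cluster (dim_row U) \<Phi> j. U $$ (i, l)) / real (card (cluster (dim_row U) \<Phi> j)))"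

definition sq_norm2 :: "real vec \<Rightarrow> real" where
  "sq_norm2 x = scalar_prod x x"

definition kmeans_cost :: "nat \<Rightarrow> real mat \<Rightarrow> (nat \<Rightarrow> nat) \<Rightarrow> real" where
  "kmeans_cost k U \<Phi> =
     (\<Sum>j<k. \<Sum>i\<in>cluster (dim_row U) \<Phi> j. sq_norm2 (row U i - centroid U \<Phi> j))"

definition approx_kmeans :: "nat \<Rightarrow> real \<Rightarrow> real mat \<Rightarrow> (nat \<Rightarrow> nat) \<Rightarrow> bool" where
  "approx_kmeans k \<epsilon> U \<Phi> \<longleftrightarrow>
     \<Phi> \<in> {..<dim_row U} \<rightarrow> {..<k} \<and>
     kmeans_cost k U \<Phi> \<le> (1 + \<epsilon>) * Min (kmeans_cost k U ` ({..<dim_row U} \<rightarrow>\<^sub>E {..<k}))"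

text \<open>
  \<open>HSC_output c \<epsilon> n d k w \<Phi>\<close>: on weights \<open>w\<close>, the clustering \<open>\<Phi>\<close> is a possible output of HSC with
  threshold constant \<open>c\<close> and k-means approximation factor \<open>1 + \<epsilon>\<close>.
\<close>

definition HSC_output ::
  "real \<Rightarrow> real \<Rightarrow> nat \<Rightarrow> nat \<Rightarrow> nat \<Rightarrow> (nat set \<Rightarrow> real) \<Rightarrow> (nat \<Rightarrow> nat) \<Rightarrow> bool" where
  "HSC_output c \<epsilon> n d k w \<Phi> \<longleftrightarrow>
     (\<exists>U. top_eigenvectors k (processed_matrix c (similarity_matrix n d w)) U \<and>
          approx_kmeans k \<epsilon> U \<Phi>)"

end

theory Submission
  imports Defs
begin

text \<open>
  Write \<open>D = \<alpha> n (n - 2 choose d - 2)\<close> for the scale of a node's weighted degree. The claimed bound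
  is at least a constant multiple of \<open>1 / D\<close>, so the goal is a misclassification rate \<open>O(1 / D)\<close> as
  soon as \<open>D\<close> exceeds a constant.

  The mean similarity matrix \<open>P\<close> is constant on blocks (off the diagonal), so the normalised cluster
  indicators \<open>u\<^sub>j\<close> span a space invariant under \<open>P\<close>, on which the form of \<open>P\<close> is at least \<open>\<kappa> D\<close>.
  Let \<open>\<xi>\<close> be the squared mass of the \<open>u\<^sub>j\<close> outside the span of the top \<open>k\<close> eigenvectors of the
  processed matrix \<open>A0\<close>. The true partition has k-means cost at most \<open>\<xi>\<close>, while its centroids stay
  \<open>1 / n_max\<close> apart in squared distance, so an approximate k-means solution mislabels only
  \<open>O(n_max \<xi>)\<close> nodes (\<open>err_le_of_projection\<close>).

  The noise \<open>A0 - P\<close> enters in two places, which ask for estimates of different strength.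
  Projecting \<open>A0 u\<^sub>j = \<Sum>\<^sub>m B\<^sub>j\<^sub>m u\<^sub>m + r\<^sub>j\<close> to the lower eigenvectors
  (\<open>sin_theta_bound\<close>) gives \<open>(\<kappa> D - \<delta>)\<^sup>2 \<xi> \<le> \<Sum>\<^sub>j \<parallel>r\<^sub>j\<parallel>\<^sup>2\<close>, where \<open>\<delta>\<close> is any upper bound on
  the eigenvalue number \<open>k + 1\<close>. So only the residuals \<open>r\<^sub>j\<close> have to be small to the right order,
  while for \<open>\<delta>\<close> any constant fraction of \<open>\<kappa> D\<close> below one will do.

  First, \<open>\<delta> = \<kappa> D / 2\<close> is an upper bound: by dimension counting it is enough to bound the form of \<open>A0\<close> on
  vectors orthogonal to the clusters, up to a small constant fraction of \<open>D\<close>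
  (\<open>quadratic_form_le_of_discrepancy\<close>). Vectors with flat coordinates are handled by the cut norm of
  \<open>A - P\<close>, and mass on few large coordinates by the sparsity of small node sets together with the
  degree bound that trimming enforces. Both discrepancy properties follow from Chernoff bounds and a
  union bound over node sets (\<open>prob_cut_event\<close>, \<open>prob_sparse_event\<close>).

  Second, \<open>\<parallel>r\<^sub>j\<parallel>\<^sup>2 = O(D)\<close>. This is a second moment: the sum over all nodes of the squared deviation of
  the weight towards one cluster is a quadratic form in the centred weights. Its diagonal is
  controlled by the total weight, and its off-diagonal part is a sum of orthogonal products, so
  Chebyshev's inequality applies (\<open>prob_cross_term\<close>); this step determines the probability
  \<open>1 - O(1 / n)\<close>. Trimming changes little: the threshold is a large multiple of every mean degree, so
  each trimmed node has a deviation of order \<open>D\<close>, and the same second moment shows that trimmed nodes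
  are few and carry little weight (\<open>removed_totals\<close>).
\<close>

unbundle no vec_syntax

section \<open>Quadratic forms of matrices with small discrepancy\<close>

text \<open>
  If every subset spans weight at most \<open>\<rho>\<close> per node, the nodes can be removed one by one so that
  each sends weight at most \<open>\<rho>\<close> to the nodes that remain. Splitting each product with weight \<open>t\<close> on
  the removed endpoint then charges \<open>\<rho>\<close> to one endpoint and the full degree, divided by \<open>t\<close>, to the
  other. A degree bound \<open>\<Delta>\<close> and \<open>t = sqrt (\<Delta> / \<rho>)\<close> give a form of order \<open>sqrt (\<rho> \<Delta>)\<close>, far below
  the trivial bound \<open>\<Delta>\<close> when \<open>\<rho>\<close> is small.
\<close>

lemma degenerate_quadratic_form_le:
  fixes A :: "'b \<Rightarrow> 'b \<Rightarrow> real" and t \<rho> :: real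
  assumes "finite S" and t: "t > 0"
    and nonneg: "\<And>i j. A i j \<ge> 0" and sym: "\<And>i j. A i j = A j i" and diag: "\<And>i. A i i = 0"
    and sparse: "\<And>T. T \<subseteq> S \<Longrightarrow> (\<Sum>i\<in>T. \<Sum>j\<in>T. A i j) \<le> \<rho> * card T"
  shows "(\<Sum>i\<in>S. \<Sum>j\<in>S. A i j * x i * x j) \<le> (\<Sum>j\<in>S. (x j)\<^sup>2 * (t * \<rho> + (\<Sum>i\<in>S. A i j) / t))"
  using \<open>finite S\<close> sparse
proof (induction S rule: finite_psubset_induct)
  case (psubset S)
  show ?case
  proof (cases "S = {}")
    case False
    have "\<exists>i\<in>S. (\<Sum>j\<in>S. A i j) \<le> \<rho>"
    proof (rule ccontr)
      assume "\<not> ?thesis"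
      then have "(\<Sum>i\<in>S. \<rho>) < (\<Sum>i\<in>S. \<Sum>j\<in>S. A i j)"
        using False psubset.hyps by (intro sum_strict_mono) auto
      then show False
        using psubset.prems[of S] by (simp add: mult.commute)
    qed
    then obtain i where i: "i \<in> S" "(\<Sum>j\<in>S. A i j) \<le> \<rho>" by blast
    define R where "R = S - {i}"
    have S: "S = insert i R" "i \<notin> R" "finite R" using i psubset.hyps by (auto simp: R_def)
    have IH: "(\<Sum>i\<in>R. \<Sum>j\<in>R. A i j * x i * x j) \<le> (\<Sum>j\<in>R. (x j)\<^sup>2 * (t * \<rho> + (\<Sum>i\<in>R. A i j) / t))"
    proof (rule psubset.IH)
      show "R \<subset> S" using i by (auto simp: R_def)
      then show "(\<Sum>i\<in>T. \<Sum>j\<in>T. A i j) \<le> \<rho> * card T" if "T \<subseteq> R" for T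
        using psubset.prems that by blast
    qed
    have amgm: "2 * (A i j * x i * x j) \<le> t * (x i)\<^sup>2 * A i j + (x j)\<^sup>2 * A i j / t" for j
    proof -
      have "(t * x i - x j)\<^sup>2 / t = t * (x i)\<^sup>2 + (x j)\<^sup>2 / t - 2 * (x i * x j)"
        using t by (simp add: power2_eq_square field_simps)
      moreover have "0 \<le> (t * x i - x j)\<^sup>2 / t" using t by simp
      ultimately have "2 * (x i * x j) \<le> t * (x i)\<^sup>2 + (x j)\<^sup>2 / t" by linarith
      then have "A i j * (2 * (x i * x j)) \<le> A i j * (t * (x i)\<^sup>2 + (x j)\<^sup>2 / t)"
        by (intro mult_left_mono nonneg) auto
      then show ?thesis by (simp add: algebra_simps)
    qed
    have "(\<Sum>i\<in>S. \<Sum>j\<in>S. A i j * x i * x j)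
        = (\<Sum>i\<in>R. \<Sum>j\<in>R. A i j * x i * x j) + (\<Sum>j\<in>R. 2 * (A i j * x i * x j))"
    proof -
      have "(\<Sum>l\<in>R. A l i * x l * x i) = (\<Sum>j\<in>R. A i j * x i * x j)"
        by (intro sum.cong refl) (simp add: sym[of _ i])
      then show ?thesis using S by (simp add: diag sum.distrib sum_distrib_left[symmetric])
    qed
    also have "(\<Sum>j\<in>R. 2 * (A i j * x i * x j)) \<le> (\<Sum>j\<in>R. t * (x i)\<^sup>2 * A i j + (x j)\<^sup>2 * A i j / t)"
      by (intro sum_mono amgm)
    also have "\<dots> = t * (x i)\<^sup>2 * (\<Sum>j\<in>S. A i j) + (\<Sum>j\<in>R. (x j)\<^sup>2 * A i j / t)"
      unfolding S(1) using S(2,3) by (simp add: sum.distrib sum_distrib_left diag)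
    also have "t * (x i)\<^sup>2 * (\<Sum>j\<in>S. A i j) \<le> t * (x i)\<^sup>2 * \<rho>"
      using i t by (intro mult_left_mono) auto
    finally have "(\<Sum>i\<in>S. \<Sum>j\<in>S. A i j * x i * x j) \<le>
       (\<Sum>j\<in>R. (x j)\<^sup>2 * (t * \<rho> + (\<Sum>i\<in>R. A i j) / t)) + (t * (x i)\<^sup>2 * \<rho> + (\<Sum>j\<in>R. (x j)\<^sup>2 * A i j / t))"
      using IH by linarith
    also have "\<dots> = (\<Sum>j\<in>R. (x j)\<^sup>2 * (t * \<rho> + (\<Sum>i\<in>S. A i j) / t)) + (x i)\<^sup>2 * (t * \<rho>)"
      unfolding S(1) using S(2,3) by (simp add: sum.distrib algebra_simps add_divide_distrib)
    also have "\<dots> \<le> (\<Sum>j\<in>S. (x j)\<^sup>2 * (t * \<rho> + (\<Sum>i\<in>S. A i j) / t))"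
    proof -
      have "(x i)\<^sup>2 * (t * \<rho>) \<le> (x i)\<^sup>2 * (t * \<rho> + (\<Sum>l\<in>S. A l i) / t)"
        using t by (intro mult_left_mono) (auto simp: sum_nonneg nonneg)
      moreover have "(\<Sum>j\<in>S. f j) = (\<Sum>j\<in>R. f j) + f i" for f :: "'b \<Rightarrow> real"
        using S by simp
      ultimately show ?thesis by simp
    qed
    finally show ?thesis .
  qed simp
qed

text \<open>
  A linear form on a cube is extremal at a vertex, so it is controlled by its values on the two sets of
  indices with positive and with negative coefficients.
\<close>

lemma sum_bounded_coeffs_le:
  fixes r x :: "'b \<Rightarrow> real"
  assumes "finite N" and cut: "\<And>S. S \<subseteq> N \<Longrightarrow> \<bar>\<Sum>i\<in>S. r i\<bar> \<le> c"
    and x: "\<And>i. i \<in> N \<Longrightarrow> \<bar>x i\<bar> \<le> \<tau>" and "\<tau> \<ge> 0"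
  shows "\<bar>\<Sum>i\<in>N. x i * r i\<bar> \<le> 2 * \<tau> * c"
proof -
  define Np where "Np = {i\<in>N. r i \<ge> 0}"
  define Nn where "Nn = {i\<in>N. r i < 0}"
  have "\<bar>\<Sum>i\<in>N. x i * r i\<bar> \<le> (\<Sum>i\<in>N. \<tau> * \<bar>r i\<bar>)"
    by (rule order_trans[OF sum_abs], rule sum_mono) (simp add: abs_mult mult_right_mono x)
  also have "\<dots> = \<tau> * (\<Sum>i\<in>N. \<bar>r i\<bar>)" by (simp add: sum_distrib_left)
  also have "(\<Sum>i\<in>N. \<bar>r i\<bar>) = (\<Sum>i\<in>Np. \<bar>r i\<bar>) + (\<Sum>i\<in>Nn. \<bar>r i\<bar>)"
    using \<open>finite N\<close> by (subst sum.union_disjoint[symmetric]) (auto simp: Np_def Nn_def intro!: sum.cong)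
  also have "(\<Sum>i\<in>Np. \<bar>r i\<bar>) = (\<Sum>i\<in>Np. r i)" by (auto simp: Np_def intro!: sum.cong)
  also have "(\<Sum>i\<in>Nn. \<bar>r i\<bar>) = - (\<Sum>i\<in>Nn. r i)" by (auto simp: Nn_def sum_negf[symmetric] intro!: sum.cong)
  also have "\<tau> * ((\<Sum>i\<in>Np. r i) + - (\<Sum>i\<in>Nn. r i)) \<le> \<tau> * (c + c)"
    using cut[of Np] cut[of Nn] \<open>\<tau> \<ge> 0\<close> by (intro mult_left_mono) (auto simp: Np_def Nn_def)
  finally show ?thesis by simp
qed

text \<open>
  The vertex argument of \<open>sum_bounded_coeffs_le\<close>, once per argument of the form.
\<close>

lemma cut_bound_bilinear:
  fixes M :: "'b \<Rightarrow> 'b \<Rightarrow> real"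
  assumes "finite N" and cut: "\<And>S T. S \<subseteq> N \<Longrightarrow> T \<subseteq> N \<Longrightarrow> \<bar>\<Sum>i\<in>S. \<Sum>j\<in>T. M i j\<bar> \<le> c"
    and x: "\<And>i. i \<in> N \<Longrightarrow> \<bar>x i\<bar> \<le> \<tau>" and "\<tau> \<ge> 0"
  shows "\<bar>\<Sum>i\<in>N. \<Sum>j\<in>N. M i j * x i * x j\<bar> \<le> 4 * \<tau>\<^sup>2 * c"
proof -
  have half: "\<bar>\<Sum>i\<in>S. \<Sum>j\<in>N. x j * M i j\<bar> \<le> 2 * \<tau> * c" if "S \<subseteq> N" for S
  proof -
    have "\<bar>\<Sum>j\<in>N. x j * (\<Sum>i\<in>S. M i j)\<bar> \<le> 2 * \<tau> * c"
    proof (rule sum_bounded_coeffs_le)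
      fix T assume "T \<subseteq> N"
      then have "\<bar>\<Sum>i\<in>S. \<Sum>j\<in>T. M i j\<bar> \<le> c" using cut that by blast
      then show "\<bar>\<Sum>j\<in>T. \<Sum>i\<in>S. M i j\<bar> \<le> c" by (subst sum.swap)
    qed (use assms in auto)
    also have "(\<Sum>j\<in>N. x j * (\<Sum>i\<in>S. M i j)) = (\<Sum>i\<in>S. \<Sum>j\<in>N. x j * M i j)"
      by (subst sum.swap) (simp add: sum_distrib_left)
    finally show ?thesis .
  qed
  have "\<bar>\<Sum>i\<in>N. x i * (\<Sum>j\<in>N. x j * M i j)\<bar> \<le> 2 * \<tau> * (2 * \<tau> * c)"
    using assms half by (intro sum_bounded_coeffs_le) auto
  then show ?thesis by (simp add: sum_distrib_left algebra_simps power2_eq_square)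
qed

text \<open>
  The coordinates of \<open>y\<close> are compared with the root mean square \<open>\<tau>\<close>. Pairs whose coordinates are both at
  most \<open>K1 \<tau>\<close> fall under the cut bound \<open>c\<close>. Every other pair contains a coordinate above \<open>K1 \<tau>\<close>;
  if the partner is above \<open>K0 \<tau>\<close>, both lie in a set of at most \<open>n / K0\<^sup>2\<close> indices, which is sparse,
  and otherwise the ratio \<open>K0 / K1\<close> of the coordinates makes the degree bound \<open>\<Delta>\<close> affordable. The
  contribution of \<open>P\<close> to the pairs with a large coordinate is small because \<open>P\<close> is spread out.
\<close>

lemma quadratic_form_le_of_discrepancy:
  fixes A P :: "nat \<Rightarrow> nat \<Rightarrow> real" and t \<rho> :: real
  assumes n: "n > 0" and K: "0 < K0" "K0 \<le> K1" and t: "t > 0"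
    and nonneg: "\<And>i j. A i j \<ge> 0" and sym: "\<And>i j. A i j = A j i" and diag: "\<And>i. A i i = 0"
    and bounds: "\<rho> \<ge> 0" "\<Delta> \<ge> 0"
    and P: "\<And>i j. 0 \<le> P i j" "\<And>i j. P i j \<le> \<pi>"
    and supp: "\<And>i. i < n \<Longrightarrow> y i \<noteq> 0 \<Longrightarrow> (\<Sum>j<n. A i j) \<le> \<Delta>"
    and cut: "\<And>S T. S \<subseteq> {..<n} \<Longrightarrow> T \<subseteq> {..<n} \<Longrightarrow> \<bar>\<Sum>i\<in>S. \<Sum>j\<in>T. A i j - P i j\<bar> \<le> c"
    and small: "\<And>S. S \<subseteq> {..<n} \<Longrightarrow> real (card S) * K0\<^sup>2 \<le> real n \<Longrightarrow> (\<Sum>i\<in>S. \<Sum>j\<in>S. A i j) \<le> \<rho> * card S"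
  shows "(\<Sum>i<n. \<Sum>j<n. (A i j - P i j) * y i * y j)
     \<le> (4 * c * K1\<^sup>2 / n + t * \<rho> + \<Delta> / t + 2 * \<Delta> * K0 / K1 + 2 * \<pi> * n / K1) * (\<Sum>i<n. (y i)\<^sup>2)"
proof -
  define s where "s = (\<Sum>i<n. (y i)\<^sup>2)"
  show ?thesis
  proof (cases "s = 0")
    case True
    then have "\<And>i. i < n \<Longrightarrow> y i = 0" by (simp add: s_def sum_nonneg_eq_0_iff)
    then show ?thesis by simp
  next
    case False
    then have s: "s > 0" using sum_nonneg[of "{..<n}" "\<lambda>i. (y i)\<^sup>2"] by (simp add: s_def)
    have K1: "K1 > 0" using K by simp
    have pi: "\<pi> \<ge> 0" using P order_trans by blast
    define \<tau> where "\<tau> = sqrt (s / n)"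
    have \<tau>: "\<tau> > 0" "\<tau>\<^sup>2 = s / n" using s n by (auto simp: \<tau>_def)
    define H where "H = {i. i < n \<and> \<bar>y i\<bar> > K1 * \<tau>}"
    define S0 where "S0 = {i. i < n \<and> \<bar>y i\<bar> > K0 * \<tau>}"
    \<comment> \<open>Large coordinates are those above \<open>K1 \<tau>\<close>; \<open>S0\<close> also contains the medium ones.\<close>
    define xl where "xl = (\<lambda>i. if i \<in> H then 0 else y i)"
    define h where "h = (\<lambda>i. if i \<in> H then \<bar>y i\<bar> else 0)"
    define z where "z = (\<lambda>i. if i \<in> S0 then \<bar>y i\<bar> else 0)"
    have HS: "H \<subseteq> S0" using K \<tau> by (auto simp: H_def S0_def intro: order_le_less_trans[OF mult_right_mono])
    have S0sub: "S0 \<subseteq> {..<n}" and fin: "finite S0" by (auto simp: S0_def)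
    have cross: "A i j * \<bar>y i\<bar> * \<bar>y j\<bar> \<le> (K0 / K1) * (A i j * (y i)\<^sup>2)"
      if "i \<in> H" "j < n" "j \<notin> S0" for i j
    proof -
      have "\<bar>y j\<bar> \<le> K0 * \<tau>" using that by (auto simp: S0_def)
      also have "\<dots> = (K0 / K1) * (K1 * \<tau>)" using K1 by simp
      also have "\<dots> \<le> (K0 / K1) * \<bar>y i\<bar>" using that K K1 by (intro mult_left_mono) (auto simp: H_def)
      finally have "A i j * \<bar>y i\<bar> * \<bar>y j\<bar> \<le> A i j * \<bar>y i\<bar> * ((K0 / K1) * \<bar>y i\<bar>)"
        by (intro mult_left_mono) (auto simp: nonneg)
      also have "\<dots> = (K0 / K1) * (A i j * (\<bar>y i\<bar> * \<bar>y i\<bar>))" by (simp add: algebra_simps)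
      finally show ?thesis by (simp add: power2_eq_square)
    qed
    have pointwise: "(A i j - P i j) * y i * y j \<le> (A i j - P i j) * xl i * xl j + A i j * z i * z j
        + (K0 / K1) * (A i j * (y i)\<^sup>2) + (K0 / K1) * (A i j * (y j)\<^sup>2)
        + \<pi> * (h i * \<bar>y j\<bar>) + \<pi> * (h j * \<bar>y i\<bar>)" if ij: "i < n" "j < n" for i j
    proof -
      have nn: "0 \<le> A i j * z i * z j" "0 \<le> (K0 / K1) * (A i j * (y i)\<^sup>2)" "0 \<le> (K0 / K1) * (A i j * (y j)\<^sup>2)"
        "0 \<le> \<pi> * (h i * \<bar>y j\<bar>)" "0 \<le> \<pi> * (h j * \<bar>y i\<bar>)"
        using K K1 nonneg pi by (auto simp: z_def h_def)
      show ?thesis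
      proof (cases "i \<in> H \<or> j \<in> H")
        case False
        then show ?thesis using nn by (simp add: xl_def)
      next
        case True
        have 1: "A i j * y i * y j \<le> A i j * \<bar>y i\<bar> * \<bar>y j\<bar>"
          using mult_left_mono[OF abs_ge_self[of "y i * y j"] nonneg[of i j]] by (simp add: abs_mult mult.assoc)
        have 2: "A i j * \<bar>y i\<bar> * \<bar>y j\<bar> \<le> A i j * z i * z j
          + (K0 / K1) * (A i j * (y i)\<^sup>2) + (K0 / K1) * (A i j * (y j)\<^sup>2)"
        proof (cases "i \<in> S0 \<and> j \<in> S0")
          case True then show ?thesis using nn by (simp add: z_def)
        next
          case False
          then consider "i \<in> H" "j \<notin> S0" | "j \<in> H" "i \<notin> S0" using True HS by blast
          then show ?thesis
          proof cases
            case 1 then show ?thesis using cross[of i j] ij nn by linarith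
          next
            case 2 then show ?thesis using cross[of j i] ij nn by (simp add: sym[of j i] mult.commute mult.left_commute)
          qed
        qed
        have "- (P i j * y i * y j) \<le> P i j * (\<bar>y i\<bar> * \<bar>y j\<bar>)"
          using mult_left_mono[OF abs_ge_minus_self[of "y i * y j"] P(1)[of i j]] by (simp add: abs_mult mult.assoc)
        also have "\<dots> \<le> \<pi> * (\<bar>y i\<bar> * \<bar>y j\<bar>)" by (intro mult_right_mono P) auto
        also have "\<dots> \<le> \<pi> * (h i * \<bar>y j\<bar>) + \<pi> * (h j * \<bar>y i\<bar>)"
          using True nn by (auto simp: h_def mult.commute)
        finally have 3: "- (P i j * y i * y j) \<le> \<pi> * (h i * \<bar>y j\<bar>) + \<pi> * (h j * \<bar>y i\<bar>)" .
        have 4: "(A i j - P i j) * xl i * xl j = 0" using True by (auto simp: xl_def)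
        have "(A i j - P i j) * y i * y j = A i j * y i * y j + - (P i j * y i * y j)"
          by (simp add: left_diff_distrib)
        then show ?thesis using 1 2 3 4 by linarith
      qed
    qed
    have T1: "(\<Sum>i<n. \<Sum>j<n. (A i j - P i j) * xl i * xl j) \<le> 4 * (K1 * \<tau>)\<^sup>2 * c"
    proof -
      have "\<bar>\<Sum>i<n. \<Sum>j<n. (A i j - P i j) * xl i * xl j\<bar> \<le> 4 * (K1 * \<tau>)\<^sup>2 * c"
        using cut K1 \<tau> by (intro cut_bound_bilinear) (auto simp: xl_def H_def)
      then show ?thesis by simp
    qed
    have T2: "(\<Sum>i<n. \<Sum>j<n. A i j * z i * z j) \<le> (t * \<rho> + \<Delta> / t) * s"
    proof -
      have card: "real (card S0) * K0\<^sup>2 \<le> real n"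
      proof -
        have "real (card S0) * (K0 * \<tau>)\<^sup>2 = (\<Sum>i\<in>S0. (K0 * \<tau>)\<^sup>2)" by simp
        also have "\<dots> \<le> (\<Sum>i\<in>S0. (y i)\<^sup>2)"
          using K \<tau> by (intro sum_mono) (auto simp: S0_def abs_le_square_iff[symmetric])
        also have "\<dots> \<le> s" unfolding s_def using S0sub by (intro sum_mono2) auto
        finally have "real (card S0) * K0\<^sup>2 * (s / n) \<le> n * (s / n)" using \<tau> n by (simp add: power_mult_distrib)
        then show ?thesis using s n by (subst (asm) mult_le_cancel_right) auto
      qed
      have "(\<Sum>i<n. \<Sum>j<n. A i j * z i * z j) = (\<Sum>i\<in>S0. \<Sum>j<n. A i j * z i * z j)"
        using S0sub by (intro sum.mono_neutral_right) (auto simp: z_def)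
      also have "\<dots> = (\<Sum>i\<in>S0. \<Sum>j\<in>S0. A i j * z i * z j)"
        using S0sub by (intro sum.cong[OF refl] sum.mono_neutral_right) (auto simp: z_def)
      also have "\<dots> \<le> (\<Sum>j\<in>S0. (z j)\<^sup>2 * (t * \<rho> + (\<Sum>i\<in>S0. A i j) / t))"
      proof (rule degenerate_quadratic_form_le[OF fin t nonneg sym diag])
        fix T assume T: "T \<subseteq> S0"
        then have "real (card T) * K0\<^sup>2 \<le> real (card S0) * K0\<^sup>2"
          using fin by (intro mult_right_mono) (auto simp: card_mono)
        then show "(\<Sum>i\<in>T. \<Sum>j\<in>T. A i j) \<le> \<rho> * card T"
          using card T S0sub by (intro small) auto
      qed
      also have "\<dots> \<le> (\<Sum>j\<in>S0. (y j)\<^sup>2 * (t * \<rho> + \<Delta> / t))"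
      proof (rule sum_mono)
        fix j assume j: "j \<in> S0"
        have "(\<Sum>i\<in>S0. A i j) \<le> (\<Sum>i<n. A j i)"
          using S0sub by (subst sym) (intro sum_mono2, auto simp: nonneg)
        also have "\<dots> \<le> \<Delta>"
        proof (rule supp)
          have "0 < K0 * \<tau>" using K \<tau> by simp
          then show "j < n" "y j \<noteq> 0" using j by (auto simp: S0_def)
        qed
        finally show "(z j)\<^sup>2 * (t * \<rho> + (\<Sum>i\<in>S0. A i j) / t) \<le> (y j)\<^sup>2 * (t * \<rho> + \<Delta> / t)"
          using t j by (auto simp: z_def divide_right_mono intro!: mult_left_mono)
      qed
      also have "\<dots> = (\<Sum>j\<in>S0. (y j)\<^sup>2) * (t * \<rho> + \<Delta> / t)" by (simp add: sum_distrib_right)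
      also have "\<dots> \<le> s * (t * \<rho> + \<Delta> / t)"
        unfolding s_def using S0sub t bounds by (intro mult_right_mono sum_mono2) auto
      finally show ?thesis by (simp add: mult.commute)
    qed
    have T3: "(\<Sum>i<n. \<Sum>j<n. A i j * (y i)\<^sup>2) \<le> \<Delta> * s"
    proof -
      have "(\<Sum>i<n. \<Sum>j<n. A i j * (y i)\<^sup>2) = (\<Sum>i<n. (y i)\<^sup>2 * (\<Sum>j<n. A i j))"
        by (intro sum.cong refl) (simp add: sum_distrib_right mult.commute)
      also have "\<dots> \<le> (\<Sum>i<n. (y i)\<^sup>2 * \<Delta>)"
      proof (rule sum_mono)
        fix i assume "i \<in> {..<n}"
        then show "(y i)\<^sup>2 * (\<Sum>j<n. A i j) \<le> (y i)\<^sup>2 * \<Delta>"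
          using supp[of i] by (cases "y i = 0") (auto intro!: mult_left_mono)
      qed
      finally show ?thesis by (simp add: s_def sum_distrib_left mult.commute)
    qed
    have T3': "(\<Sum>i<n. \<Sum>j<n. A i j * (y j)\<^sup>2) \<le> \<Delta> * s"
      using T3 by (subst sum.swap) (simp add: sym)
    have T4: "(\<Sum>i<n. \<Sum>j<n. h i * \<bar>y j\<bar>) \<le> n / K1 * s"
    proof -
      have "h i \<le> (y i)\<^sup>2 / (K1 * \<tau>)" for i
      proof (cases "i \<in> H")
        case True
        then have "\<bar>y i\<bar> * (K1 * \<tau>) \<le> \<bar>y i\<bar> * \<bar>y i\<bar>" by (intro mult_left_mono) (auto simp: H_def)
        then show ?thesis using True K1 \<tau> by (simp add: h_def power2_eq_square field_simps)
      next
        case False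
        then show ?thesis using K1 \<tau> by (simp add: h_def)
      qed
      then have "(\<Sum>i<n. h i) \<le> (\<Sum>i<n. (y i)\<^sup>2 / (K1 * \<tau>))" by (intro sum_mono)
      then have h: "(\<Sum>i<n. h i) \<le> s / (K1 * \<tau>)" by (simp add: s_def sum_divide_distrib)
      have "(\<Sum>j<n. \<bar>y j\<bar>)\<^sup>2 \<le> (\<Sum>j<n. (y j)\<^sup>2) * (\<Sum>j<n. 1)"
        using Cauchy_Schwarz_ineq_sum[of "\<lambda>j. \<bar>y j\<bar>" "\<lambda>j. 1" "{..<n}"] by simp
      also have "\<dots> = (real n)\<^sup>2 * (s / n)" using n unfolding s_def[symmetric] by (simp add: power2_eq_square)
      also have "\<dots> = (n * \<tau>)\<^sup>2" by (simp add: power_mult_distrib \<tau>(2))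
      finally have y: "(\<Sum>j<n. \<bar>y j\<bar>) \<le> n * \<tau>"
        using \<tau> by (rule_tac power2_le_imp_le) auto
      have "(\<Sum>i<n. \<Sum>j<n. h i * \<bar>y j\<bar>) = (\<Sum>i<n. h i) * (\<Sum>j<n. \<bar>y j\<bar>)" by (simp add: sum_product)
      also have "\<dots> \<le> (s / (K1 * \<tau>)) * (n * \<tau>)"
        using h y K1 \<tau> s by (intro mult_mono) (auto simp: h_def intro!: sum_nonneg)
      also have "\<dots> = n / K1 * s" using \<tau> by simp
      finally show ?thesis .
    qed
    have T4': "(\<Sum>i<n. \<Sum>j<n. h j * \<bar>y i\<bar>) \<le> n / K1 * s"
      using T4 by (subst sum.swap)
    have "(\<Sum>i<n. \<Sum>j<n. (A i j - P i j) * y i * y j) \<le> (\<Sum>i<n. \<Sum>j<n.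
        (A i j - P i j) * xl i * xl j + A i j * z i * z j
        + (K0 / K1) * (A i j * (y i)\<^sup>2) + (K0 / K1) * (A i j * (y j)\<^sup>2)
        + \<pi> * (h i * \<bar>y j\<bar>) + \<pi> * (h j * \<bar>y i\<bar>))"
      by (intro sum_mono pointwise) auto
    also have "\<dots> = (\<Sum>i<n. \<Sum>j<n. (A i j - P i j) * xl i * xl j) + (\<Sum>i<n. \<Sum>j<n. A i j * z i * z j)
        + (K0 / K1) * (\<Sum>i<n. \<Sum>j<n. A i j * (y i)\<^sup>2) + (K0 / K1) * (\<Sum>i<n. \<Sum>j<n. A i j * (y j)\<^sup>2)
        + \<pi> * (\<Sum>i<n. \<Sum>j<n. h i * \<bar>y j\<bar>) + \<pi> * (\<Sum>i<n. \<Sum>j<n. h j * \<bar>y i\<bar>)"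
      by (simp only: sum.distrib sum_distrib_left)
    also have "\<dots> \<le> 4 * (K1 * \<tau>)\<^sup>2 * c + (t * \<rho> + \<Delta> / t) * s + (K0 / K1) * (\<Delta> * s) + (K0 / K1) * (\<Delta> * s)
        + \<pi> * (n / K1 * s) + \<pi> * (n / K1 * s)"
      using K K1 pi by (intro add_mono T1 T2 mult_left_mono T3 T3' T4 T4') auto
    also have "\<dots> = (4 * c * K1\<^sup>2 / n + t * \<rho> + \<Delta> / t + 2 * \<Delta> * K0 / K1 + 2 * \<pi> * n / K1) * s"
      by (simp add: power_mult_distrib \<tau>(2) algebra_simps)
    finally show ?thesis by (simp add: s_def)
  qed
qed

section \<open>Eigenvectors and perturbed invariant subspaces\<close>

text \<open>
  A zero row turns the coefficients into a singular square matrix.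
\<close>

lemma homogeneous_system_nontrivial:
  fixes C :: "nat \<Rightarrow> nat \<Rightarrow> real"
  shows "\<exists>c. (\<exists>l<Suc k. c l \<noteq> 0) \<and> (\<forall>j<k. (\<Sum>l<Suc k. C j l * c l) = 0)"
proof -
  define M where "M = mat (Suc k) (Suc k) (\<lambda>(j,l). if j < k then C j l else 0)"
  have M: "M \<in> carrier_mat (Suc k) (Suc k)" by (simp add: M_def)
  have "M = mat\<^sub>r (Suc k) (Suc k) (\<lambda>i. if i = k then 0\<^sub>v (Suc k) else vec (Suc k) (C i))"
    by (rule eq_matI) (auto simp: M_def)
  then have "det M = 0"
    using det_row_0[of k "Suc k" "\<lambda>i. vec (Suc k) (C i)"] by simp
  then obtain v where v: "v \<in> carrier_vec (Suc k)" "v \<noteq> 0\<^sub>v (Suc k)" "M *\<^sub>v v = 0\<^sub>v (Suc k)"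
    using det_0_iff_vec_prod_zero[OF M] by blast
  have "\<exists>l<Suc k. v $ l \<noteq> 0"
    using v by (metis carrier_vecD eq_vecI index_zero_vec)
  moreover have "(\<Sum>l<Suc k. C j l * v $ l) = 0" if "j < k" for j
  proof -
    have "(M *\<^sub>v v) $ j = (\<Sum>l<Suc k. C j l * v $ l)"
      using v(1) that by (auto simp: M_def scalar_prod_def atLeast0LessThan simp del: sum.lessThan_Suc intro!: sum.cong)
    then show ?thesis using v(3) that by simp
  qed
  ultimately show ?thesis by (intro exI[of _ "\<lambda>l. v $ l"]) blast
qed

lemma orthonormal_complete:
  fixes v :: "nat \<Rightarrow> nat \<Rightarrow> real"
  assumes on: "\<And>l m. l < n \<Longrightarrow> m < n \<Longrightarrow> (\<Sum>i<n. v l i * v m i) = (if l = m then 1 else 0)"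
    and ij: "i < n" "j < n"
  shows "(\<Sum>l<n. v l i * v l j) = (if i = j then 1 else 0)"
proof -
  define V where "V = mat n n (\<lambda>(l,i). v l i)"
  have V: "V \<in> carrier_mat n n" by (simp add: V_def)
  have "V * transpose_mat V = 1\<^sub>m n"
    by (rule eq_matI) (auto simp: V_def scalar_prod_def atLeast0LessThan on)
  then have "transpose_mat V * V = 1\<^sub>m n"
    using mat_mult_left_right_inverse[OF V] V by simp
  then have "(transpose_mat V * V) $$ (i, j) = (if i = j then 1 else 0)" using ij by simp
  then show ?thesis using ij by (simp add: V_def scalar_prod_def atLeast0LessThan)
qed

locale orthonormal_basis =
  fixes n :: nat and v :: "nat \<Rightarrow> nat \<Rightarrow> real"
  assumes orthonormal: "\<And>l m. l < n \<Longrightarrow> m < n \<Longrightarrow> (\<Sum>i<n. v l i * v m i) = (if l = m then 1 else 0)"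
begin

lemmas complete = orthonormal_complete[OF orthonormal]

definition coord :: "nat \<Rightarrow> (nat \<Rightarrow> real) \<Rightarrow> real" where
  "coord l x = (\<Sum>i<n. v l i * x i)"

lemma parseval: "(\<Sum>l<n. coord l x * coord l y) = (\<Sum>i<n. x i * y i)"
proof -
  have "(\<Sum>l<n. coord l x * coord l y) = (\<Sum>l<n. \<Sum>i<n. \<Sum>j<n. (v l i * v l j) * (x i * y j))"
    by (simp add: coord_def sum_product algebra_simps)
  also have "\<dots> = (\<Sum>i<n. \<Sum>j<n. (\<Sum>l<n. v l i * v l j) * (x i * y j))"
    by (subst sum.swap, rule sum.cong[OF refl], subst sum.swap) (simp add: sum_distrib_right)
  also have "\<dots> = (\<Sum>i<n. \<Sum>j<n. if i = j then x i * y j else 0)"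
    by (intro sum.cong refl) (auto simp: complete)
  finally show ?thesis by simp
qed

lemma parseval_sq: "(\<Sum>l<n. (coord l x)\<^sup>2) = (\<Sum>i<n. (x i)\<^sup>2)"
  using parseval[of x x] by (simp add: power2_eq_square)

lemma coord_cong: "(\<And>i. i < n \<Longrightarrow> x i = y i) \<Longrightarrow> coord l x = coord l y"
  by (simp add: coord_def)

lemma coord_add: "coord l (\<lambda>i. x i + y i) = coord l x + coord l y"
  by (simp add: coord_def algebra_simps sum.distrib)

lemma coord_sum: "coord l (\<lambda>i. \<Sum>j\<in>J. c j * u j i) = (\<Sum>j\<in>J. c j * coord l (u j))"
  unfolding coord_def
  by (simp add: sum_distrib_left algebra_simps) (rule sum.swap)

end

locale symmetric_eigenbasis = orthonormal_basis +
  fixes A :: "nat \<Rightarrow> nat \<Rightarrow> real" and ev :: "nat \<Rightarrow> real"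
  assumes sym: "\<And>i j. i < n \<Longrightarrow> j < n \<Longrightarrow> A i j = A j i"
    and eigen: "\<And>l i. l < n \<Longrightarrow> i < n \<Longrightarrow> (\<Sum>j<n. A i j * v l j) = ev l * v l i"
    and decreasing: "\<And>l m. l \<le> m \<Longrightarrow> m < n \<Longrightarrow> ev m \<le> ev l"
begin

lemma coord_mult: "l < n \<Longrightarrow> coord l (\<lambda>i. \<Sum>j<n. A i j * x j) = ev l * coord l x"
proof -
  assume l: "l < n"
  have "coord l (\<lambda>i. \<Sum>j<n. A i j * x j) = (\<Sum>i<n. \<Sum>j<n. v l i * A i j * x j)"
    by (simp add: coord_def sum_distrib_left algebra_simps)
  also have "\<dots> = (\<Sum>j<n. (\<Sum>i<n. A j i * v l i) * x j)"
    by (subst sum.swap) (auto simp: sum_distrib_right sym intro!: sum.cong)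
  also have "\<dots> = (\<Sum>j<n. ev l * v l j * x j)" by (intro sum.cong refl) (simp add: eigen l)
  finally show ?thesis by (simp add: coord_def sum_distrib_left algebra_simps)
qed

lemma quadratic_form_eq: "(\<Sum>i<n. \<Sum>j<n. A i j * x i * x j) = (\<Sum>l<n. ev l * (coord l x)\<^sup>2)"
proof -
  have "(\<Sum>i<n. \<Sum>j<n. A i j * x i * x j) = (\<Sum>i<n. x i * (\<Sum>j<n. A i j * x j))"
    by (simp add: sum_distrib_left algebra_simps)
  also have "\<dots> = (\<Sum>l<n. coord l x * coord l (\<lambda>i. \<Sum>j<n. A i j * x j))" by (simp add: parseval)
  also have "\<dots> = (\<Sum>l<n. ev l * (coord l x)\<^sup>2)"
    by (intro sum.cong refl) (simp add: coord_mult power2_eq_square)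
  finally show ?thesis .
qed

text \<open>
  The easy half of the Courant-Fischer principle: the span of the first \<open>k + 1\<close> eigenvectors contains a
  nonzero vector that satisfies \<open>k\<close> linear constraints, and the form is at least \<open>ev k\<close> there.
\<close>

lemma eigenvalue_le_of_constrained_form:
  fixes g :: "nat \<Rightarrow> nat \<Rightarrow> real"
  assumes kn: "k < n"
    and form: "\<And>x. (\<And>j. j < k \<Longrightarrow> (\<Sum>i<n. g j i * x i) = 0)
       \<Longrightarrow> (\<Sum>i<n. \<Sum>j<n. A i j * x i * x j) \<le> \<delta> * (\<Sum>i<n. (x i)\<^sup>2)"
  shows "ev k \<le> \<delta>"
proof -
  obtain c where c: "\<exists>l<Suc k. c l \<noteq> 0" "\<And>j. j < k \<Longrightarrow> (\<Sum>l<Suc k. (\<Sum>i<n. g j i * v l i) * c l) = 0"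
    using homogeneous_system_nontrivial[of k "\<lambda>j l. \<Sum>i<n. g j i * v l i"] by blast
  define x where "x = (\<lambda>i. \<Sum>l<Suc k. c l * v l i)"
  have cx: "coord l x = (if l < Suc k then c l else 0)" if "l < n" for l
  proof -
    have "coord l x = (\<Sum>m<Suc k. c m * coord l (v m))"
      unfolding x_def by (rule coord_sum)
    also have "\<dots> = (\<Sum>m<Suc k. if m = l then c l else 0)"
      using that kn by (intro sum.cong refl) (auto simp: coord_def orthonormal)
    finally show ?thesis by auto
  qed
  have "(\<Sum>i<n. g j i * x i) = 0" if "j < k" for j
  proof -
    have "(\<Sum>i<n. g j i * x i) = (\<Sum>i<n. \<Sum>l<Suc k. g j i * v l i * c l)"
      unfolding x_def by (simp only: sum_distrib_left mult.assoc mult.commute[of "v _ _"])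
    also have "\<dots> = (\<Sum>l<Suc k. (\<Sum>i<n. g j i * v l i) * c l)"
      by (subst sum.swap) (simp only: sum_distrib_right)
    finally show ?thesis using c that by simp
  qed
  then have "(\<Sum>l<n. ev l * (coord l x)\<^sup>2) \<le> \<delta> * (\<Sum>l<n. (coord l x)\<^sup>2)"
    using form[of x] by (simp add: quadratic_form_eq parseval_sq)
  moreover have "(\<Sum>l<n. ev k * (coord l x)\<^sup>2) \<le> (\<Sum>l<n. ev l * (coord l x)\<^sup>2)"
  proof (rule sum_mono)
    fix l assume "l \<in> {..<n}"
    then show "ev k * (coord l x)\<^sup>2 \<le> ev l * (coord l x)\<^sup>2"
      using decreasing[of l k] kn by (cases "l < Suc k") (auto simp: cx intro!: mult_right_mono)
  qed
  ultimately have "ev k * (\<Sum>l<n. (coord l x)\<^sup>2) \<le> \<delta> * (\<Sum>l<n. (coord l x)\<^sup>2)"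
    by (simp add: sum_distrib_left)
  moreover have "(\<Sum>l<n. (coord l x)\<^sup>2) > 0"
  proof -
    obtain l where l: "l < Suc k" "c l \<noteq> 0" using c by blast
    then show ?thesis using kn by (intro sum_pos2[of _ l]) (auto simp: cx)
  qed
  ultimately show ?thesis by simp
qed

text \<open>
  A signed Davis-Kahan estimate. For a fixed lower eigenvector, the coordinates of the almost invariant
  vectors \<open>u j\<close> satisfy a Sylvester-type equation in which the block form \<open>B\<close> exceeds the eigenvalue by
  the gap. Eigenvalues are bounded only from above, so large negative ones do no harm.
\<close>

lemma sin_theta_bound:
  fixes u r :: "nat \<Rightarrow> nat \<Rightarrow> real" and B :: "nat \<Rightarrow> nat \<Rightarrow> real"
  assumes top: "ev k \<le> \<delta>" and gap: "\<delta> < \<kappa>"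
    and Bpos: "\<And>z. (\<Sum>j<k. \<Sum>m<k. B j m * z j * z m) \<ge> \<kappa> * (\<Sum>j<k. (z j)\<^sup>2)"
    and r: "\<And>j i. j < k \<Longrightarrow> i < n \<Longrightarrow> (\<Sum>m<n. A i m * u j m) = (\<Sum>m<k. B j m * u m i) + r j i"
  shows "(\<kappa> - \<delta>)\<^sup>2 * (\<Sum>j<k. \<Sum>l\<in>{k..<n}. (coord l (u j))\<^sup>2) \<le> (\<Sum>j<k. \<Sum>i<n. (r j i)\<^sup>2)"
proof -
  have one: "(\<kappa> - \<delta>)\<^sup>2 * (\<Sum>j<k. (coord l (u j))\<^sup>2) \<le> (\<Sum>j<k. (coord l (r j))\<^sup>2)" if l: "l \<in> {k..<n}" for l
  proof -
    define y where "y = (\<lambda>j. coord l (u j))"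
    define \<rho> where "\<rho> = (\<lambda>j. coord l (r j))"
    have eq: "ev l * y j = (\<Sum>m<k. B j m * y m) + \<rho> j" if "j < k" for j
    proof -
      have "ev l * y j = coord l (\<lambda>i. \<Sum>m<n. A i m * u j m)" using l by (simp add: coord_mult y_def)
      also have "\<dots> = coord l (\<lambda>i. (\<Sum>m<k. B j m * u m i) + r j i)" using r that by (intro coord_cong) auto
      also have "\<dots> = (\<Sum>m<k. B j m * y m) + \<rho> j" by (simp add: coord_add coord_sum y_def \<rho>_def)
      finally show ?thesis .
    qed
    define Y where "Y = (\<Sum>j<k. (y j)\<^sup>2)"
    have Y: "Y \<ge> 0" by (simp add: Y_def sum_nonneg)
    have "ev l * Y = (\<Sum>j<k. y j * (ev l * y j))" by (simp add: Y_def sum_distrib_left power2_eq_square algebra_simps)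
    also have "\<dots> = (\<Sum>j<k. \<Sum>m<k. B j m * y j * y m) + (\<Sum>j<k. y j * \<rho> j)"
      by (simp add: eq sum_distrib_left algebra_simps sum.distrib)
    also have "\<dots> \<ge> \<kappa> * Y + (\<Sum>j<k. y j * \<rho> j)" using Bpos[of y] by (simp add: Y_def)
    finally have "\<kappa> * Y + (\<Sum>j<k. y j * \<rho> j) \<le> ev l * Y" .
    moreover have "ev l * Y \<le> \<delta> * Y"
      using decreasing[of k l] l top Y by (intro mult_right_mono) auto
    ultimately have 1: "(\<kappa> - \<delta>) * Y \<le> - (\<Sum>j<k. y j * \<rho> j)" by (simp add: algebra_simps)
    have "((\<kappa> - \<delta>) * Y)\<^sup>2 \<le> (- (\<Sum>j<k. y j * \<rho> j))\<^sup>2"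
      using 1 gap Y by (intro power_mono) auto
    also have "\<dots> \<le> Y * (\<Sum>j<k. (\<rho> j)\<^sup>2)"
      using Cauchy_Schwarz_ineq_sum[of y \<rho> "{..<k}"] by (simp add: Y_def)
    finally have 2: "Y * ((\<kappa> - \<delta>)\<^sup>2 * Y) \<le> Y * (\<Sum>j<k. (\<rho> j)\<^sup>2)" by (simp add: power2_eq_square algebra_simps)
    show ?thesis
    proof (cases "Y = 0")
      case True then show ?thesis by (simp add: Y_def y_def sum_nonneg)
    next
      case False
      with Y 2 have "(\<kappa> - \<delta>)\<^sup>2 * Y \<le> (\<Sum>j<k. (\<rho> j)\<^sup>2)" by (subst (asm) mult_le_cancel_left_pos) auto
      then show ?thesis by (simp add: Y_def y_def \<rho>_def)
    qed
  qed
  have "(\<kappa> - \<delta>)\<^sup>2 * (\<Sum>j<k. \<Sum>l\<in>{k..<n}. (coord l (u j))\<^sup>2) = (\<Sum>l\<in>{k..<n}. (\<kappa> - \<delta>)\<^sup>2 * (\<Sum>j<k. (coord l (u j))\<^sup>2))"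
    by (subst sum.swap) (simp add: sum_distrib_left)
  also have "\<dots> \<le> (\<Sum>l\<in>{k..<n}. \<Sum>j<k. (coord l (r j))\<^sup>2)" by (intro sum_mono one)
  also have "\<dots> \<le> (\<Sum>l<n. \<Sum>j<k. (coord l (r j))\<^sup>2)" by (intro sum_mono2) (auto intro: sum_nonneg)
  also have "\<dots> = (\<Sum>j<k. \<Sum>i<n. (r j i)\<^sup>2)" by (subst sum.swap) (simp add: parseval_sq)
  finally show ?thesis .
qed

end

text \<open>
  With \<open>k\<close> labels available, \<open>k\<close> groups that are all represented and use disjoint sets of labels
  use exactly one label each.
\<close>

lemma label_permutation:
  fixes \<Phi> \<Psi> :: "'b \<Rightarrow> nat"
  assumes \<Phi>: "\<And>i. i \<in> S \<Longrightarrow> \<Phi> i < k"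
    and sep: "\<And>i j. i \<in> S \<Longrightarrow> j \<in> S \<Longrightarrow> \<Phi> i = \<Phi> j \<Longrightarrow> \<Psi> i = \<Psi> j"
    and rep: "\<And>j. j < k \<Longrightarrow> \<exists>i\<in>S. \<Psi> i = j"
  shows "\<exists>\<pi>. \<pi> permutes {..<k} \<and> (\<forall>i\<in>S. \<pi> (\<Phi> i) = \<Psi> i)"
proof -
  obtain g where g: "\<And>j. j < k \<Longrightarrow> g j \<in> S \<and> \<Psi> (g j) = j" using rep by metis
  \<comment> \<open>the label of a representative of each group\<close>
  define \<sigma> where "\<sigma> = (\<lambda>j. if j < k then \<Phi> (g j) else j)"
  have inj: "inj_on \<sigma> {..<k}"
    using g sep by (auto simp: inj_on_def \<sigma>_def) metis
  have "\<sigma> ` {..<k} \<subseteq> {..<k}" using g \<Phi> by (auto simp: \<sigma>_def)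
  then have "\<sigma> permutes {..<k}"
    using inj endo_inj_surj[of "{..<k}" \<sigma>]
    by (intro bij_imp_permutes) (auto simp: bij_betw_def \<sigma>_def)
  then have perm: "inv_into UNIV \<sigma> permutes {..<k}" and bij: "bij \<sigma>" by (auto simp: permutes_inv permutes_bij)
  have "inv_into UNIV \<sigma> (\<Phi> i) = \<Psi> i" if i: "i \<in> S" for i
  proof -
    have "\<Phi> i \<in> \<sigma> ` {..<k}" using \<Phi>[OF i] permutes_image[OF \<open>\<sigma> permutes {..<k}\<close>] by simp
    then obtain j where j: "j < k" "\<Phi> i = \<sigma> j" by blast
    then have "\<Psi> i = j" using sep[OF i, of "g j"] g[of j] by (simp add: \<sigma>_def)
    then show ?thesis using j bij by (simp add: bij_is_inj)
  qed
  with perm show ?thesis by blast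
qed

section \<open>Misclassification by approximate k-means\<close>

text \<open>
  Entrywise form of an eigenbasis, which replaces matrix and vector types by plain sums.
\<close>

lemma top_eigenvectors_basis:
  assumes top: "top_eigenvectors k A U" and A: "A \<in> carrier_mat n n"
    and sym: "\<And>i j. i < n \<Longrightarrow> j < n \<Longrightarrow> A $$ (i, j) = A $$ (j, i)"
  obtains v ev where "symmetric_eigenbasis n v (\<lambda>i j. A $$ (i, j)) ev"
    and "\<And>i l. i < n \<Longrightarrow> l < k \<Longrightarrow> U $$ (i, l) = v l i" and "U \<in> carrier_mat n k" and "k \<le> n"
proof -
  have dim: "dim_row A = n" using A by simp
  obtain w ev where k: "k \<le> n" and U: "U \<in> carrier_mat n k"
    and eig: "\<forall>i<n. eigenvector A (w i) (ev i)"
    and on: "\<forall>i<n. \<forall>j<n. scalar_prod (w i) (w j) = (if i = j then 1 else (0::real))"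
    and dec: "\<forall>i j. i \<le> j \<and> j < n \<longrightarrow> ev j \<le> ev i"
    and col: "\<forall>l<k. col U l = w l"
    using top unfolding top_eigenvectors_def dim by (elim conjE exE) (rule that; assumption)
  have w: "w l \<in> carrier_vec n" "A *\<^sub>v w l = ev l \<cdot>\<^sub>v w l" if "l < n" for l
    using eig that dim by (auto simp: eigenvector_def)
  show ?thesis
  proof (rule that[of "\<lambda>l i. w l $ i" ev])
    show "symmetric_eigenbasis n (\<lambda>l i. w l $ i) (\<lambda>i j. A $$ (i, j)) ev"
    proof unfold_locales
      fix l m assume "l < n" "m < n"
      then have "scalar_prod (w l) (w m) = (if l = m then 1 else 0)" and "dim_vec (w m) = n"
        using on w(1)[of m] by auto
      then show "(\<Sum>i<n. w l $ i * w m $ i) = (if l = m then 1 else 0)"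
        by (simp add: scalar_prod_def atLeast0LessThan)
    next
      fix l i assume l: "l < n" and i: "i < n"
      have "(\<Sum>j<n. A $$ (i, j) * w l $ j) = (A *\<^sub>v w l) $ i"
        using A w(1)[OF l] i by (simp add: scalar_prod_def atLeast0LessThan)
      then show "(\<Sum>j<n. A $$ (i, j) * w l $ j) = ev l * w l $ i"
        using w[OF l] i by simp
    qed (use sym dec in auto)
    show "U $$ (i, l) = w l $ i" if "i < n" "l < k" for i l
      using col U that by (metis carrier_matD index_col)
  qed (use k U in auto)
qed

lemma finite_cluster [simp]: "finite (cluster n \<Phi> j)"
  by (simp add: cluster_def)

lemma sum_clusters:
  assumes "\<Phi> \<in> {..<n} \<rightarrow> {..<k}"
  shows "(\<Sum>j<k. \<Sum>i\<in>cluster n \<Phi> j. h i) = (\<Sum>i<n. h i)"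
proof -
  have "cluster n \<Phi> = (\<lambda>j. {i \<in> {..<n}. \<Phi> i = j})" by (auto simp: cluster_def)
  then show ?thesis using assms by (simp only:, intro sum.group) auto
qed

lemma kmeans_cost_eq:
  assumes U: "U \<in> carrier_mat n m" and \<Phi>: "\<Phi> \<in> {..<n} \<rightarrow> {..<k}"
  shows "kmeans_cost k U \<Phi> = (\<Sum>i<n. \<Sum>l<m. (U $$ (i, l) - centroid U \<Phi> (\<Phi> i) $ l)\<^sup>2)"
proof -
  have "kmeans_cost k U \<Phi> = (\<Sum>j<k. \<Sum>i\<in>cluster n \<Phi> j. \<Sum>l<m. (U $$ (i, l) - centroid U \<Phi> (\<Phi> i) $ l)\<^sup>2)"
    using U unfolding kmeans_cost_def
    by (intro sum.cong refl)
       (auto simp: sq_norm2_def scalar_prod_def centroid_def cluster_def atLeast0LessThan power2_eq_square intro!: sum.cong)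
  then show ?thesis by (simp only: sum_clusters[OF \<Phi>])
qed

lemma approx_kmeans_le:
  assumes U: "U \<in> carrier_mat n m" and km: "approx_kmeans k \<epsilon> U \<Phi>" and \<Psi>: "\<Psi> \<in> {..<n} \<rightarrow> {..<k}" and "\<epsilon> \<ge> 0"
  shows "kmeans_cost k U \<Phi> \<le> (1 + \<epsilon>) * kmeans_cost k U \<Psi>"
proof -
  have dim: "dim_row U = n" using U by simp
  let ?\<Psi> = "restrict \<Psi> {..<n}"
  have cl: "cluster n ?\<Psi> j = cluster n \<Psi> j" for j by (auto simp: cluster_def)
  have "kmeans_cost k U ?\<Psi> = kmeans_cost k U \<Psi>"
    by (simp add: kmeans_cost_def centroid_def dim cl)
  moreover have "?\<Psi> \<in> {..<n} \<rightarrow>\<^sub>E {..<k}" using \<Psi> by (simp add: restrict_PiE_iff Pi_iff)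
  ultimately have "Min (kmeans_cost k U ` ({..<n} \<rightarrow>\<^sub>E {..<k})) \<le> kmeans_cost k U \<Psi>"
    by (intro Min_le finite_imageI finite_PiE image_eqI[of _ _ ?\<Psi>]) simp_all
  then have "(1 + \<epsilon>) * Min (kmeans_cost k U ` ({..<n} \<rightarrow>\<^sub>E {..<k})) \<le> (1 + \<epsilon>) * kmeans_cost k U \<Psi>"
    using \<open>\<epsilon> \<ge> 0\<close> by (intro mult_left_mono) auto
  with km show ?thesis by (simp add: approx_kmeans_def dim)
qed

lemma card_cluster_bounds:
  assumes "j < k"
  shows "n_min n k \<Psi> \<le> card (cluster n \<Psi> j)" "card (cluster n \<Psi> j) \<le> n_max n k \<Psi>"
  using assms unfolding n_min_def n_max_def by (auto intro!: Min_le Max_ge)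

lemma err_le_of_matching:
  assumes S: "S \<subseteq> {..<n}" and \<pi>: "\<pi> permutes {..<k}" "\<And>i. i \<in> S \<Longrightarrow> \<pi> (\<Phi> i) = \<Psi> i" and n: "n > 0"
  shows "err n k \<Psi> \<Phi> \<le> card ({..<n} - S) / n"
proof -
  have "Min ((\<lambda>\<pi>. card {i. i < n \<and> \<Psi> i \<noteq> \<pi> (\<Phi> i)}) ` {\<pi>. \<pi> permutes {..<k}})
      \<le> card {i. i < n \<and> \<Psi> i \<noteq> \<pi> (\<Phi> i)}"
    using \<pi> by (intro Min_le) (auto simp: finite_permutations)
  also have "\<dots> \<le> card ({..<n} - S)" using \<pi>(2) by (intro card_mono) auto
  finally show ?thesis using n unfolding err_def by (intro divide_right_mono) auto
qed

lemma sum_sq_le_twice: "(a + b)\<^sup>2 \<le> 2 * a\<^sup>2 + 2 * (b::real)\<^sup>2"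
proof -
  have "0 \<le> (a - b)\<^sup>2" by simp
  then show ?thesis by (simp add: power2_eq_square algebra_simps)
qed

definition unit_indicator :: "nat \<Rightarrow> (nat \<Rightarrow> nat) \<Rightarrow> nat \<Rightarrow> nat \<Rightarrow> real" where
  "unit_indicator n \<Psi> j i = (if \<Psi> i = j then 1 / sqrt (card (cluster n \<Psi> j)) else 0)"

lemma sum_unit_indicator:
  "(\<Sum>i<n. f i * unit_indicator n \<Psi> j i) = (\<Sum>i\<in>cluster n \<Psi> j. f i) / sqrt (card (cluster n \<Psi> j))"
proof -
  have "(\<Sum>i<n. f i * unit_indicator n \<Psi> j i) = (\<Sum>i\<in>cluster n \<Psi> j. f i * unit_indicator n \<Psi> j i)"
    by (intro sum.mono_neutral_right) (auto simp: cluster_def unit_indicator_def)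
  also have "\<dots> = (\<Sum>i\<in>cluster n \<Psi> j. f i / sqrt (card (cluster n \<Psi> j)))"
    by (intro sum.cong) (auto simp: cluster_def unit_indicator_def)
  finally show ?thesis by (simp add: sum_divide_distrib)
qed

text \<open>
  The projection to the top \<open>k\<close> eigenvectors almost preserves the indicators. Hence the rows of \<open>U\<close>
  have total squared distance at most \<open>\<xi>\<close> from the centroids \<open>z\<close> of the true clusters, and the
  centroids inherit the mutual distances of the scaled indicators up to the factor \<open>1 - \<xi>\<close>. Nodes
  where the centroid assigned by \<open>\<Phi>\<close> is close to the true one are labelled consistently; the
  remaining ones are counted by Markov's inequality and do not exhaust any cluster.
\<close>

lemma (in orthonormal_basis) err_le_of_projection:
  fixes U :: "real mat" and \<xi> \<epsilon> :: real
  assumes U: "U \<in> carrier_mat n k" "\<And>i l. i < n \<Longrightarrow> l < k \<Longrightarrow> U $$ (i, l) = v l i" and kn: "k \<le> n"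
    and km: "approx_kmeans k \<epsilon> U \<Phi>" and \<epsilon>: "\<epsilon> \<ge> 0"
    and \<Psi>: "\<Psi> \<in> {..<n} \<rightarrow> {..<k}" and pos: "n_min n k \<Psi> > 0"
    and \<xi>: "(\<Sum>j<k. \<Sum>l\<in>{k..<n}. (coord l (unit_indicator n \<Psi> j))\<^sup>2) \<le> \<xi>" "\<xi> \<le> 1 / 2"
    and small: "8 * (2 + \<epsilon>) * n_max n k \<Psi> * \<xi> < n_min n k \<Psi>"
    and n: "n > 0"
  shows "err n k \<Psi> \<Phi> \<le> 8 * (2 + \<epsilon>) * n_max n k \<Psi> * \<xi> / n"
proof -
  define c where "c = (\<lambda>j. real (card (cluster n \<Psi> j)))"
  define nM where "nM = real (n_max n k \<Psi>)"
  have \<Phi>: "\<Phi> \<in> {..<n} \<rightarrow> {..<k}" using km U(1) by (simp add: approx_kmeans_def)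
  have cpos: "c j > 0" "c j \<le> nM" if "j < k" for j
    using card_cluster_bounds[OF that, of n \<Psi>] pos by (auto simp: c_def nM_def)
  have \<Psi>k: "\<Psi> i < k" if "i < n" for i using \<Psi> that by auto
  have nM: "nM > 0" using cpos[OF \<Psi>k[OF n]] by linarith
  define z where "z = (\<lambda>j l. (\<Sum>i\<in>cluster n \<Psi> j. v l i) / c j)"
  define y where "y = (\<lambda>j l. coord l (unit_indicator n \<Psi> j))"
  have yz: "y j l = sqrt (c j) * z j l" if "j < k" for j l
  proof -
    have "sqrt (c j) / c j = 1 / sqrt (c j)"
      using cpos[OF that] by (simp add: sqrt_divide_self_eq inverse_eq_divide)
    moreover have "y j l = (\<Sum>i\<in>cluster n \<Psi> j. v l i) * (1 / sqrt (c j))"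
      unfolding y_def coord_def sum_unit_indicator c_def by simp
    moreover have "sqrt (c j) * z j l = (\<Sum>i\<in>cluster n \<Psi> j. v l i) * (sqrt (c j) / c j)"
      by (simp add: z_def)
    ultimately show ?thesis by simp
  qed
  have ynorm: "(\<Sum>l<n. (y j l)\<^sup>2) = 1" if "j < k" for j
  proof -
    have "(\<Sum>l<n. (y j l)\<^sup>2) = (\<Sum>i<n. unit_indicator n \<Psi> j i * unit_indicator n \<Psi> j i)"
      using parseval[of "unit_indicator n \<Psi> j" "unit_indicator n \<Psi> j"] unfolding y_def power2_eq_square .
    also have "\<dots> = (\<Sum>i\<in>cluster n \<Psi> j. 1 / sqrt (c j)) / sqrt (c j)"
      unfolding sum_unit_indicator c_def by (simp add: unit_indicator_def cluster_def)
    also have "\<dots> = c j / (sqrt (c j) * sqrt (c j))" by (simp add: c_def)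
    also have "\<dots> = 1" using cpos[OF that] by simp
    finally show ?thesis .
  qed
  have yorth: "(\<Sum>l<n. y j l * y j' l) = 0" if "j \<noteq> j'" for j j'
  proof -
    have "unit_indicator n \<Psi> j i * unit_indicator n \<Psi> j' i = 0" for i
      using that by (simp add: unit_indicator_def)
    then show ?thesis
      using parseval[of "unit_indicator n \<Psi> j" "unit_indicator n \<Psi> j'"] unfolding y_def by (simp only: \<open>\<And>i. _ = 0\<close> sum.neutral_const)
  qed
  have split: "(\<Sum>l<n. h l) = (\<Sum>l<k. h l) + (\<Sum>l\<in>{k..<n}. h l)" for h :: "nat \<Rightarrow> real"
    using kn by (metis lessThan_atLeast0 sum.atLeastLessThan_concat zero_le)
  have cost\<Psi>: "kmeans_cost k U \<Psi> \<le> \<xi>"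
  proof -
    have "kmeans_cost k U \<Psi> = (\<Sum>i<n. \<Sum>l<k. (v l i - z (\<Psi> i) l)\<^sup>2)"
      unfolding kmeans_cost_eq[OF U(1) \<Psi>] using U
      by (intro sum.cong refl) (auto simp: centroid_def z_def c_def cluster_def)
    also have "\<dots> = (\<Sum>l<k. \<Sum>i<n. (v l i - z (\<Psi> i) l)\<^sup>2)" by (rule sum.swap)
    also have "\<dots> = (\<Sum>l<k. 1 - (\<Sum>j<k. (y j l)\<^sup>2))"
    proof (rule sum.cong[OF refl])
      fix l assume l: "l \<in> {..<k}"
      have "(\<Sum>i<n. (v l i - z (\<Psi> i) l)\<^sup>2) = (\<Sum>i<n. v l i * v l i) - (\<Sum>i<n. 2 * v l i * z (\<Psi> i) l - (z (\<Psi> i) l)\<^sup>2)"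
        by (simp add: sum_subtractf[symmetric] power2_eq_square algebra_simps)
      also have "(\<Sum>i<n. 2 * v l i * z (\<Psi> i) l - (z (\<Psi> i) l)\<^sup>2)
         = (\<Sum>j<k. \<Sum>i\<in>cluster n \<Psi> j. 2 * v l i * z (\<Psi> i) l - (z (\<Psi> i) l)\<^sup>2)"
        by (rule sum_clusters[OF \<Psi>, symmetric])
      also have "\<dots> = (\<Sum>j<k. (y j l)\<^sup>2)"
      proof (rule sum.cong[OF refl])
        fix j assume j: "j \<in> {..<k}"
        have "(\<Sum>i\<in>cluster n \<Psi> j. 2 * v l i * z (\<Psi> i) l - (z (\<Psi> i) l)\<^sup>2)
          = (\<Sum>i\<in>cluster n \<Psi> j. v l i * (2 * z j l) - (z j l)\<^sup>2)"
          by (intro sum.cong) (auto simp: cluster_def)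
        also have "\<dots> = (\<Sum>i\<in>cluster n \<Psi> j. v l i) * (2 * z j l) - c j * (z j l)\<^sup>2"
          by (simp add: sum_subtractf sum_distrib_right c_def)
        also have "(\<Sum>i\<in>cluster n \<Psi> j. v l i) = c j * z j l" using cpos[of j] j by (simp add: z_def)
        also have "c j * z j l * (2 * z j l) - c j * (z j l)\<^sup>2 = (y j l)\<^sup>2"
          using cpos[of j] j by (simp add: yz power_mult_distrib power2_eq_square)
        finally show "(\<Sum>i\<in>cluster n \<Psi> j. 2 * v l i * z (\<Psi> i) l - (z (\<Psi> i) l)\<^sup>2) = (y j l)\<^sup>2" .
      qed
      finally show "(\<Sum>i<n. (v l i - z (\<Psi> i) l)\<^sup>2) = 1 - (\<Sum>j<k. (y j l)\<^sup>2)"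
        using l kn orthonormal[of l l] by simp
    qed
    also have "\<dots> = (\<Sum>j<k. 1 - (\<Sum>l<k. (y j l)\<^sup>2))"
      by (simp add: sum_subtractf) (rule sum.swap)
    also have "\<dots> = (\<Sum>j<k. \<Sum>l\<in>{k..<n}. (y j l)\<^sup>2)"
    proof (rule sum.cong[OF refl])
      fix j assume "j \<in> {..<k}"
      then show "1 - (\<Sum>l<k. (y j l)\<^sup>2) = (\<Sum>l\<in>{k..<n}. (y j l)\<^sup>2)"
        using ynorm[of j] split[of "\<lambda>l. (y j l)\<^sup>2"] by simp
    qed
    finally show ?thesis using \<xi> by (simp add: y_def)
  qed
  have gap: "1 / nM \<le> (\<Sum>l<k. (z a l - z b l)\<^sup>2)" if ab: "a < k" "b < k" "a \<noteq> b" for a b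
  proof -
    have zy: "z j l = y j l / sqrt (c j)" if "j < k" for j l using cpos[OF that] by (simp add: yz[OF that])
    have all: "(\<Sum>l<n. (z a l - z b l)\<^sup>2) = 1 / c a + 1 / c b"
    proof -
      have "(z a l - z b l)\<^sup>2 = (y a l)\<^sup>2 / c a + (y b l)\<^sup>2 / c b - (2 / (sqrt (c a) * sqrt (c b))) * (y a l * y b l)" for l
        using cpos[OF ab(1)] cpos[OF ab(2)] by (simp add: zy ab power2_diff power_divide)
      then have "(\<Sum>l<n. (z a l - z b l)\<^sup>2) = (\<Sum>l<n. (y a l)\<^sup>2) / c a + (\<Sum>l<n. (y b l)\<^sup>2) / c b
          - (2 / (sqrt (c a) * sqrt (c b))) * (\<Sum>l<n. y a l * y b l)"
        by (simp only: sum_subtractf sum.distrib sum_divide_distrib sum_distrib_left)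
      then show ?thesis using ynorm ab yorth by simp
    qed
    have "(\<Sum>l\<in>{k..<n}. (z a l - z b l)\<^sup>2) \<le> (\<Sum>l\<in>{k..<n}. (1 / c a + 1 / c b) * ((y a l)\<^sup>2 + (y b l)\<^sup>2))"
    proof (rule sum_mono)
      fix l
      define s t where "s = 1 / sqrt (c a)" and "t = 1 / sqrt (c b)"
      have st: "s\<^sup>2 = 1 / c a" "t\<^sup>2 = 1 / c b" using cpos[OF ab(1)] cpos[OF ab(2)] by (auto simp: s_def t_def power_divide)
      have "0 \<le> (s * y b l + t * y a l)\<^sup>2" by simp
      then have "(s * y a l - t * y b l)\<^sup>2 \<le> (s\<^sup>2 + t\<^sup>2) * ((y a l)\<^sup>2 + (y b l)\<^sup>2)"
        by (simp add: power2_eq_square algebra_simps)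
      then show "(z a l - z b l)\<^sup>2 \<le> (1 / c a + 1 / c b) * ((y a l)\<^sup>2 + (y b l)\<^sup>2)"
        unfolding st by (simp add: zy ab s_def t_def)
    qed
    also have "\<dots> = (1 / c a + 1 / c b) * ((\<Sum>l\<in>{k..<n}. (y a l)\<^sup>2) + (\<Sum>l\<in>{k..<n}. (y b l)\<^sup>2))"
      by (simp only: sum_distrib_left[symmetric] sum.distrib)
    also have "\<dots> \<le> (1 / c a + 1 / c b) * (1 / 2)"
    proof (rule mult_left_mono)
      have "(\<Sum>l\<in>{k..<n}. (y a l)\<^sup>2) + (\<Sum>l\<in>{k..<n}. (y b l)\<^sup>2) = (\<Sum>j\<in>{a,b}. \<Sum>l\<in>{k..<n}. (y j l)\<^sup>2)"
        using ab by simp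
      also have "\<dots> \<le> (\<Sum>j<k. \<Sum>l\<in>{k..<n}. (y j l)\<^sup>2)"
        using ab by (intro sum_mono2) (auto intro: sum_nonneg)
      also have "\<dots> \<le> 1 / 2" using \<xi> by (simp add: y_def)
      finally show "(\<Sum>l\<in>{k..<n}. (y a l)\<^sup>2) + (\<Sum>l\<in>{k..<n}. (y b l)\<^sup>2) \<le> 1 / 2" .
    qed (use cpos[OF ab(1)] cpos[OF ab(2)] in simp)
    finally have "(\<Sum>l<k. (z a l - z b l)\<^sup>2) \<ge> (1 / c a + 1 / c b) * (1 / 2)"
      using all split[of "\<lambda>l. (z a l - z b l)\<^sup>2"] by simp
    moreover have "1 / nM \<le> 1 / c a" "1 / nM \<le> 1 / c b"
      using cpos[OF ab(1)] cpos[OF ab(2)] by (auto intro!: divide_left_mono)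
    ultimately show ?thesis by simp
  qed
  define f where "f = (\<lambda>i l. centroid U \<Phi> (\<Phi> i) $ l)"
  define dev where "dev = (\<lambda>i. \<Sum>l<k. (f i l - z (\<Psi> i) l)\<^sup>2)"
  have dev: "(\<Sum>i<n. dev i) \<le> 2 * (2 + \<epsilon>) * \<xi>"
  proof -
    have "dev i \<le> 2 * (\<Sum>l<k. (U $$ (i, l) - f i l)\<^sup>2) + 2 * (\<Sum>l<k. (U $$ (i, l) - z (\<Psi> i) l)\<^sup>2)" for i
    proof -
      have "(f i l - z (\<Psi> i) l)\<^sup>2 \<le> 2 * (U $$ (i, l) - f i l)\<^sup>2 + 2 * (U $$ (i, l) - z (\<Psi> i) l)\<^sup>2" for l
        using sum_sq_le_twice[of "f i l - U $$ (i, l)" "U $$ (i, l) - z (\<Psi> i) l"] by (simp add: power2_commute)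
      then have "dev i \<le> (\<Sum>l<k. 2 * (U $$ (i, l) - f i l)\<^sup>2 + 2 * (U $$ (i, l) - z (\<Psi> i) l)\<^sup>2)"
        unfolding dev_def by (intro sum_mono)
      then show ?thesis by (simp add: sum.distrib sum_distrib_left)
    qed
    then have "(\<Sum>i<n. dev i) \<le> (\<Sum>i<n. 2 * (\<Sum>l<k. (U $$ (i, l) - f i l)\<^sup>2) + 2 * (\<Sum>l<k. (U $$ (i, l) - z (\<Psi> i) l)\<^sup>2))"
      by (intro sum_mono)
    also have "\<dots> = 2 * kmeans_cost k U \<Phi> + 2 * (\<Sum>i<n. \<Sum>l<k. (U $$ (i, l) - z (\<Psi> i) l)\<^sup>2)"
      by (simp add: kmeans_cost_eq[OF U(1) \<Phi>] f_def sum.distrib sum_distrib_left)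
    also have "(\<Sum>i<n. \<Sum>l<k. (U $$ (i, l) - z (\<Psi> i) l)\<^sup>2) = kmeans_cost k U \<Psi>"
      unfolding kmeans_cost_eq[OF U(1) \<Psi>] using U
      by (intro sum.cong refl) (auto simp: centroid_def z_def c_def cluster_def)
    also have "2 * kmeans_cost k U \<Phi> + 2 * kmeans_cost k U \<Psi> \<le> 2 * ((1 + \<epsilon>) * \<xi>) + 2 * \<xi>"
      using approx_kmeans_le[OF U(1) km \<Psi> \<epsilon>] mult_left_mono[OF cost\<Psi>, of "1 + \<epsilon>"] cost\<Psi> \<epsilon> by linarith
    finally show ?thesis by (simp add: algebra_simps)
  qed
  define S where "S = {i. i < n \<and> dev i < 1 / (4 * nM)}"
  have bad: "real (card ({..<n} - S)) \<le> 8 * (2 + \<epsilon>) * nM * \<xi>"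
  proof -
    have "real (card ({..<n} - S)) * (1 / (4 * nM)) = (\<Sum>i\<in>{..<n} - S. 1 / (4 * nM))" by simp
    also have "\<dots> \<le> (\<Sum>i\<in>{..<n} - S. dev i)" by (intro sum_mono) (auto simp: S_def)
    also have "\<dots> \<le> (\<Sum>i<n. dev i)" by (intro sum_mono2) (auto simp: dev_def intro: sum_nonneg)
    finally have "real (card ({..<n} - S)) * (1 / (4 * nM)) \<le> 2 * (2 + \<epsilon>) * \<xi>" using dev by linarith
    then show ?thesis using nM by (simp add: field_simps)
  qed
  have "\<exists>\<pi>. \<pi> permutes {..<k} \<and> (\<forall>i\<in>S. \<pi> (\<Phi> i) = \<Psi> i)"
  proof (rule label_permutation)
    show "\<Phi> i < k" if "i \<in> S" for i using \<Phi> that by (auto simp: S_def)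
  next
    fix i j assume ij: "i \<in> S" "j \<in> S" and eq: "\<Phi> i = \<Phi> j"
    show "\<Psi> i = \<Psi> j"
    proof (rule ccontr)
      assume ne: "\<Psi> i \<noteq> \<Psi> j"
      have ijn: "i < n" "j < n" using ij by (auto simp: S_def)
      have "1 / nM \<le> (\<Sum>l<k. (z (\<Psi> i) l - z (\<Psi> j) l)\<^sup>2)" using gap \<Psi>k ijn ne by simp
      also have "\<dots> \<le> (\<Sum>l<k. 2 * (f i l - z (\<Psi> i) l)\<^sup>2 + 2 * (f j l - z (\<Psi> j) l)\<^sup>2)"
      proof (rule sum_mono)
        fix l
        have "f i l = f j l" by (simp add: f_def eq)
        then show "(z (\<Psi> i) l - z (\<Psi> j) l)\<^sup>2 \<le> 2 * (f i l - z (\<Psi> i) l)\<^sup>2 + 2 * (f j l - z (\<Psi> j) l)\<^sup>2"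
          using sum_sq_le_twice[of "z (\<Psi> i) l - f i l" "f j l - z (\<Psi> j) l"] by (simp add: power2_commute)
      qed
      also have "\<dots> = 2 * dev i + 2 * dev j" by (simp add: dev_def sum.distrib sum_distrib_left)
      also have "\<dots> < 1 / nM" using ij by (simp add: S_def)
      finally show False by simp
    qed
  next
    fix j assume j: "j < k"
    show "\<exists>i\<in>S. \<Psi> i = j"
    proof (rule ccontr)
      assume "\<not> ?thesis"
      then have "cluster n \<Psi> j \<subseteq> {..<n} - S" by (auto simp: cluster_def)
      then have "card (cluster n \<Psi> j) \<le> card ({..<n} - S)" by (intro card_mono) auto
      then have "real (n_min n k \<Psi>) \<le> card ({..<n} - S)" using card_cluster_bounds(1)[OF j, of n \<Psi>] by linarith
      with bad small show False by (simp add: nM_def)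
    qed
  qed
  then obtain \<pi> where "\<pi> permutes {..<k}" "\<And>i. i \<in> S \<Longrightarrow> \<pi> (\<Phi> i) = \<Psi> i" by blast
  then have "err n k \<Psi> \<Phi> \<le> card ({..<n} - S) / n" using n by (intro err_le_of_matching) (auto simp: S_def)
  also have "\<dots> \<le> 8 * (2 + \<epsilon>) * nM * \<xi> / n" using bad by (intro divide_right_mono) auto
  finally show ?thesis by (simp add: nM_def)
qed

section \<open>Counting hyperedges\<close>

text \<open>
  Indexing the mixed products by two-element sets makes them distinct orthogonal random variables when
  the summands are independent and centred.
\<close>

lemma square_of_sum:
  fixes y :: "'b \<Rightarrow> real"
  assumes "finite I"
  shows "(\<Sum>e\<in>I. y e)\<^sup>2 = (\<Sum>e\<in>I. (y e)\<^sup>2) + 2 * (\<Sum>p\<in>{p. p \<subseteq> I \<and> card p = 2}. \<Prod>e\<in>p. y e)"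
  using assms
proof (induction I rule: finite_induct)
  case empty
  have "{p::'b set. p \<subseteq> {} \<and> card p = 2} = {}" by auto
  then show ?case by simp
next
  case (insert x I)
  let ?P = "\<lambda>I. {p. p \<subseteq> I \<and> card p = 2}"
  have split: "?P (insert x I) = ?P I \<union> (\<lambda>e. {x, e}) ` I"
  proof
    show "?P (insert x I) \<subseteq> ?P I \<union> (\<lambda>e. {x, e}) ` I"
    proof
      fix p assume p: "p \<in> ?P (insert x I)"
      then obtain a b where ab: "p = {a, b}" "a \<noteq> b" by (auto simp: card_2_iff)
      then show "p \<in> ?P I \<union> (\<lambda>e. {x, e}) ` I" using p by (cases "a = x"; cases "b = x") auto
    qed
    show "?P I \<union> (\<lambda>e. {x, e}) ` I \<subseteq> ?P (insert x I)"
      using insert.hyps by (auto simp: card_2_iff)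
  qed
  have fin: "finite (?P I)" using insert.hyps by simp
  have "(\<Sum>p\<in>?P (insert x I). \<Prod>e\<in>p. y e) = (\<Sum>p\<in>?P I. \<Prod>e\<in>p. y e) + (\<Sum>p\<in>(\<lambda>e. {x, e}) ` I. \<Prod>e\<in>p. y e)"
    unfolding split using insert.hyps fin by (intro sum.union_disjoint) auto
  also have "(\<Sum>p\<in>(\<lambda>e. {x, e}) ` I. \<Prod>e\<in>p. y e) = (\<Sum>e\<in>I. y x * y e)"
  proof (subst sum.reindex)
    show "inj_on (\<lambda>e. {x, e}) I" by (auto simp: inj_on_def doubleton_eq_iff)
    have "(\<Prod>e\<in>{x, e}. y e) = y x * y e" if "e \<in> I" for e
      using that insert.hyps by (subst prod.insert) auto
    then show "sum ((\<lambda>p. \<Prod>e\<in>p. y e) \<circ> (\<lambda>e. {x, e})) I = (\<Sum>e\<in>I. y x * y e)" by simp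
  qed
  finally have "(\<Sum>p\<in>?P (insert x I). \<Prod>e\<in>p. y e) = (\<Sum>p\<in>?P I. \<Prod>e\<in>p. y e) + y x * (\<Sum>e\<in>I. y e)"
    by (simp add: sum_distrib_left)
  then show ?case using insert by (simp add: power2_sum algebra_simps)
qed

lemma finite_hyperedges [simp]: "finite (hyperedges n d)"
  unfolding hyperedges_def by simp

lemma hyperedgeD: "e \<in> hyperedges n d \<Longrightarrow> e \<subseteq> {..<n} \<and> card e = d \<and> finite e"
  by (auto simp: hyperedges_def intro: finite_subset)

text \<open>
  The coefficient of the weight of \<open>e\<close> in the total similarity between \<open>S\<close> and \<open>T\<close>: it turns
  sums of dependent matrix entries into sums of independent weights.
\<close>

definition pair_count :: "nat set \<Rightarrow> nat set \<Rightarrow> nat set \<Rightarrow> real" where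
  "pair_count S T e = (\<Sum>i\<in>S. \<Sum>j\<in>T. if i \<noteq> j \<and> {i, j} \<subseteq> e then 1 else 0)"

text \<open>
  Entries of the similarity matrix as a function on all pairs of naturals, so that node sets can be
  summed over without reference to the matrix type.
\<close>

definition similarity :: "nat \<Rightarrow> nat \<Rightarrow> (nat set \<Rightarrow> real) \<Rightarrow> nat \<Rightarrow> nat \<Rightarrow> real" where
  "similarity n d w i j = (if i = j then 0 else \<Sum>e\<in>{e \<in> hyperedges n d. {i, j} \<subseteq> e}. w e)"

lemma similarity_commute: "similarity n d w i j = similarity n d w j i"
  by (auto simp: similarity_def insert_commute)

lemma similarity_diag [simp]: "similarity n d w i i = 0"
  by (simp add: similarity_def)

lemma similarity_nonneg:
  assumes "\<And>e. e \<in> hyperedges n d \<Longrightarrow> w e \<ge> 0"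
  shows "similarity n d w i j \<ge> 0"
  using assms by (auto simp: similarity_def intro!: sum_nonneg)

lemma similarity_eq_sum_hyperedges:
  "similarity n d w i j = (\<Sum>e\<in>hyperedges n d. w e * (if i \<noteq> j \<and> {i, j} \<subseteq> e then 1 else 0))"
proof (cases "i = j")
  case False
  then show ?thesis
    by (simp only: similarity_def if_False) (rule sum.mono_neutral_cong_left; auto)
qed (simp add: similarity_def)

lemma sum_similarity:
  "(\<Sum>i\<in>S. \<Sum>j\<in>T. similarity n d w i j) = (\<Sum>e\<in>hyperedges n d. w e * pair_count S T e)"
proof -
  have "(\<Sum>i\<in>S. \<Sum>j\<in>T. similarity n d w i j)
      = (\<Sum>i\<in>S. \<Sum>j\<in>T. \<Sum>e\<in>hyperedges n d. w e * (if i \<noteq> j \<and> {i, j} \<subseteq> e then 1 else 0))"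
    by (simp only: similarity_eq_sum_hyperedges)
  also have "\<dots> = (\<Sum>i\<in>S. \<Sum>e\<in>hyperedges n d. \<Sum>j\<in>T. w e * (if i \<noteq> j \<and> {i, j} \<subseteq> e then 1 else 0))"
    by (intro sum.cong[OF refl] sum.swap)
  also have "\<dots> = (\<Sum>e\<in>hyperedges n d. \<Sum>i\<in>S. \<Sum>j\<in>T. w e * (if i \<noteq> j \<and> {i, j} \<subseteq> e then 1 else 0))"
    by (rule sum.swap)
  finally show ?thesis by (simp only: pair_count_def sum_distrib_left)
qed

lemma pair_count_nonneg [simp]: "pair_count S T e \<ge> 0"
  by (auto simp: pair_count_def intro!: sum_nonneg)

lemma pair_count_inner_le:
  assumes "finite T" "finite e"
  shows "(\<Sum>j\<in>T. if i \<noteq> j \<and> {i, j} \<subseteq> e then 1 else 0) \<le> (if i \<in> e then real (card e) else 0)"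
proof (cases "i \<in> e")
  case True
  have "(\<Sum>j\<in>T. if i \<noteq> j \<and> {i, j} \<subseteq> e then 1 else 0) \<le> (\<Sum>j\<in>T. if j \<in> e then 1 else (0::real))"
    by (intro sum_mono) auto
  also have "\<dots> = card (T \<inter> e)" using assms by (simp add: sum.If_cases)
  also have "\<dots> \<le> card e" using assms by (simp add: card_mono)
  finally show ?thesis using True by simp
qed simp

lemma pair_count_le:
  assumes "finite S" "finite T" "finite e"
  shows "pair_count S T e \<le> real (card e) ^ 2"
proof -
  have "pair_count S T e \<le> (\<Sum>i\<in>S. if i \<in> e then real (card e) else 0)"
    unfolding pair_count_def using assms by (intro sum_mono pair_count_inner_le) auto
  also have "\<dots> = real (card (S \<inter> e)) * card e" using assms by (simp add: sum.If_cases)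
  also have "\<dots> \<le> real (card e) * card e" using assms by (intro mult_right_mono) (auto simp: card_mono)
  finally show ?thesis by (simp add: power2_eq_square)
qed

lemma pair_count_singleton_le:
  assumes "finite T" "finite e"
  shows "pair_count {i} T e \<le> real (card e)" "i \<notin> e \<Longrightarrow> pair_count {i} T e = 0"
  using pair_count_inner_le[OF assms, of i] by (auto simp: pair_count_def split: if_splits)

lemma pair_count_ge_1:
  assumes "finite S" "finite T" "pair_count S T e \<noteq> 0"
  shows "pair_count S T e \<ge> 1"
proof -
  have "pair_count S T e = real (\<Sum>i\<in>S. \<Sum>j\<in>T. if i \<noteq> j \<and> {i, j} \<subseteq> e then 1 else 0)"
    unfolding pair_count_def by (simp only: of_nat_sum of_nat_1 of_nat_0 if_distrib[of real])
  then obtain m :: nat where m: "pair_count S T e = real m" by blast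
  with assms have "m \<noteq> 0" by auto
  then show ?thesis using m by simp
qed

lemma card_subsets_containing_pair:
  assumes X: "finite X" and il: "i \<in> X" "l \<in> X" "i \<noteq> l" and d: "d \<ge> 2"
  shows "card {e. e \<subseteq> X \<and> card e = d \<and> {i, l} \<subseteq> e} = (card X - 2) choose (d - 2)"
proof -
  let ?Y = "X - {i, l}"
  have "bij_betw (\<lambda>b. b \<union> {i, l}) {b. b \<subseteq> ?Y \<and> card b = d - 2} {e. e \<subseteq> X \<and> card e = d \<and> {i, l} \<subseteq> e}"
  proof (rule bij_betw_byWitness[where f' = "\<lambda>e. e - {i, l}"])
    show "(\<lambda>b. b \<union> {i, l}) ` {b. b \<subseteq> ?Y \<and> card b = d - 2} \<subseteq> {e. e \<subseteq> X \<and> card e = d \<and> {i, l} \<subseteq> e}"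
    proof
      fix e assume "e \<in> (\<lambda>b. b \<union> {i, l}) ` {b. b \<subseteq> ?Y \<and> card b = d - 2}"
      then obtain b where b: "b \<subseteq> ?Y" "card b = d - 2" "e = b \<union> {i, l}" by blast
      have "finite b" using b X by (meson finite_Diff finite_subset)
      then have "card e = card b + card {i, l}" unfolding b(3) using b(1) by (intro card_Un_disjoint) auto
      then show "e \<in> {e. e \<subseteq> X \<and> card e = d \<and> {i, l} \<subseteq> e}" using b il d by auto
    qed
    show "(\<lambda>e. e - {i, l}) ` {e. e \<subseteq> X \<and> card e = d \<and> {i, l} \<subseteq> e} \<subseteq> {b. b \<subseteq> ?Y \<and> card b = d - 2}"
    proof
      fix b assume "b \<in> (\<lambda>e. e - {i, l}) ` {e. e \<subseteq> X \<and> card e = d \<and> {i, l} \<subseteq> e}"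
      then obtain e where e: "e \<subseteq> X" "card e = d" "{i, l} \<subseteq> e" "b = e - {i, l}" by blast
      have "card b = card e - card {i, l}" unfolding e(4) using e by (intro card_Diff_subset) auto
      then show "b \<in> {b. b \<subseteq> ?Y \<and> card b = d - 2}" using e il by auto
    qed
  qed auto
  then have "card {e. e \<subseteq> X \<and> card e = d \<and> {i, l} \<subseteq> e} = card {b. b \<subseteq> ?Y \<and> card b = d - 2}"
    by (simp add: bij_betw_same_card)
  also have "\<dots> = card ?Y choose (d - 2)" using X by (intro n_subsets) auto
  also have "card ?Y = card X - 2" using il X by (simp add: card_Diff_subset)
  finally show ?thesis .
qed

lemma card_hyperedges_through_pair:
  assumes "i < n" "l < n" "i \<noteq> l" "d \<ge> 2"
  shows "card {e \<in> hyperedges n d. {i, l} \<subseteq> e} = (n - 2) choose (d - 2)"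
  using card_subsets_containing_pair[of "{..<n}" i l d] assms by (simp add: hyperedges_def conj_assoc)

lemma sum_pair_count_le:
  assumes "S \<subseteq> {..<n}" "T \<subseteq> {..<n}" "d \<ge> 2"
  shows "(\<Sum>e\<in>hyperedges n d. pair_count S T e) \<le> real (card S) * real (card T) * real ((n - 2) choose (d - 2))"
proof -
  have "(\<Sum>e\<in>hyperedges n d. pair_count S T e) = (\<Sum>i\<in>S. \<Sum>j\<in>T. similarity n d (\<lambda>_. 1) i j)"
    by (simp add: sum_similarity)
  also have "\<dots> \<le> (\<Sum>i\<in>S. \<Sum>j\<in>T. real ((n - 2) choose (d - 2)))"
  proof (intro sum_mono)
    fix i j assume "i \<in> S" "j \<in> T"
    then show "similarity n d (\<lambda>_. 1) i j \<le> real ((n - 2) choose (d - 2))"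
      using assms card_hyperedges_through_pair[of i n j d] by (cases "i = j") (auto simp: similarity_def subset_iff)
  qed
  finally show ?thesis by simp
qed

definition mean_weight :: "real \<Rightarrow> real \<Rightarrow> real \<Rightarrow> (nat \<Rightarrow> nat) \<Rightarrow> nat set \<Rightarrow> real" where
  "mean_weight p q \<alpha> \<Psi> e = (if homogeneous \<Psi> e then p * \<alpha> else q * \<alpha>)"

lemma similarity_mean_weight:
  assumes il: "i < n" "l < n" "i \<noteq> l" and d: "d \<ge> 2"
  shows "similarity n d (mean_weight p q \<alpha> \<Psi>) i l = q * \<alpha> * ((n - 2) choose (d - 2))
     + (if \<Psi> i = \<Psi> l then (p - q) * \<alpha> * ((card (cluster n \<Psi> (\<Psi> i)) - 2) choose (d - 2)) else 0)"
proof -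
  let ?E = "{e \<in> hyperedges n d. {i, l} \<subseteq> e}"
  have fin: "finite ?E" by simp
  have "similarity n d (mean_weight p q \<alpha> \<Psi>) i l
      = (\<Sum>e\<in>?E. q * \<alpha> + (p - q) * \<alpha> * (if homogeneous \<Psi> e then 1 else 0))"
    using il unfolding similarity_def by (simp, intro sum.cong refl) (auto simp: mean_weight_def algebra_simps)
  also have "\<dots> = q * \<alpha> * card ?E + (p - q) * \<alpha> * card {e \<in> ?E. homogeneous \<Psi> e}"
    using fin by (simp add: sum.distrib sum_distrib_left[symmetric] sum.If_cases Int_def)
  finally have expand: "similarity n d (mean_weight p q \<alpha> \<Psi>) i l
      = q * \<alpha> * card ?E + (p - q) * \<alpha> * card {e \<in> ?E. homogeneous \<Psi> e}" .
  have all: "card ?E = (n - 2) choose (d - 2)" using assms by (rule card_hyperedges_through_pair)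
  have "card {e \<in> ?E. homogeneous \<Psi> e}
      = (if \<Psi> i = \<Psi> l then (card (cluster n \<Psi> (\<Psi> i)) - 2) choose (d - 2) else 0)"
  proof (cases "\<Psi> i = \<Psi> l")
    case True
    have "e \<subseteq> {..<n} \<and> homogeneous \<Psi> e \<longleftrightarrow> e \<subseteq> cluster n \<Psi> (\<Psi> i)" if "i \<in> e" for e
    proof
      assume "e \<subseteq> {..<n} \<and> homogeneous \<Psi> e"
      then show "e \<subseteq> cluster n \<Psi> (\<Psi> i)" using that unfolding homogeneous_def cluster_def by blast
    next
      assume "e \<subseteq> cluster n \<Psi> (\<Psi> i)"
      then have "\<And>x. x \<in> e \<Longrightarrow> x < n \<and> \<Psi> x = \<Psi> i" by (auto simp: cluster_def)
      then show "e \<subseteq> {..<n} \<and> homogeneous \<Psi> e" unfolding homogeneous_def by auto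
    qed
    then have eq: "(e \<subseteq> {..<n} \<and> card e = d) \<and> {i, l} \<subseteq> e \<and> homogeneous \<Psi> e
       \<longleftrightarrow> e \<subseteq> cluster n \<Psi> (\<Psi> i) \<and> card e = d \<and> {i, l} \<subseteq> e" for e
      by (metis insert_subset)
    have "{e \<in> ?E. homogeneous \<Psi> e} = {e. e \<subseteq> cluster n \<Psi> (\<Psi> i) \<and> card e = d \<and> {i, l} \<subseteq> e}"
      unfolding hyperedges_def mem_Collect_eq conj_assoc[symmetric] using eq by (simp only: conj_assoc)
    then show ?thesis using card_subsets_containing_pair[of "cluster n \<Psi> (\<Psi> i)" i l d] il d True
      by (simp add: cluster_def)
  next
    case False
    then have "{e \<in> ?E. homogeneous \<Psi> e} = {}" unfolding homogeneous_def by blast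
    then show ?thesis using False by (simp only: card.empty if_False)
  qed
  then show ?thesis unfolding expand all by (cases "\<Psi> i = \<Psi> l") (simp_all only: if_True if_False, simp_all)
qed

lemma choose_pair_identity:
  assumes "d \<ge> 2" "n \<ge> 2"
  shows "real d * (real d - 1) * (n choose d) = real n * (real n - 1) * ((n - 2) choose (d - 2))"
proof -
  have 1: "d * (n choose d) = n * ((n - 1) choose (d - 1))"
    using assms by (intro times_binomial_minus1_eq) auto
  have 2: "(d - 1) * ((n - 1) choose (d - 1)) = (n - 1) * ((n - 2) choose (d - 2))"
    using times_binomial_minus1_eq[of "d - 1" "n - 1"] assms by (simp add: numeral_2_eq_2)
  have "d * (d - 1) * (n choose d) = n * ((d - 1) * ((n - 1) choose (d - 1)))"
    using 1 by (metis mult.assoc mult.commute)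
  also have "\<dots> = n * (n - 1) * ((n - 2) choose (d - 2))" unfolding 2 by simp
  finally have "real (d * (d - 1) * (n choose d)) = real (n * (n - 1) * ((n - 2) choose (d - 2)))" by simp
  then show ?thesis using assms by (simp add: of_nat_diff)
qed

text \<open>
  Comparable cluster sizes have comparable numbers of hyperedges through a pair. The bound
  \<open>(m / r) ^ r \<le> m choose r \<le> m ^ r\<close> costs a factor depending on \<open>d\<close> alone.
\<close>

lemma choose_ratio_le:
  fixes R :: real
  assumes R: "R \<ge> 1" and m: "real m2 \<le> R * real m1" and m1: "m1 \<ge> 4" "m1 \<ge> d" and d: "d \<ge> 2"
  shows "real ((m2 - 2) choose (d - 2)) \<le> (2 * real d * R) ^ d * ((m1 - 2) choose (d - 2))"
proof -
  define r where "r = d - 2"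
  have "real ((m2 - 2) choose r) \<le> real (m2 - 2) ^ r"
  proof -
    have "((m2 - 2) choose r) * 1 \<le> ((m2 - 2) choose r) * fact r"
      by (intro mult_left_mono) (auto intro: fact_ge_1)
    also have "\<dots> \<le> (m2 - 2) ^ r" by (rule binomial_fact_pow)
    finally have "real ((m2 - 2) choose r) \<le> real ((m2 - 2) ^ r)" by (simp only: of_nat_le_iff mult_1_right)
    then show ?thesis by simp
  qed
  also have "\<dots> \<le> (R * real m1) ^ r" using m by (intro power_mono) auto
  also have "\<dots> \<le> (R * (2 * real (m1 - 2))) ^ r" using m1 R by (intro power_mono mult_left_mono) auto
  also have "\<dots> = (2 * R) ^ r * real (m1 - 2) ^ r" by (simp add: power_mult_distrib)
  also have "\<dots> \<le> (2 * R) ^ r * (real d ^ r * ((m1 - 2) choose r))"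
  proof (rule mult_left_mono)
    show "real (m1 - 2) ^ r \<le> real d ^ r * ((m1 - 2) choose r)"
    proof (cases "r = 0")
      case False
      have "real (m1 - 2) ^ r = real r ^ r * (real (m1 - 2) / real r) ^ r" using False by (simp add: power_divide)
      also have "\<dots> \<le> real r ^ r * ((m1 - 2) choose r)"
        using m1 d by (intro mult_left_mono binomial_ge_n_over_k_pow_k) (auto simp: r_def)
      also have "\<dots> \<le> real d ^ r * ((m1 - 2) choose r)"
        by (intro mult_right_mono power_mono) (auto simp: r_def)
      finally show ?thesis .
    qed simp
  qed (use R in simp)
  also have "\<dots> = (2 * real d * R) ^ r * ((m1 - 2) choose r)" by (simp add: power_mult_distrib)
  also have "\<dots> \<le> (2 * real d * R) ^ d * ((m1 - 2) choose r)"
  proof (intro mult_right_mono power_increasing)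
    have "1 * 1 \<le> (2 * real d) * R" using d R by (intro mult_mono) auto
    then show "1 \<le> 2 * real d * R" by simp
  qed (auto simp: r_def)
  finally show ?thesis by (simp add: r_def)
qed

section \<open>Tail bounds for independent weights\<close>

lemma exp_le_quadratic:
  fixes x :: real
  assumes "\<bar>x\<bar> \<le> 1"
  shows "exp x \<le> 1 + x + x\<^sup>2"
proof (cases "x \<ge> 0")
  case True
  then show ?thesis using assms exp_bound[of x] by simp
next
  case False
  define y where "y = - x"
  have y: "y > 0" using False by (simp add: y_def)
  have "exp (- y) = 1 / exp y" by (simp add: exp_minus inverse_eq_divide)
  also have "\<dots> \<le> 1 / (1 + y)" using y by (intro divide_left_mono) (auto intro: mult_pos_pos)
  also have "\<dots> \<le> 1 - y + y\<^sup>2"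
  proof -
    have "1 \<le> (1 - y + y\<^sup>2) * (1 + y)" using y by (simp add: algebra_simps power2_eq_square)
    then show ?thesis using y by (simp add: divide_le_eq)
  qed
  finally show ?thesis by (simp add: y_def)
qed

context prob_space
begin

lemma integrable_unit_interval:
  assumes "random_variable borel X" "AE \<omega> in M. X \<omega> \<in> {0..1::real}"
  shows "integrable M X"
  using assms by (intro integrable_const_bound[where B = 1]) auto

lemma mgf_unit_interval_le:
  fixes X :: "'a \<Rightarrow> real"
  assumes [measurable]: "random_variable borel X" and X: "AE \<omega> in M. X \<omega> \<in> {0..1}"
  shows "integrable M (\<lambda>\<omega>. exp (c * X \<omega>))"
    and "expectation (\<lambda>\<omega>. exp (c * X \<omega>)) \<le> exp (expectation X * (exp c - 1))"
proof -
  have chord: "exp (c * x) \<le> 1 + x * (exp c - 1)" if "x \<in> {0..1}" for x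
  proof -
    have "exp ((1 - x) *\<^sub>R 0 + x *\<^sub>R c) \<le> (1 - x) * exp 0 + x * exp c"
      using that by (intro convex_onD[OF exp_convex]) auto
    then show ?thesis by (simp add: algebra_simps)
  qed
  have int: "integrable M X" using assms by (rule integrable_unit_interval)
  show int': "integrable M (\<lambda>\<omega>. exp (c * X \<omega>))"
  proof (rule integrable_const_bound[where B = "1 + exp c"])
    show "AE \<omega> in M. norm (exp (c * X \<omega>)) \<le> 1 + exp c"
      using X
    proof eventually_elim
      case (elim \<omega>)
      have "X \<omega> * (exp c - 1) \<le> X \<omega> * exp c" using elim by (intro mult_left_mono) auto
      also have "\<dots> \<le> 1 * exp c" using elim by (intro mult_right_mono) auto
      finally show ?case using chord[OF elim] by simp
    qed
  qed simp
  have "expectation (\<lambda>\<omega>. exp (c * X \<omega>)) \<le> expectation (\<lambda>\<omega>. 1 + X \<omega> * (exp c - 1))"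
    using int int' X chord by (intro integral_mono_AE) auto
  also have "\<dots> = 1 + expectation X * (exp c - 1)" using int by (simp add: prob_space)
  also have "\<dots> \<le> exp (expectation X * (exp c - 1))" by simp
  finally show "expectation (\<lambda>\<omega>. exp (c * X \<omega>)) \<le> exp (expectation X * (exp c - 1))" .
qed

text \<open>
  By convexity the moment generating function of a variable in the unit interval is at most that of a
  Poisson variable with the same mean. This keeps the dependence on the means, which may be tiny.
\<close>

lemma poisson_chernoff:
  fixes X :: "'i \<Rightarrow> 'a \<Rightarrow> real"
  assumes I: "finite I" and indep: "indep_vars (\<lambda>_. borel) X I"
    and range: "\<And>e. e \<in> I \<Longrightarrow> AE \<omega> in M. X e \<omega> \<in> {0..1}"
  shows "prob {\<omega> \<in> space M. (\<Sum>e\<in>I. c e * X e \<omega>) \<ge> r}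
     \<le> exp (- r + (\<Sum>e\<in>I. expectation (X e) * (exp (c e) - 1)))"
proof -
  have rv[measurable]: "random_variable borel (X e)" if "e \<in> I" for e
    using indep that by (auto simp: indep_vars_def)
  have indep': "indep_vars (\<lambda>_. borel) (\<lambda>e \<omega>. exp (c e * X e \<omega>)) I"
    by (rule indep_vars_compose2[OF indep]) simp
  have int: "integrable M (\<lambda>\<omega>. exp (c e * X e \<omega>))" if "e \<in> I" for e
    by (rule mgf_unit_interval_le(1)[OF rv[OF that] range[OF that]])
  have prod: "(\<lambda>\<omega>. exp (\<Sum>e\<in>I. c e * X e \<omega>)) = (\<lambda>\<omega>. \<Prod>e\<in>I. exp (c e * X e \<omega>))"
    using I by (simp add: exp_sum)
  have "prob {\<omega> \<in> space M. exp r \<le> exp (\<Sum>e\<in>I. c e * X e \<omega>)}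
      \<le> expectation (\<lambda>\<omega>. exp (\<Sum>e\<in>I. c e * X e \<omega>)) / exp r"
  proof (rule integral_Markov_inequality_measure[where A = "space M"])
    show "integrable M (\<lambda>\<omega>. exp (\<Sum>e\<in>I. c e * X e \<omega>))"
      unfolding prod by (rule indep_vars_integrable[OF I indep' int])
  qed auto
  also have "expectation (\<lambda>\<omega>. exp (\<Sum>e\<in>I. c e * X e \<omega>)) = (\<Prod>e\<in>I. expectation (\<lambda>\<omega>. exp (c e * X e \<omega>)))"
    unfolding prod by (rule indep_vars_lebesgue_integral[OF I indep' int])
  also have "(\<Prod>e\<in>I. expectation (\<lambda>\<omega>. exp (c e * X e \<omega>))) / exp r
      \<le> (\<Prod>e\<in>I. exp (expectation (X e) * (exp (c e) - 1))) / exp r"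
  proof (intro divide_right_mono prod_mono conjI)
    fix e assume e: "e \<in> I"
    show "0 \<le> expectation (\<lambda>\<omega>. exp (c e * X e \<omega>))" by (rule integral_nonneg_AE) simp
    show "expectation (\<lambda>\<omega>. exp (c e * X e \<omega>)) \<le> exp (expectation (X e) * (exp (c e) - 1))"
      by (rule mgf_unit_interval_le(2)[OF rv[OF e] range[OF e]])
  qed simp
  also have "\<dots> = exp (- r + (\<Sum>e\<in>I. expectation (X e) * (exp (c e) - 1)))"
  proof -
    have "exp S / exp r = exp (- r + S)" for S by (simp add: exp_diff[symmetric])
    then show ?thesis unfolding exp_sum[OF I, symmetric] .
  qed
  finally show ?thesis by simp
qed

text \<open>
  For small exponents the Poisson exponent is quadratic, which gives a variance-sensitive bound for the
  centred sum.
\<close>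

lemma bernstein_upper_tail:
  fixes X :: "'i \<Rightarrow> 'a \<Rightarrow> real"
  assumes I: "finite I" and indep: "indep_vars (\<lambda>_. borel) X I"
    and range: "\<And>e. e \<in> I \<Longrightarrow> AE \<omega> in M. X e \<omega> \<in> {0..1}"
    and l: "l > 0" and small: "\<And>e. e \<in> I \<Longrightarrow> \<bar>l * c e\<bar> \<le> 1"
    and V: "(\<Sum>e\<in>I. expectation (X e) * (c e)\<^sup>2) \<le> V"
  shows "prob {\<omega> \<in> space M. (\<Sum>e\<in>I. c e * (X e \<omega> - expectation (X e))) \<ge> r} \<le> exp (- l * r + l\<^sup>2 * V)"
proof -
  define m where "m = (\<lambda>e. expectation (X e))"
  have m: "m e \<ge> 0" if "e \<in> I" for e
    unfolding m_def using range[OF that] by (intro integral_nonneg_AE) auto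
  have "{\<omega> \<in> space M. (\<Sum>e\<in>I. c e * (X e \<omega> - m e)) \<ge> r}
      = {\<omega> \<in> space M. (\<Sum>e\<in>I. (l * c e) * X e \<omega>) \<ge> l * r + (\<Sum>e\<in>I. l * c e * m e)}"
  proof -
    have "(\<Sum>e\<in>I. (l * c e) * X e \<omega>) = l * (\<Sum>e\<in>I. c e * (X e \<omega> - m e)) + (\<Sum>e\<in>I. l * c e * m e)" for \<omega>
      by (simp add: sum_distrib_left sum.distrib[symmetric] algebra_simps)
    then show ?thesis using l by (simp add: mult_le_cancel_left_pos)
  qed
  then have "prob {\<omega> \<in> space M. (\<Sum>e\<in>I. c e * (X e \<omega> - m e)) \<ge> r}
      \<le> exp (- (l * r + (\<Sum>e\<in>I. l * c e * m e)) + (\<Sum>e\<in>I. m e * (exp (l * c e) - 1)))"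
    using poisson_chernoff[OF I indep range, where c = "\<lambda>e. l * c e"
        and r = "l * r + (\<Sum>e\<in>I. l * c e * m e)"] unfolding m_def by (simp only:)
  also have "\<dots> = exp (- l * r + (\<Sum>e\<in>I. m e * (exp (l * c e) - 1 - l * c e)))"
    by (simp add: sum_subtractf sum.distrib algebra_simps)
  also have "\<dots> \<le> exp (- l * r + (\<Sum>e\<in>I. l\<^sup>2 * (m e * (c e)\<^sup>2)))"
  proof -
    have "m e * (exp (l * c e) - 1 - l * c e) \<le> l\<^sup>2 * (m e * (c e)\<^sup>2)" if "e \<in> I" for e
    proof -
      have "m e * (exp (l * c e) - 1 - l * c e) \<le> m e * (l * c e)\<^sup>2"
        using exp_le_quadratic[OF small[OF that]] m[OF that] by (intro mult_left_mono) auto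
      then show ?thesis by (simp add: power_mult_distrib algebra_simps)
    qed
    then show ?thesis by (simp add: sum_mono)
  qed
  also have "\<dots> \<le> exp (- l * r + l\<^sup>2 * V)"
    using V l by (simp add: sum_distrib_left[symmetric] m_def)
  finally show ?thesis by (simp add: m_def)
qed

text \<open>
  An index in only one of the two sets contributes a factor \<open>expectation (w e) = 0\<close>.
\<close>

lemma expectation_product_pair:
  fixes w :: "'i \<Rightarrow> 'a \<Rightarrow> real"
  assumes I: "finite I" and indep: "indep_vars (\<lambda>_. borel) w I"
    and bound: "\<And>e. e \<in> I \<Longrightarrow> AE \<omega> in M. \<bar>w e \<omega>\<bar> \<le> 1"
    and centered: "\<And>e. e \<in> I \<Longrightarrow> expectation (w e) = 0"
    and pq: "p \<subseteq> I" "q \<subseteq> I"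
  shows "integrable M (\<lambda>\<omega>. (\<Prod>e\<in>p. w e \<omega>) * (\<Prod>e\<in>q. w e \<omega>))"
    and "expectation (\<lambda>\<omega>. (\<Prod>e\<in>p. w e \<omega>) * (\<Prod>e\<in>q. w e \<omega>))
       = (if p = q then \<Prod>e\<in>p. expectation (\<lambda>\<omega>. (w e \<omega>)\<^sup>2) else 0)"
proof -
  define g where "g = (\<lambda>e x. (if e \<in> p then x else 1) * (if e \<in> q then x else (1::real)))"
  have rv[measurable]: "random_variable borel (w e)" if "e \<in> I" for e
    using indep that by (auto simp: indep_vars_def)
  have gm[measurable]: "g e \<in> borel_measurable borel" for e by (cases "e \<in> p"; cases "e \<in> q") (simp_all add: g_def)
  have prod: "(\<Prod>e\<in>p. w e \<omega>) * (\<Prod>e\<in>q. w e \<omega>) = (\<Prod>e\<in>I. g e (w e \<omega>))" for \<omega>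
  proof -
    have "(\<Prod>e\<in>r. w e \<omega>) = (\<Prod>e\<in>I. if e \<in> r then w e \<omega> else 1)" if "r \<subseteq> I" for r
      using I that by (simp add: prod.If_cases Int_absorb1)
    then show ?thesis using pq by (simp add: g_def prod.distrib)
  qed
  have indep': "indep_vars (\<lambda>_. borel) (\<lambda>e \<omega>. g e (w e \<omega>)) I"
    by (rule indep_vars_compose2[OF indep]) simp
  have int: "integrable M (\<lambda>\<omega>. g e (w e \<omega>))" if e: "e \<in> I" for e
  proof (rule integrable_const_bound[where B = 1])
    show "AE \<omega> in M. norm (g e (w e \<omega>)) \<le> 1"
      using bound[OF e]
    proof eventually_elim
      case (elim \<omega>)
      then show ?case using mult_mono[OF elim elim] by (auto simp: g_def abs_mult)
    qed
    show "(\<lambda>\<omega>. g e (w e \<omega>)) \<in> borel_measurable M" using measurable_compose[OF rv[OF e] gm] .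
  qed
  show "integrable M (\<lambda>\<omega>. (\<Prod>e\<in>p. w e \<omega>) * (\<Prod>e\<in>q. w e \<omega>))"
    unfolding prod by (rule indep_vars_integrable[OF I indep' int])
  have "expectation (\<lambda>\<omega>. (\<Prod>e\<in>p. w e \<omega>) * (\<Prod>e\<in>q. w e \<omega>)) = (\<Prod>e\<in>I. expectation (\<lambda>\<omega>. g e (w e \<omega>)))"
    unfolding prod by (rule indep_vars_lebesgue_integral[OF I indep' int])
  also have "\<dots> = (if p = q then \<Prod>e\<in>p. expectation (\<lambda>\<omega>. (w e \<omega>)\<^sup>2) else 0)"
  proof (cases "p = q")
    case True
    have "(\<Prod>e\<in>I. expectation (\<lambda>\<omega>. g e (w e \<omega>))) = (\<Prod>e\<in>p. expectation (\<lambda>\<omega>. g e (w e \<omega>)))"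
      using I pq True by (intro prod.mono_neutral_right) (auto simp: g_def prob_space)
    also have "\<dots> = (\<Prod>e\<in>p. expectation (\<lambda>\<omega>. (w e \<omega>)\<^sup>2))"
      using True by (intro prod.cong refl) (simp add: g_def power2_eq_square)
    finally show ?thesis using True by simp
  next
    case False
    then obtain e where e: "e \<in> I" "(e \<in> p \<and> e \<notin> q) \<or> (e \<in> q \<and> e \<notin> p)" using pq by blast
    then have "expectation (\<lambda>\<omega>. g e (w e \<omega>)) = 0" using centered[OF e(1)] by (auto simp: g_def)
    then have "(\<Prod>e\<in>I. expectation (\<lambda>\<omega>. g e (w e \<omega>))) = 0" using I e by (intro prod_zero) auto
    then show ?thesis using False by simp
  qed
  finally show "expectation (\<lambda>\<omega>. (\<Prod>e\<in>p. w e \<omega>) * (\<Prod>e\<in>q. w e \<omega>))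
       = (if p = q then \<Prod>e\<in>p. expectation (\<lambda>\<omega>. (w e \<omega>)\<^sup>2) else 0)" .
qed

text \<open>
  Chebyshev's inequality, with the second moment computed by orthogonality of the products.
\<close>

lemma chaos_tail:
  fixes w :: "'i \<Rightarrow> 'a \<Rightarrow> real" and b :: "'i set \<Rightarrow> real"
  assumes I: "finite I" and indep: "indep_vars (\<lambda>_. borel) w I"
    and bound: "\<And>e. e \<in> I \<Longrightarrow> AE \<omega> in M. \<bar>w e \<omega>\<bar> \<le> 1"
    and centered: "\<And>e. e \<in> I \<Longrightarrow> expectation (w e) = 0"
    and F: "F \<subseteq> Pow I" and r: "r > 0"
    and V: "(\<Sum>p\<in>F. (b p)\<^sup>2 * (\<Prod>e\<in>p. expectation (\<lambda>\<omega>. (w e \<omega>)\<^sup>2))) \<le> V"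
  shows "prob {\<omega> \<in> space M. \<bar>\<Sum>p\<in>F. b p * (\<Prod>e\<in>p. w e \<omega>)\<bar> \<ge> r} \<le> V / r\<^sup>2"
proof -
  define Q where "Q = (\<lambda>\<omega>. \<Sum>p\<in>F. b p * (\<Prod>e\<in>p. w e \<omega>))"
  have Q2: "(Q \<omega>)\<^sup>2 = (\<Sum>p\<in>F. \<Sum>q\<in>F. (b p * b q) * ((\<Prod>e\<in>p. w e \<omega>) * (\<Prod>e\<in>q. w e \<omega>)))" for \<omega>
    by (simp add: Q_def power2_eq_square sum_product mult_ac)
  have fin: "finite F" using F I finite_subset by blast
  note pair = expectation_product_pair[OF I indep bound centered]
  have int: "integrable M (\<lambda>\<omega>. (b p * b q) * ((\<Prod>e\<in>p. w e \<omega>) * (\<Prod>e\<in>q. w e \<omega>)))" if "p \<in> F" "q \<in> F" for p q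
    using pair(1)[of p q] that F by (intro integrable_mult_right) auto
  have intQ: "integrable M (\<lambda>\<omega>. (Q \<omega>)\<^sup>2)" unfolding Q2 using int by (intro Bochner_Integration.integrable_sum)
  have "expectation (\<lambda>\<omega>. (Q \<omega>)\<^sup>2)
      = (\<Sum>p\<in>F. \<Sum>q\<in>F. expectation (\<lambda>\<omega>. (b p * b q) * ((\<Prod>e\<in>p. w e \<omega>) * (\<Prod>e\<in>q. w e \<omega>))))"
    unfolding Q2 using int by (simp add: Bochner_Integration.integral_sum Bochner_Integration.integrable_sum)
  also have "\<dots> = (\<Sum>p\<in>F. \<Sum>q\<in>F. if q = p then (b p)\<^sup>2 * (\<Prod>e\<in>p. expectation (\<lambda>\<omega>. (w e \<omega>)\<^sup>2)) else 0)"
  proof (intro sum.cong refl)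
    fix p q assume "p \<in> F" "q \<in> F"
    then have "p \<subseteq> I" "q \<subseteq> I" using F by auto
    then show "expectation (\<lambda>\<omega>. (b p * b q) * ((\<Prod>e\<in>p. w e \<omega>) * (\<Prod>e\<in>q. w e \<omega>)))
        = (if q = p then (b p)\<^sup>2 * (\<Prod>e\<in>p. expectation (\<lambda>\<omega>. (w e \<omega>)\<^sup>2)) else 0)"
      using pair(2)[of p q] by (simp add: power2_eq_square del: mult_eq_0_iff)
  qed
  also have "\<dots> = (\<Sum>p\<in>F. (b p)\<^sup>2 * (\<Prod>e\<in>p. expectation (\<lambda>\<omega>. (w e \<omega>)\<^sup>2)))"
    using fin by simp
  finally have E: "expectation (\<lambda>\<omega>. (Q \<omega>)\<^sup>2) \<le> V" using V by simp
  have "{\<omega> \<in> space M. \<bar>Q \<omega>\<bar> \<ge> r} = {\<omega> \<in> space M. r\<^sup>2 \<le> (Q \<omega>)\<^sup>2}"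
    using r by (auto simp: abs_le_square_iff[symmetric])
  also have "prob \<dots> \<le> expectation (\<lambda>\<omega>. (Q \<omega>)\<^sup>2) / r\<^sup>2"
    using r intQ by (intro integral_Markov_inequality_measure[where A = "space M"]) auto
  also have "\<dots> \<le> V / r\<^sup>2" using E by (intro divide_right_mono) auto
  finally show ?thesis by (simp add: Q_def)
qed

end

lemma power_self_le_fact_times_exp: "real s ^ s \<le> fact s * exp 1 ^ s"
proof -
  have "(\<Sum>m\<in>{s}. real s ^ m /\<^sub>R fact m) \<le> (\<Sum>m. real s ^ m /\<^sub>R fact m)"
    by (intro sum_le_suminf summable_exp_generic) auto
  also have "\<dots> = exp (real s)" using exp_converges[of "real s"] by (simp add: sums_iff)
  also have "\<dots> = exp 1 ^ s" by (simp add: exp_of_nat_mult[symmetric])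
  finally show ?thesis by (simp add: field_simps)
qed

lemma sum_over_powers_of_two_le: "(\<Sum>s=1..N. real s / 2 ^ s) \<le> 2"
proof -
  have "(\<Sum>s=1..N. real s / 2 ^ s) = 2 - (real N + 2) / 2 ^ N"
    by (induction N) (auto simp: field_simps)
  then show ?thesis by simp
qed

text \<open>
  Since \<open>n choose s \<le> (exp 1 * n / s) ^ s\<close>, the sets of size \<open>s\<close> contribute at most
  \<open>(exp 1 * (s / n)\<^sup>2) ^ s\<close>. For \<open>s \<le> n / 6\<close> this is at most \<open>s / (2 ^ s * n)\<close>, so that the smallest
  sets dominate and the sum is of order \<open>1 / n\<close>.
\<close>

lemma sum_small_subsets_le:
  fixes n :: nat and \<theta> :: real
  assumes n: "n > 0" and \<theta>: "\<theta> \<le> 1 / 6"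
  shows "(\<Sum>S\<in>{S. S \<subseteq> {..<n} \<and> S \<noteq> {} \<and> real (card S) \<le> \<theta> * n}. (real (card S) / n) ^ (3 * card S)) \<le> 2 / n"
proof -
  let ?F = "{S. S \<subseteq> {..<n} \<and> S \<noteq> {} \<and> real (card S) \<le> \<theta> * n}"
  have finS: "finite S" if "S \<subseteq> {..<n}" for S using that by (rule finite_subset) simp
  have fin: "finite ?F" by (rule finite_subset[of _ "Pow {..<n}"]) auto
  have single: "real (n choose s) * (real s / n) ^ (3 * s) \<le> (real s / 2 ^ s) / n"
    if s: "s \<ge> 1" "real s \<le> \<theta> * n" for s
  proof -
    have "real s \<le> 1 / 6 * real n" using s(2) mult_right_mono[OF \<theta>, of "real n"] by linarith
    then have sn: "real s / n \<le> 1 / 6" using n by (simp add: divide_le_eq)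
    have "(n choose s) * fact s \<le> n ^ s" by (rule binomial_fact_pow)
    then have "real ((n choose s) * fact s) \<le> real (n ^ s)" by (simp only: of_nat_le_iff)
    then have ch: "real (n choose s) * fact s \<le> real n ^ s" by simp
    have "real (n choose s) * real s ^ s \<le> real (n choose s) * (fact s * exp 1 ^ s)"
      by (intro mult_left_mono power_self_le_fact_times_exp) auto
    also have "\<dots> = (real (n choose s) * fact s) * exp 1 ^ s" by simp
    also have "\<dots> \<le> real n ^ s * exp 1 ^ s" using ch by (intro mult_right_mono) auto
    finally have ch2: "real (n choose s) * (real s / n) ^ s \<le> exp 1 ^ s"
      using n by (simp add: power_divide divide_le_eq mult.commute)
    have "real (n choose s) * (real s / n) ^ (3 * s) = (real (n choose s) * (real s / n) ^ s) * ((real s / n) ^ s * (real s / n) ^ s)"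
    proof -
      have "3 * s = s + (s + s)" by simp
      then show ?thesis by (simp only: power_add mult.assoc)
    qed
    also have "\<dots> \<le> exp 1 ^ s * ((real s / n) ^ s * (real s / n) ^ s)"
      using ch2 by (intro mult_right_mono) auto
    also have "\<dots> = (exp 1 * (real s / n)) ^ s * (real s / n) ^ s" by (simp only: power_mult_distrib mult.assoc)
    also have "\<dots> \<le> (1 / 2) ^ s * (real s / n) ^ 1"
    proof (intro mult_mono power_mono power_decreasing)
      have "exp 1 * (real s / n) \<le> 3 * (1 / 6)" using exp_le sn by (intro mult_mono) auto
      then show "exp 1 * (real s / n) \<le> 1 / 2" by simp
      show "real s / n \<le> 1" using sn by linarith
    qed (use s in auto)
    also have "\<dots> = (real s / 2 ^ s) / n" by (simp add: power_divide)
    finally show ?thesis .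
  qed
  have "(\<Sum>S\<in>?F. (real (card S) / n) ^ (3 * card S))
      = (\<Sum>s=1..n. \<Sum>S\<in>{S\<in>?F. card S = s}. (real (card S) / n) ^ (3 * card S))"
  proof (rule sum.group[symmetric])
    show "card ` ?F \<subseteq> {1..n}"
    proof
      fix s assume "s \<in> card ` ?F"
      then obtain S where S: "S \<subseteq> {..<n}" "S \<noteq> {}" "s = card S" by blast
      then have "card S \<le> n" "card S \<noteq> 0" using card_mono[of "{..<n}" S] finS[OF S(1)] by auto
      then show "s \<in> {1..n}" using S by simp
    qed
  qed (use fin in auto)
  also have "\<dots> \<le> (\<Sum>s=1..n. (real s / 2 ^ s) / n)"
  proof (rule sum_mono)
    fix s assume s: "s \<in> {1..n}"
    show "(\<Sum>S\<in>{S\<in>?F. card S = s}. (real (card S) / n) ^ (3 * card S)) \<le> (real s / 2 ^ s) / n"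
    proof (cases "real s \<le> \<theta> * n")
      case True
      have "(\<Sum>S\<in>{S\<in>?F. card S = s}. (real (card S) / n) ^ (3 * card S)) = real (card {S\<in>?F. card S = s}) * (real s / n) ^ (3 * s)"
        by simp
      also have "\<dots> \<le> real (n choose s) * (real s / n) ^ (3 * s)"
      proof -
        have "card {S\<in>?F. card S = s} \<le> card {S. S \<subseteq> {..<n} \<and> card S = s}"
          by (rule card_mono) auto
        also have "\<dots> = n choose s" using n_subsets[of "{..<n}" s] by simp
        finally show ?thesis by (intro mult_right_mono) auto
      qed
      also have "\<dots> \<le> (real s / 2 ^ s) / n" using s True by (intro single) auto
      finally show ?thesis .
    next
      case False
      then have "{S\<in>?F. card S = s} = {}" by auto
      then show ?thesis by (simp only: sum.empty) simp
    qed
  qed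
  also have "\<dots> = (\<Sum>s=1..n. real s / 2 ^ s) / n" by (simp add: sum_divide_distrib)
  also have "\<dots> \<le> 2 / n" by (intro divide_right_mono sum_over_powers_of_two_le) auto
  finally show ?thesis .
qed

section \<open>Discrepancy and row deviations of the similarity matrix\<close>

context weighted_SBM
begin

abbreviation "E \<equiv> hyperedges n d"
abbreviation "\<mu> \<equiv> mean_weight p q \<alpha> \<Psi>"

text \<open>
  The order of magnitude of a node's degree in the similarity matrix; the quantity called \<open>D\<close> in the
  introduction.
\<close>

definition degree_scale :: real where
  "degree_scale = \<alpha> * real n * real ((n - 2) choose (d - 2))"

lemma degree_scale_nonneg: "degree_scale \<ge> 0"
  using scale_pos by (simp add: degree_scale_def)

lemma weight_measurable [measurable]: "e \<in> E \<Longrightarrow> random_variable borel (W e)"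
  using indep_weights by (auto simp: indep_vars_def)

lemma integrable_weight: "e \<in> E \<Longrightarrow> integrable M (W e)"
  by (intro integrable_unit_interval weight_range weight_measurable)

lemma expectation_weight: "e \<in> E \<Longrightarrow> expectation (W e) = \<mu> e"
  using mean_homogeneous mean_heterogeneous by (auto simp: mean_weight_def)

lemma mean_weight_unit: assumes "e \<in> E" shows "0 \<le> \<mu> e" "\<mu> e \<le> 1"
proof -
  have "expectation (W e) \<ge> 0" using weight_range[OF assms] by (intro integral_nonneg_AE) auto
  then show "0 \<le> \<mu> e" using expectation_weight[OF assms] by simp
  have "expectation (W e) \<le> expectation (\<lambda>_. 1)"
    using weight_range[OF assms] integrable_weight[OF assms] by (intro integral_mono_AE) auto
  then show "\<mu> e \<le> 1" using expectation_weight[OF assms] by (simp add: prob_space)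
qed

end

locale assortative_SBM = weighted_SBM +
  assumes d_ge_2: "d \<ge> 2" and n_pos: "n > 0" and q_nonneg: "0 \<le> q" and q_less_p: "q < p"
begin

lemma p_pos: "p > 0" using q_nonneg q_less_p by simp

lemma mean_weight_le: "\<mu> e \<le> p * \<alpha>"
  using q_less_p scale_pos by (auto simp: mean_weight_def intro!: mult_right_mono)

lemma mean_weight_nonneg: "\<mu> e \<ge> 0"
  using q_nonneg p_pos scale_pos by (simp add: mean_weight_def)

lemma sum_mean_pair_count_le:
  assumes "S \<subseteq> {..<n}" "T \<subseteq> {..<n}"
  shows "(\<Sum>e\<in>E. \<mu> e * pair_count S T e) \<le> p * degree_scale * (card S * card T / n)"
proof -
  have "(\<Sum>e\<in>E. \<mu> e * pair_count S T e) \<le> (\<Sum>e\<in>E. p * \<alpha> * pair_count S T e)"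
    by (intro sum_mono mult_right_mono mean_weight_le) auto
  also have "\<dots> = p * \<alpha> * (\<Sum>e\<in>E. pair_count S T e)" by (simp add: sum_distrib_left)
  also have "\<dots> \<le> p * \<alpha> * (real (card S) * real (card T) * real ((n - 2) choose (d - 2)))"
    using assms d_ge_2 p_pos scale_pos by (intro mult_left_mono sum_pair_count_le) auto
  also have "\<dots> = p * degree_scale * (card S * card T / n)"
    using n_pos by (simp add: degree_scale_def)
  finally show ?thesis .
qed

lemma sum_mean_pair_count_le_total:
  assumes "S \<subseteq> {..<n}" "T \<subseteq> {..<n}"
  shows "(\<Sum>e\<in>E. \<mu> e * pair_count S T e) \<le> p * degree_scale * n"
proof -
  have "real (card S) * real (card T) \<le> real n * real n"
    using assms card_mono[of "{..<n}" S] card_mono[of "{..<n}" T] by (intro mult_mono) auto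
  then have "real (card S) * real (card T) / n \<le> n" using n_pos by (simp add: divide_le_eq)
  then have "p * degree_scale * (card S * card T / n) \<le> p * degree_scale * n"
    using p_pos degree_scale_nonneg by (intro mult_left_mono) auto
  then show ?thesis using sum_mean_pair_count_le[OF assms] by linarith
qed

lemma pair_count_le_d:
  assumes "S \<subseteq> {..<n}" "T \<subseteq> {..<n}" "e \<in> E"
  shows "pair_count S T e \<le> real d ^ 2"
  using pair_count_le[of S T e] hyperedgeD[OF assms(3)] assms by (auto intro: finite_subset)

text \<open>
  Deviation of a block sum of the similarity matrix from its mean. Singletons \<open>S\<close> give the row
  deviations.
\<close>

definition cut_dev :: "nat set \<Rightarrow> nat set \<Rightarrow> 'a \<Rightarrow> real" where
  "cut_dev S T \<omega> = (\<Sum>i\<in>S. \<Sum>j\<in>T. similarity n d (\<lambda>e. W e \<omega>) i j - similarity n d \<mu> i j)"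

lemma cut_dev_eq: "cut_dev S T \<omega> = (\<Sum>e\<in>E. pair_count S T e * (W e \<omega> - \<mu> e))"
proof -
  have "cut_dev S T \<omega> = (\<Sum>i\<in>S. \<Sum>j\<in>T. similarity n d (\<lambda>e. W e \<omega>) i j) - (\<Sum>i\<in>S. \<Sum>j\<in>T. similarity n d \<mu> i j)"
    unfolding cut_dev_def by (simp only: sum_subtractf)
  then show ?thesis by (simp only: sum_similarity sum_subtractf right_diff_distrib mult.commute)
qed

lemma cut_dev_measurable [measurable]: "random_variable borel (cut_dev S T)"
  unfolding cut_dev_eq[abs_def] by measurable

text \<open>
  The deviation \<open>\<gamma> D n\<close> is a constant fraction of the largest possible mean, so the exponent is of order
  \<open>D n\<close>; a constant \<open>D\<close> is already enough to beat the \<open>4 ^ n\<close> pairs of node sets.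
\<close>

lemma cut_dev_tail:
  assumes ST: "S \<subseteq> {..<n}" "T \<subseteq> {..<n}" and \<gamma>: "0 < \<gamma>" "\<gamma> \<le> p"
    and D: "degree_scale * \<gamma>\<^sup>2 \<ge> 16 * real d ^ 2 * p"
  shows "prob {\<omega> \<in> space M. \<bar>cut_dev S T \<omega>\<bar> \<ge> \<gamma> * degree_scale * n} \<le> 2 * exp (- (4 * real n))"
proof -
  \<comment> \<open>minimises \<open>- l \<gamma> + l\<^sup>2 d\<^sup>2 p\<close>\<close>
  define l where "l = \<gamma> / (2 * real d ^ 2 * p)"
  have d: "real d > 0" using d_ge_2 by simp
  have l: "l > 0" using \<gamma> p_pos d by (simp add: l_def)
  define V where "V = real d ^ 2 * (p * degree_scale * n)"
  have tail: "prob {\<omega> \<in> space M. (\<Sum>e\<in>E. (s * pair_count S T e) * (W e \<omega> - expectation (W e))) \<ge> \<gamma> * degree_scale * n}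
       \<le> exp (- (4 * real n))" if s: "\<bar>s\<bar> = 1" for s :: real
  proof -
    have "s\<^sup>2 = 1" using s by (metis power2_abs power_one)
    then have sq: "(s * x)\<^sup>2 = x * x" for x by (simp add: power_mult_distrib power2_eq_square)
    have "prob {\<omega> \<in> space M. (\<Sum>e\<in>E. (s * pair_count S T e) * (W e \<omega> - expectation (W e))) \<ge> \<gamma> * degree_scale * n}
      \<le> exp (- l * (\<gamma> * degree_scale * n) + l\<^sup>2 * V)"
    proof (rule bernstein_upper_tail[OF finite_hyperedges indep_weights weight_range l])
      fix e assume e: "e \<in> E"
      have "\<bar>l * (s * pair_count S T e)\<bar> = l * pair_count S T e" using l s by (simp add: abs_mult)
      also have "\<dots> \<le> l * real d ^ 2" using l pair_count_le_d[OF ST e] by (intro mult_left_mono) auto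
      also have "\<dots> = \<gamma> / (2 * p)" using d by (simp add: l_def)
      also have "\<dots> \<le> 1" using \<gamma> p_pos by simp
      finally show "\<bar>l * (s * pair_count S T e)\<bar> \<le> 1" .
    next
      have "(\<Sum>e\<in>E. expectation (W e) * (s * pair_count S T e)\<^sup>2) \<le> (\<Sum>e\<in>E. real d ^ 2 * (\<mu> e * pair_count S T e))"
      proof (rule sum_mono)
        fix e assume e: "e \<in> E"
        have "\<mu> e * (pair_count S T e * pair_count S T e) \<le> \<mu> e * (real d ^ 2 * pair_count S T e)"
          using pair_count_le_d[OF ST e] mean_weight_nonneg by (intro mult_left_mono mult_right_mono) auto
        then show "expectation (W e) * (s * pair_count S T e)\<^sup>2 \<le> real d ^ 2 * (\<mu> e * pair_count S T e)"
          using e by (simp add: expectation_weight sq mult_ac)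
      qed
      also have "\<dots> = real d ^ 2 * (\<Sum>e\<in>E. \<mu> e * pair_count S T e)" by (simp add: sum_distrib_left)
      also have "\<dots> \<le> V" unfolding V_def by (intro mult_left_mono sum_mean_pair_count_le_total ST) auto
      finally show "(\<Sum>e\<in>E. expectation (W e) * (s * pair_count S T e)\<^sup>2) \<le> V" .
    qed
    also have "- l * (\<gamma> * degree_scale * n) + l\<^sup>2 * V = - (degree_scale * \<gamma>\<^sup>2 / (4 * real d ^ 2 * p)) * n"
      using d p_pos unfolding l_def V_def by (simp add: field_simps power2_eq_square)
    also have "\<dots> \<le> - (4 * real n)"
    proof -
      have "4 \<le> degree_scale * \<gamma>\<^sup>2 / (4 * real d ^ 2 * p)"
        using D d p_pos by (simp add: le_divide_eq)
      then have "4 * real n \<le> degree_scale * \<gamma>\<^sup>2 / (4 * real d ^ 2 * p) * n" by (intro mult_right_mono) auto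
      then show ?thesis by simp
    qed
    finally show ?thesis by simp
  qed
  have eq: "(\<Sum>e\<in>E. (s * pair_count S T e) * (W e \<omega> - expectation (W e))) = s * cut_dev S T \<omega>" for s \<omega>
    unfolding cut_dev_eq sum_distrib_left by (intro sum.cong refl) (simp add: expectation_weight)
  have "prob {\<omega> \<in> space M. \<bar>cut_dev S T \<omega>\<bar> \<ge> \<gamma> * degree_scale * n}
     \<le> prob ({\<omega> \<in> space M. 1 * cut_dev S T \<omega> \<ge> \<gamma> * degree_scale * n} \<union> {\<omega> \<in> space M. (-1) * cut_dev S T \<omega> \<ge> \<gamma> * degree_scale * n})"
    by (intro finite_measure_mono) (auto simp: abs_if split: if_splits)
  also have "\<dots> \<le> prob {\<omega> \<in> space M. 1 * cut_dev S T \<omega> \<ge> \<gamma> * degree_scale * n}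
     + prob {\<omega> \<in> space M. (-1) * cut_dev S T \<omega> \<ge> \<gamma> * degree_scale * n}"
    by (rule measure_Un_le) auto
  also have "\<dots> \<le> exp (- (4 * real n)) + exp (- (4 * real n))"
    using tail[of 1] tail[of "-1"] unfolding eq by (intro add_mono) auto
  finally show ?thesis by simp
qed

definition cut_event :: "real \<Rightarrow> 'a set" where
  "cut_event \<gamma> = {\<omega> \<in> space M. \<forall>S\<in>Pow {..<n}. \<forall>T\<in>Pow {..<n}. \<not> \<bar>cut_dev S T \<omega>\<bar> \<ge> \<gamma> * degree_scale * n}"

lemma cut_event_sets [measurable]: "cut_event \<gamma> \<in> events"
  unfolding cut_event_def by (intro sets.sets_Collect_finite_All) auto

lemma prob_cut_event:
  assumes \<gamma>: "0 < \<gamma>" "\<gamma> \<le> p" and D: "degree_scale * \<gamma>\<^sup>2 \<ge> 16 * real d ^ 2 * p"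
  shows "prob (space M - cut_event \<gamma>) \<le> 1 / n"
proof -
  let ?I = "Pow {..<n} \<times> Pow {..<n}"
  let ?F = "\<lambda>(S, T). {\<omega> \<in> space M. \<bar>cut_dev S T \<omega>\<bar> \<ge> \<gamma> * degree_scale * n}"
  have "space M - cut_event \<gamma> = (\<Union>x\<in>?I. ?F x)" unfolding cut_event_def by blast
  then have "prob (space M - cut_event \<gamma>) \<le> (\<Sum>x\<in>?I. prob (?F x))"
    by (simp only:) (intro measure_UNION_le, auto)
  also have "\<dots> \<le> (\<Sum>x\<in>?I. 2 * exp (- (4 * real n)))"
    using cut_dev_tail[OF _ _ \<gamma> D] by (intro sum_mono) auto
  also have "\<dots> = 2 * (4 ^ n / exp (4 * real n))"
    by (simp add: card_cartesian_product card_Pow power_mult_distrib[symmetric] exp_minus inverse_eq_divide)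
  also have "\<dots> \<le> 1 / n"
  proof -
    \<comment> \<open>This is where the exponent \<open>4 n\<close> comes from: \<open>exp 4 \<ge> 16\<close> absorbs \<open>4 ^ n\<close> and the factor \<open>2 n\<close>.\<close>
    have "2 * real n * 4 ^ n \<le> 4 ^ n * 4 ^ n"
    proof (rule mult_right_mono)
      show "2 * real n \<le> 4 ^ n" using Bernoulli_inequality[of "3::real" n] by simp
    qed simp
    also have "\<dots> = 16 ^ n" by (simp add: power_mult_distrib[symmetric])
    also have "\<dots> \<le> (exp 4) ^ n"
    proof (rule power_mono)
      have "(2::real) ^ 4 \<le> exp 1 ^ 4" using exp_ge_add_one_self[of 1] by (intro power_mono) auto
      then show "16 \<le> exp (4::real)" using exp_of_nat_mult[of 4 "1::real"] by simp
    qed simp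
    also have "\<dots> = exp (4 * real n)" by (simp add: exp_of_nat_mult[symmetric] mult.commute)
    finally show ?thesis using n_pos by (simp add: field_simps)
  qed
  finally show ?thesis .
qed

definition sparse_event :: "real \<Rightarrow> real \<Rightarrow> 'a set" where
  "sparse_event \<theta> \<delta> = {\<omega> \<in> space M. \<forall>S\<in>{S. S \<subseteq> {..<n} \<and> S \<noteq> {} \<and> real (card S) \<le> \<theta> * n}.
     \<not> (\<Sum>e\<in>E. W e \<omega> * pair_count S S e) \<ge> \<delta> * degree_scale * card S}"

lemma sparse_event_sets [measurable]: "sparse_event \<theta> \<delta> \<in> events"
proof -
  have "finite {S. S \<subseteq> {..<n} \<and> S \<noteq> {} \<and> real (card S) \<le> \<theta> * n}"
    by (rule finite_subset[of _ "Pow {..<n}"]) auto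
  then show ?thesis unfolding sparse_event_def by (intro sets.sets_Collect_finite_All) auto
qed

text \<open>
  A set of \<open>s\<close> nodes has mean internal weight at most \<open>p D s\<^sup>2 / n\<close>, which is far below \<open>\<delta> D s\<close> when
  \<open>s / n\<close> is small. The Poisson tail is used with the large exponent that satisfies
  \<open>exp (l d\<^sup>2) = n / s\<close>; it yields a power of \<open>s / n\<close> that beats the number of sets of this size.
\<close>

lemma dense_set_tail:
  fixes \<theta> \<delta> :: real
  assumes S: "S \<subseteq> {..<n}" "S \<noteq> {}" "real (card S) \<le> \<theta> * n"
    and \<theta>: "0 < \<theta>" "\<theta> \<le> 1 / 6" and \<delta>: "\<delta> > 0"
    and ln\<theta>: "ln (1 / \<theta>) \<ge> 2 * p * real d ^ 2 / \<delta>" and D: "degree_scale \<ge> 6 * real d ^ 2 / \<delta>"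
  shows "prob {\<omega> \<in> space M. (\<Sum>e\<in>E. W e \<omega> * pair_count S S e) \<ge> \<delta> * degree_scale * card S}
     \<le> (real (card S) / n) ^ (3 * card S)"
proof -
  define s where "s = real (card S)"
  have d: "real d > 0" using d_ge_2 by simp
  have s: "s > 0" using S(1,2) finite_subset[OF S(1)] by (auto simp: s_def card_gt_0_iff)
  have nn: "real n > 0" using n_pos by simp
  define L where "L = ln (n / s)"
  have "1 / \<theta> \<le> n / s" using S(3) s \<theta> by (simp add: s_def[symmetric] field_simps)
  then have L1: "L \<ge> ln (1 / \<theta>)" unfolding L_def using \<theta> s nn by (subst ln_le_cancel_iff) auto
  have expL: "exp L = n / s" using s nn by (simp add: L_def)
  have L0: "L > 0"
  proof -
    have "1 < 1 / \<theta>" using \<theta> by (simp add: field_simps)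
    then have "ln (1 / \<theta>) > 0" by (rule ln_gt_zero)
    then show ?thesis using L1 by simp
  qed
  define l where "l = L / real d ^ 2"
  have l: "l > 0" using L0 d by (simp add: l_def)
  have ld: "l * real d ^ 2 = L" using d by (simp add: l_def)
  let ?c = "\<lambda>e. pair_count S S e"
  have "{\<omega> \<in> space M. (\<Sum>e\<in>E. W e \<omega> * ?c e) \<ge> \<delta> * degree_scale * s}
     = {\<omega> \<in> space M. (\<Sum>e\<in>E. (l * ?c e) * W e \<omega>) \<ge> l * (\<delta> * degree_scale * s)}"
  proof -
    have "(\<Sum>e\<in>E. (l * ?c e) * W e \<omega>) = l * (\<Sum>e\<in>E. W e \<omega> * ?c e)" for \<omega>
      by (simp add: sum_distrib_left mult_ac)
    then show ?thesis using l by (simp add: mult.assoc)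
  qed
  then have "prob {\<omega> \<in> space M. (\<Sum>e\<in>E. W e \<omega> * ?c e) \<ge> \<delta> * degree_scale * s}
     \<le> exp (- (l * (\<delta> * degree_scale * s)) + (\<Sum>e\<in>E. expectation (W e) * (exp (l * ?c e) - 1)))"
    using poisson_chernoff[OF finite_hyperedges indep_weights weight_range, where c = "\<lambda>e. l * ?c e" and r = "l * (\<delta> * degree_scale * s)"]
    by (simp only:)
  also have "\<dots> \<le> exp (- (l * (\<delta> * degree_scale * s)) + p * degree_scale * s)"
  proof -
    have "(\<Sum>e\<in>E. expectation (W e) * (exp (l * ?c e) - 1)) \<le> (\<Sum>e\<in>E. (n / s) * (\<mu> e * ?c e))"
    proof (rule sum_mono)
      fix e assume e: "e \<in> E"
      have "exp (l * ?c e) - 1 \<le> ?c e * (n / s)"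
      proof (cases "?c e = 0")
        case False
        have fin: "finite S" using S(1) by (rule finite_subset) simp
        have "exp (l * ?c e) \<le> exp (l * real d ^ 2)"
          using l pair_count_le_d[OF S(1) S(1) e] by simp
        also have "\<dots> = 1 * (n / s)" using ld expL by simp
        also have "\<dots> \<le> ?c e * (n / s)" using pair_count_ge_1[OF fin fin False] s by (intro mult_right_mono) auto
        finally show ?thesis by simp
      qed simp
      then have "\<mu> e * (exp (l * ?c e) - 1) \<le> \<mu> e * (?c e * (n / s))" by (intro mult_left_mono mean_weight_nonneg)
      then show "expectation (W e) * (exp (l * ?c e) - 1) \<le> (n / s) * (\<mu> e * ?c e)"
        using e by (simp add: expectation_weight mult_ac)
    qed
    also have "\<dots> = (n / s) * (\<Sum>e\<in>E. \<mu> e * ?c e)" by (simp add: sum_distrib_left)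
    also have "\<dots> \<le> (n / s) * (p * degree_scale * (s * s / n))"
      using sum_mean_pair_count_le[OF S(1) S(1)] s by (intro mult_left_mono) (auto simp: s_def)
    also have "\<dots> = p * degree_scale * s" using s nn by simp
    finally show ?thesis by simp
  qed
  also have "\<dots> \<le> exp (- (3 * s * L))"
  proof -
    have "2 * p * real d ^ 2 / \<delta> \<le> L" using ln\<theta> L1 by simp
    then have "2 * p * real d ^ 2 \<le> L * \<delta>" using \<delta> by (simp add: divide_le_eq)
    then have "p \<le> l * \<delta> / 2" using d by (simp add: l_def field_simps)
    then have "p * (degree_scale * s) \<le> (l * \<delta> / 2) * (degree_scale * s)"
      using degree_scale_nonneg s by (intro mult_right_mono) auto
    moreover have "3 * L \<le> (l * \<delta> / 2) * degree_scale"
    proof -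
      have "6 * real d ^ 2 \<le> degree_scale * \<delta>" using D \<delta> by (simp add: divide_le_eq)
      then have "l * (6 * real d ^ 2) \<le> l * (degree_scale * \<delta>)" using l by (intro mult_left_mono) auto
      then show ?thesis using ld by (simp add: mult_ac)
    qed
    then have "3 * L * s \<le> (l * \<delta> / 2) * degree_scale * s" using s by (intro mult_right_mono) auto
    ultimately have "p * degree_scale * s + 3 * s * L \<le> l * (\<delta> * degree_scale * s)" by (simp add: mult_ac)
    then show ?thesis by simp
  qed
  also have "\<dots> = exp (- L) ^ (3 * card S)" by (simp add: exp_of_nat_mult[symmetric] s_def)
  also have "exp (- L) = s / n" using expL by (simp add: exp_minus)
  finally show ?thesis by (simp add: s_def)
qed

lemma prob_sparse_event:
  fixes \<theta> \<delta> :: real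
  assumes \<theta>: "0 < \<theta>" "\<theta> \<le> 1 / 6" and \<delta>: "\<delta> > 0"
    and ln\<theta>: "ln (1 / \<theta>) \<ge> 2 * p * real d ^ 2 / \<delta>" and D: "degree_scale \<ge> 6 * real d ^ 2 / \<delta>"
  shows "prob (space M - sparse_event \<theta> \<delta>) \<le> 2 / n"
proof -
  let ?I = "{S. S \<subseteq> {..<n} \<and> S \<noteq> {} \<and> real (card S) \<le> \<theta> * n}"
  let ?F = "\<lambda>S. {\<omega> \<in> space M. (\<Sum>e\<in>E. W e \<omega> * pair_count S S e) \<ge> \<delta> * degree_scale * card S}"
  have fin: "finite ?I" by (rule finite_subset[of _ "Pow {..<n}"]) auto
  have "space M - sparse_event \<theta> \<delta> = (\<Union>S\<in>?I. ?F S)"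
    unfolding sparse_event_def by blast
  then have "prob (space M - sparse_event \<theta> \<delta>) \<le> (\<Sum>S\<in>?I. prob (?F S))"
    by (simp only:) (intro measure_UNION_le fin, measurable)
  also have "\<dots> \<le> (\<Sum>S\<in>?I. (real (card S) / n) ^ (3 * card S))"
    using dense_set_tail[OF _ _ _ assms] by (intro sum_mono) blast
  also have "\<dots> \<le> 2 / n" using n_pos \<theta> by (intro sum_small_subsets_le)
  finally show ?thesis .
qed

text \<open>
  The off-diagonal part of the sum of squared row deviations towards \<open>C\<close>, see \<open>sum_square_row_dev\<close>.
\<close>

definition cross_term :: "nat set \<Rightarrow> 'a \<Rightarrow> real" where
  "cross_term C \<omega> = (\<Sum>P\<in>{P. P \<subseteq> E \<and> card P = 2}.
     2 * (\<Sum>i<n. \<Prod>e\<in>P. pair_count {i} C e) * (\<Prod>e\<in>P. W e \<omega> - \<mu> e))"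

lemma cross_term_measurable [measurable]: "random_variable borel (cross_term C)"
proof -
  have "(\<lambda>\<omega>. \<Prod>e\<in>P. W e \<omega> - \<mu> e) \<in> borel_measurable M" if "P \<subseteq> E" for P
    using that by (intro borel_measurable_prod borel_measurable_diff weight_measurable) auto
  then show ?thesis unfolding cross_term_def[abs_def]
    by (intro borel_measurable_sum borel_measurable_times borel_measurable_const) auto
qed

lemma sum_square_row_dev:
  "(\<Sum>i<n. (cut_dev {i} C \<omega>)\<^sup>2) = (\<Sum>e\<in>E. (W e \<omega> - \<mu> e)\<^sup>2 * (\<Sum>i<n. (pair_count {i} C e)\<^sup>2)) + cross_term C \<omega>"
proof -
  have "(\<Sum>i<n. (cut_dev {i} C \<omega>)\<^sup>2) = (\<Sum>i<n. (\<Sum>e\<in>E. (pair_count {i} C e * (W e \<omega> - \<mu> e))\<^sup>2)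
      + 2 * (\<Sum>P\<in>{P. P \<subseteq> E \<and> card P = 2}. \<Prod>e\<in>P. pair_count {i} C e * (W e \<omega> - \<mu> e)))"
    unfolding cut_dev_eq by (intro sum.cong refl square_of_sum) simp
  also have "\<dots> = (\<Sum>i<n. \<Sum>e\<in>E. (W e \<omega> - \<mu> e)\<^sup>2 * (pair_count {i} C e)\<^sup>2)
      + (\<Sum>i<n. \<Sum>P\<in>{P. P \<subseteq> E \<and> card P = 2}. 2 * ((\<Prod>e\<in>P. pair_count {i} C e) * (\<Prod>e\<in>P. W e \<omega> - \<mu> e)))"
  proof -
    have "(\<Sum>e\<in>E. (pair_count {i} C e * (W e \<omega> - \<mu> e))\<^sup>2) = (\<Sum>e\<in>E. (W e \<omega> - \<mu> e)\<^sup>2 * (pair_count {i} C e)\<^sup>2)" for i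
      by (simp only: power_mult_distrib mult.commute)
    moreover have "2 * (\<Sum>P\<in>{P. P \<subseteq> E \<and> card P = 2}. \<Prod>e\<in>P. pair_count {i} C e * (W e \<omega> - \<mu> e))
      = (\<Sum>P\<in>{P. P \<subseteq> E \<and> card P = 2}. 2 * ((\<Prod>e\<in>P. pair_count {i} C e) * (\<Prod>e\<in>P. W e \<omega> - \<mu> e)))" for i
      by (simp only: prod.distrib sum_distrib_left)
    ultimately show ?thesis by (simp only: sum.distrib)
  qed
  also have "(\<Sum>i<n. \<Sum>e\<in>E. (W e \<omega> - \<mu> e)\<^sup>2 * (pair_count {i} C e)\<^sup>2)
      = (\<Sum>e\<in>E. (W e \<omega> - \<mu> e)\<^sup>2 * (\<Sum>i<n. (pair_count {i} C e)\<^sup>2))"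
    by (subst sum.swap) (simp only: sum_distrib_left)
  also have "(\<Sum>i<n. \<Sum>P\<in>{P. P \<subseteq> E \<and> card P = 2}. 2 * ((\<Prod>e\<in>P. pair_count {i} C e) * (\<Prod>e\<in>P. W e \<omega> - \<mu> e)))
      = cross_term C \<omega>"
    unfolding cross_term_def
    by (subst sum.swap) (simp only: sum_distrib_left sum_distrib_right mult.assoc)
  finally show ?thesis .
qed

lemma sum_pair_count_sq_le:
  assumes C: "C \<subseteq> {..<n}" and e: "e \<in> E"
  shows "(\<Sum>i<n. (pair_count {i} C e)\<^sup>2) \<le> real d ^ 3"
proof -
  have fin: "finite C" "finite e" and ce: "card e = d" using C hyperedgeD[OF e] by (auto intro: finite_subset)
  have "(\<Sum>i<n. (pair_count {i} C e)\<^sup>2) \<le> (\<Sum>i<n. if i \<in> e then real d ^ 2 else 0)"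
  proof (rule sum_mono)
    fix i
    show "(pair_count {i} C e)\<^sup>2 \<le> (if i \<in> e then real d ^ 2 else 0)"
      using pair_count_singleton_le[OF fin, of i] ce by (auto intro!: power_mono)
  qed
  also have "\<dots> = real (card ({..<n} \<inter> e)) * real d ^ 2" by (simp add: sum.If_cases)
  also have "\<dots> \<le> real d * real d ^ 2"
    using card_mono[of e "{..<n} \<inter> e"] fin ce by (intro mult_right_mono) auto
  finally show ?thesis by (simp add: power3_eq_cube power2_eq_square)
qed

text \<open>
  The variance of a variable in the unit interval is at most its mean.
\<close>

lemma expectation_centered_sq_le:
  assumes e: "e \<in> E"
  shows "expectation (\<lambda>\<omega>. (W e \<omega> - \<mu> e)\<^sup>2) \<le> p * \<alpha>" "expectation (\<lambda>\<omega>. (W e \<omega> - \<mu> e)\<^sup>2) \<ge> 0"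
proof -
  have int: "integrable M (W e)" "integrable M (\<lambda>\<omega>. (W e \<omega> - \<mu> e)\<^sup>2)"
  proof -
    show "integrable M (W e)" by (rule integrable_weight[OF e])
    show "integrable M (\<lambda>\<omega>. (W e \<omega> - \<mu> e)\<^sup>2)"
    proof (rule integrable_const_bound[where B = 1])
      show "AE \<omega> in M. norm ((W e \<omega> - \<mu> e)\<^sup>2) \<le> 1"
        using weight_range[OF e]
      proof eventually_elim
        case (elim \<omega>)
        then show ?case using mean_weight_unit[OF e] by (auto simp: abs_square_le_1)
      qed
    qed (use weight_measurable[OF e] in measurable)
  qed
  have "expectation (\<lambda>\<omega>. (W e \<omega> - \<mu> e)\<^sup>2) \<le> expectation (\<lambda>\<omega>. W e \<omega> - 2 * \<mu> e * W e \<omega> + (\<mu> e)\<^sup>2)"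
  proof (rule integral_mono_AE)
    show "AE \<omega> in M. (W e \<omega> - \<mu> e)\<^sup>2 \<le> W e \<omega> - 2 * \<mu> e * W e \<omega> + (\<mu> e)\<^sup>2"
      using weight_range[OF e]
    proof eventually_elim
      case (elim \<omega>)
      then have "W e \<omega> * W e \<omega> \<le> 1 * W e \<omega>" by (intro mult_right_mono) auto
      then show ?case by (simp add: power2_eq_square algebra_simps)
    qed
  qed (use int in auto)
  also have "\<dots> = \<mu> e - 2 * \<mu> e * \<mu> e + (\<mu> e)\<^sup>2"
    using int by (simp add: expectation_weight e prob_space)
  also have "\<dots> \<le> \<mu> e" by (simp add: power2_eq_square)
  also have "\<dots> \<le> p * \<alpha>" by (rule mean_weight_le)
  finally show "expectation (\<lambda>\<omega>. (W e \<omega> - \<mu> e)\<^sup>2) \<le> p * \<alpha>" .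
qed simp

text \<open>
  The coefficients are nonnegative, bounded by \<open>2 d\<^sup>3\<close> since two hyperedges share at most \<open>d\<close> nodes, and
  their sum is at most the sum over nodes of squared hyperedge counts, by \<open>square_of_sum\<close> read
  backwards. Each pair of variances contributes \<open>(p \<alpha>)\<^sup>2\<close>, so the second moment is of order
  \<open>n D\<^sup>2\<close>, which is compared with the squared level \<open>(n D)\<^sup>2\<close>.
\<close>

lemma prob_cross_term:
  assumes C: "C \<subseteq> {..<n}" and D: "degree_scale > 0"
  shows "prob {\<omega> \<in> space M. \<bar>cross_term C \<omega>\<bar> \<ge> degree_scale * n} \<le> 2 * p\<^sup>2 * real d ^ 3 / n"
proof -
  let ?F = "{P. P \<subseteq> E \<and> card P = 2}"
  define b where "b = (\<lambda>P. 2 * (\<Sum>i<n. \<Prod>e\<in>P. pair_count {i} C e))"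
  define w where "w = (\<lambda>e \<omega>. W e \<omega> - \<mu> e)"
  have b0: "b P \<ge> 0" for P unfolding b_def by (intro mult_nonneg_nonneg sum_nonneg prod_nonneg) auto
  have bmax: "b P \<le> 2 * real d ^ 3" if P: "P \<in> ?F" for P
  proof -
    obtain e f where ef: "P = {e, f}" "e \<noteq> f" "e \<in> E" "f \<in> E"
      using P by (auto simp: card_2_iff)
    have fin: "finite C" "finite e" "finite f" and ce: "card e = d" "card f = d"
      using C hyperedgeD[OF ef(3)] hyperedgeD[OF ef(4)] by (auto intro: finite_subset)
    have "(\<Sum>i<n. \<Prod>e\<in>P. pair_count {i} C e) \<le> (\<Sum>i<n. if i \<in> e then real d * real d else 0)"
    proof (rule sum_mono)
      fix i
      have "pair_count {i} C f \<le> d" using pair_count_singleton_le(1)[OF fin(1) fin(3), of i] ce by simp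
      moreover have "pair_count {i} C e \<le> (if i \<in> e then real d else 0)"
        using pair_count_singleton_le[OF fin(1) fin(2), of i] ce by auto
      ultimately have "pair_count {i} C e * pair_count {i} C f \<le> (if i \<in> e then real d else 0) * real d"
        by (intro mult_mono) auto
      then show "(\<Prod>e\<in>P. pair_count {i} C e) \<le> (if i \<in> e then real d * real d else 0)"
        using ef by (simp split: if_splits)
    qed
    also have "\<dots> = real (card ({..<n} \<inter> e)) * (real d * real d)" by (simp add: sum.If_cases)
    also have "\<dots> \<le> real d * (real d * real d)"
      using card_mono[of e "{..<n} \<inter> e"] fin ce by (intro mult_right_mono) auto
    finally show ?thesis by (simp add: b_def power3_eq_cube)
  qed
  have bsum: "(\<Sum>P\<in>?F. b P) \<le> real n * (real n * real ((n - 2) choose (d - 2)))\<^sup>2"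
  proof -
    have "(\<Sum>P\<in>?F. b P) = (\<Sum>i<n. 2 * (\<Sum>P\<in>?F. \<Prod>e\<in>P. pair_count {i} C e))"
      unfolding b_def sum_distrib_left by (rule sum.swap)
    also have "\<dots> \<le> (\<Sum>i<n. (real n * real ((n - 2) choose (d - 2)))\<^sup>2)"
    proof (rule sum_mono)
      fix i assume i: "i \<in> {..<n}"
      have "2 * (\<Sum>P\<in>?F. \<Prod>e\<in>P. pair_count {i} C e) \<le> (\<Sum>e\<in>E. pair_count {i} C e)\<^sup>2"
        unfolding square_of_sum[OF finite_hyperedges] by (simp add: sum_nonneg)
      also have "\<dots> \<le> (real n * real ((n - 2) choose (d - 2)))\<^sup>2"
      proof (rule power_mono)
        have "(\<Sum>e\<in>E. pair_count {i} C e) \<le> real (card {i}) * real (card C) * real ((n - 2) choose (d - 2))"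
          using i C d_ge_2 by (intro sum_pair_count_le) auto
        also have "\<dots> \<le> real n * real ((n - 2) choose (d - 2))"
          using card_mono[OF _ C] by (intro mult_right_mono) auto
        finally show "(\<Sum>e\<in>E. pair_count {i} C e) \<le> real n * real ((n - 2) choose (d - 2))" .
      qed (simp add: sum_nonneg)
      finally show "2 * (\<Sum>P\<in>?F. \<Prod>e\<in>P. pair_count {i} C e) \<le> (real n * real ((n - 2) choose (d - 2)))\<^sup>2" .
    qed
    finally show ?thesis by simp
  qed
  define V where "V = 2 * p\<^sup>2 * real d ^ 3 * real n * degree_scale\<^sup>2"
  have "prob {\<omega> \<in> space M. \<bar>\<Sum>P\<in>?F. b P * (\<Prod>e\<in>P. w e \<omega>)\<bar> \<ge> degree_scale * n} \<le> V / (degree_scale * n)\<^sup>2"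
  proof (rule chaos_tail[where I = E])
    show "indep_vars (\<lambda>_. borel) w E"
      unfolding w_def by (rule indep_vars_compose2[OF indep_weights]) simp
    show "AE \<omega> in M. \<bar>w e \<omega>\<bar> \<le> 1" if e: "e \<in> E" for e
      using weight_range[OF e]
    proof eventually_elim
      case (elim \<omega>)
      then show ?case using mean_weight_unit[OF e] by (auto simp: w_def)
    qed
    show "expectation (w e) = 0" if e: "e \<in> E" for e
      unfolding w_def using integrable_weight[OF e] by (simp add: expectation_weight e prob_space)
    have "(\<Sum>P\<in>?F. (b P)\<^sup>2 * (\<Prod>e\<in>P. expectation (\<lambda>\<omega>. (w e \<omega>)\<^sup>2))) \<le> (\<Sum>P\<in>?F. (2 * real d ^ 3 * b P) * (p * \<alpha>)\<^sup>2)"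
    proof (rule sum_mono)
      fix P assume P: "P \<in> ?F"
      have "(\<Prod>e\<in>P. expectation (\<lambda>\<omega>. (w e \<omega>)\<^sup>2)) \<le> (\<Prod>e\<in>P. p * \<alpha>)"
        using P expectation_centered_sq_le by (intro prod_mono) (auto simp: w_def)
      also have "\<dots> = (p * \<alpha>)\<^sup>2" using P by simp
      finally have prod: "(\<Prod>e\<in>P. expectation (\<lambda>\<omega>. (w e \<omega>)\<^sup>2)) \<le> (p * \<alpha>)\<^sup>2" .
      have "(b P)\<^sup>2 \<le> 2 * real d ^ 3 * b P"
        using bmax[OF P] b0[of P] by (simp add: power2_eq_square mult_right_mono)
      then show "(b P)\<^sup>2 * (\<Prod>e\<in>P. expectation (\<lambda>\<omega>. (w e \<omega>)\<^sup>2)) \<le> (2 * real d ^ 3 * b P) * (p * \<alpha>)\<^sup>2"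
        using prod b0[of P] by (intro mult_mono) (auto intro!: prod_nonneg)
    qed
    also have "\<dots> = 2 * real d ^ 3 * (p * \<alpha>)\<^sup>2 * (\<Sum>P\<in>?F. b P)"
      by (simp add: sum_distrib_left mult_ac)
    also have "\<dots> \<le> 2 * real d ^ 3 * (p * \<alpha>)\<^sup>2 * (real n * (real n * real ((n - 2) choose (d - 2)))\<^sup>2)"
      by (intro mult_left_mono bsum) auto
    also have "\<dots> = V" by (simp add: V_def degree_scale_def power_mult_distrib mult_ac)
    finally show "(\<Sum>P\<in>?F. (b P)\<^sup>2 * (\<Prod>e\<in>P. expectation (\<lambda>\<omega>. (w e \<omega>)\<^sup>2))) \<le> V" .
  qed (use D n_pos in auto)
  also have "V / (degree_scale * n)\<^sup>2 = 2 * p\<^sup>2 * real d ^ 3 / n"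
    using D n_pos by (simp add: V_def power2_eq_square)
  finally show ?thesis by (simp add: cross_term_def b_def w_def)
qed

end

section \<open>Mean similarities of a balanced partition\<close>

text \<open>
  A trimming constant large enough that the threshold exceeds twice every mean degree, whatever the
  number of clusters: the factor \<open>(2 d R) ^ d\<close> is the worst ratio of homogeneous pair counts between
  clusters whose sizes differ by the factor \<open>R\<close>.
\<close>

definition threshold_const :: "nat \<Rightarrow> real \<Rightarrow> real" where
  "threshold_const d R = 8 * R * (2 * real d * R) ^ d"

text \<open>
  Lower bound, in units of \<open>degree_scale\<close>, for the eigenvalues of the mean matrix on the cluster
  indicators. The factor \<open>k R\<close> bounds the ratio between \<open>n\<close> and the size of a cluster.
\<close>

definition gap_const :: "nat \<Rightarrow> nat \<Rightarrow> real \<Rightarrow> real \<Rightarrow> real \<Rightarrow> real" where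
  "gap_const k d R p q = (p - q) / (4 * real k * R * (2 * real d * (real k * R)) ^ d)"

lemma threshold_const_ge: "R \<ge> 1 \<Longrightarrow> d \<ge> 2 \<Longrightarrow> threshold_const d R \<ge> 8"
proof -
  assume R: "R \<ge> 1" and d: "d \<ge> 2"
  have "1 * 1 \<le> (2 * real d) * R" using R d by (intro mult_mono) auto
  then have "1 \<le> (2 * real d * R) ^ d" by (intro one_le_power) simp
  then have "8 * 1 * 1 \<le> 8 * R * (2 * real d * R) ^ d" using R by (intro mult_mono) auto
  then show ?thesis by (simp add: threshold_const_def)
qed

lemma gap_const_bounds:
  assumes "R \<ge> 1" "d \<ge> 2" "k \<ge> 1" "0 \<le> q" "q < p"
  shows "gap_const k d R p q > 0" "gap_const k d R p q \<le> p"
proof -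
  have kR: "1 \<le> real k * R" using mult_mono[of 1 "real k" 1 R] assms by simp
  have "1 * 1 \<le> (2 * real d) * (real k * R)" using kR assms by (intro mult_mono) auto
  then have pw: "1 \<le> (2 * real d * (real k * R)) ^ d" by (intro one_le_power) simp
  have den: "1 \<le> 4 * real k * R * (2 * real d * (real k * R)) ^ d"
    using mult_mono[of 1 "4 * (real k * R)" 1 "(2 * real d * (real k * R)) ^ d"] kR pw by (simp add: mult.assoc)
  show "gap_const k d R p q > 0" unfolding gap_const_def using den assms by (intro divide_pos_pos) auto
  have "gap_const k d R p q \<le> (p - q) / 1" unfolding gap_const_def
    using den assms by (intro divide_left_mono) auto
  then show "gap_const k d R p q \<le> p" using assms by simp
qed

text \<open>
  Each of the five error terms of \<open>quadratic_form_le_of_discrepancy\<close> is made equal to or smaller than a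
  tenth of \<open>\<kappa>\<close>. The order of choice matters: \<open>t\<close>, then the density \<open>\<delta>\<close>, then the size \<open>\<theta>\<close> of
  sparse sets and with it \<open>K0\<close>, then \<open>K1\<close>, and the cut deviation \<open>\<gamma>\<close> last.
\<close>

lemma discrepancy_constants_exist:
  fixes \<kappa> p h d :: real
  assumes "\<kappa> > 0" "p > 0" "h > 0" "d > 0"
  obtains t \<delta> \<theta> K0 K1 \<gamma> :: real where
    "t > 0" "\<delta> > 0" "0 < \<theta>" "\<theta> \<le> 1 / 6" "2 * p * d\<^sup>2 / \<delta> \<le> ln (1 / \<theta>)"
    "0 < K0" "K0\<^sup>2 * \<theta> = 1" "K0 \<le> K1" "0 < \<gamma>" "\<gamma> \<le> \<kappa>"
    "4 * \<gamma> * K1\<^sup>2 + t * \<delta> + 2 * h * p / t + 4 * h * p * K0 / K1 + 2 * p / K1 \<le> \<kappa> / 2"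
proof -
  define t where "t = 20 * h * p / \<kappa>"
  define \<delta> where "\<delta> = \<kappa> / (10 * t)"
  define \<theta> where "\<theta> = min (1 / 6) (exp (- (2 * p * d\<^sup>2 / \<delta>)))"
  define K0 where "K0 = 1 / sqrt \<theta>"
  define K1 where "K1 = K0 + 40 * h * p * K0 / \<kappa> + 20 * p / \<kappa>"
  define \<gamma> where "\<gamma> = min \<kappa> (\<kappa> / (40 * K1\<^sup>2))"
  have t: "t > 0" using assms by (simp add: t_def)
  have \<delta>: "\<delta> > 0" using assms t by (simp add: \<delta>_def)
  have \<theta>: "\<theta> > 0" "\<theta> \<le> 1 / 6" by (auto simp: \<theta>_def)
  have ln\<theta>: "2 * p * d\<^sup>2 / \<delta> \<le> ln (1 / \<theta>)"
  proof -
    have "ln \<theta> \<le> ln (exp (- (2 * p * d\<^sup>2 / \<delta>)))" using \<theta> by (intro ln_mono) (auto simp: \<theta>_def)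
    then show ?thesis using \<theta> by (simp add: ln_div)
  qed
  have K0: "K0 > 0" using \<theta> by (simp add: K0_def)
  have K0\<theta>: "K0\<^sup>2 * \<theta> = 1" using \<theta> by (simp add: K0_def power_divide)
  have nn: "40 * h * p * K0 / \<kappa> > 0" "20 * p / \<kappa> > 0" using assms K0 by auto
  have K1: "K0 \<le> K1" "K1 > 0" "40 * h * p * K0 / \<kappa> \<le> K1" "20 * p / \<kappa> \<le> K1"
    unfolding K1_def using nn K0 by linarith+
  have \<gamma>: "0 < \<gamma>" "\<gamma> \<le> \<kappa>" using assms K1 by (auto simp: \<gamma>_def)
  have "4 * \<gamma> * K1\<^sup>2 \<le> 4 * (\<kappa> / (40 * K1\<^sup>2)) * K1\<^sup>2" by (intro mult_right_mono mult_left_mono) (auto simp: \<gamma>_def)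
  then have b1: "4 * \<gamma> * K1\<^sup>2 \<le> \<kappa> / 10" using K1 by simp
  have b2: "t * \<delta> = \<kappa> / 10" using t by (simp add: \<delta>_def)
  have b3: "2 * h * p / t = \<kappa> / 10" using assms by (simp add: t_def)
  have "40 * h * p * K0 \<le> K1 * \<kappa>" using K1(3) assms by (simp add: divide_le_eq)
  then have b4: "4 * h * p * K0 / K1 \<le> \<kappa> / 10" using K1(2) by (simp add: divide_le_eq mult_ac)
  have "20 * p \<le> K1 * \<kappa>" using K1(4) assms by (simp add: divide_le_eq)
  then have b5: "2 * p / K1 \<le> \<kappa> / 10" using K1(2) by (simp add: divide_le_eq mult_ac)
  show ?thesis
    by (rule that[OF t \<delta> \<theta> ln\<theta> K0 K0\<theta> K1(1) \<gamma>]) (use b1 b2 b3 b4 b5 in linarith)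
qed

lemma similarity_outside: "\<not> (i < n \<and> j < n) \<Longrightarrow> similarity n d w i j = 0"
  by (auto simp: similarity_def hyperedges_def intro!: sum.neutral)

text \<open>
  The regime of large \<open>n\<close>; for bounded \<open>n\<close> the probability bound is vacuous. The condition
  \<open>n * gap_const k d R p q \<ge> p\<close> makes the missing diagonal of the mean matrix negligible.
\<close>

locale balanced_SBM = assortative_SBM +
  fixes R :: real
  assumes R: "R \<ge> 1" and k_pos: "k \<ge> 1"
    and balanced: "real (n_max n k \<Psi>) \<le> R * real (n_min n k \<Psi>)"
    and clusters_large: "n_min n k \<Psi> \<ge> 4" "n_min n k \<Psi> \<ge> d"
    and n_large: "real n * gap_const k d R p q \<ge> p" "k < n"
begin

abbreviation "c j \<equiv> card (cluster n \<Psi> j)"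
definition base_mean :: real where "base_mean = q * \<alpha> * real ((n - 2) choose (d - 2))"
definition extra_mean :: "nat \<Rightarrow> real" where "extra_mean j = (p - q) * \<alpha> * real ((c j - 2) choose (d - 2))"
definition \<kappa> :: real where "\<kappa> = gap_const k d R p q"
definition h :: real where "h = threshold_const d R"
abbreviation "D \<equiv> degree_scale"
abbreviation "P i j \<equiv> similarity n d \<mu> i j"

lemma \<kappa>: "\<kappa> > 0" "\<kappa> \<le> p"
  using gap_const_bounds[OF R d_ge_2 k_pos q_nonneg q_less_p] by (auto simp: \<kappa>_def)

lemma h: "h \<ge> 8" using threshold_const_ge[OF R d_ge_2] by (simp add: h_def)

lemma base_mean_nonneg: "base_mean \<ge> 0" using q_nonneg scale_pos by (simp add: base_mean_def)
lemma extra_mean_nonneg: "extra_mean j \<ge> 0" using q_less_p scale_pos by (simp add: extra_mean_def)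

lemma \<Psi>_less: "i < n \<Longrightarrow> \<Psi> i < k" using partition by auto

lemma cluster_size:
  assumes "j < k"
  shows "c j \<ge> 4" "c j \<ge> d" "\<And>j'. j' < k \<Longrightarrow> real (c j') \<le> R * real (c j)" "real n \<le> real k * R * real (c j)"
proof -
  show "c j \<ge> 4" "c j \<ge> d" using card_cluster_bounds(1)[OF assms, of n \<Psi>] clusters_large by auto
  show *: "real (c j') \<le> R * real (c j)" if "j' < k" for j'
  proof -
    have "real (c j') \<le> real (n_max n k \<Psi>)" using card_cluster_bounds(2)[OF that, of n \<Psi>] by simp
    also have "\<dots> \<le> R * real (n_min n k \<Psi>)" by (rule balanced)
    also have "\<dots> \<le> R * real (c j)" using card_cluster_bounds(1)[OF assms, of n \<Psi>] R by (intro mult_left_mono) auto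
    finally show ?thesis .
  qed
  have "real n = (\<Sum>j'<k. real (c j'))"
    using sum_clusters[OF partition, of "\<lambda>_. 1::real"] by simp
  also have "\<dots> \<le> (\<Sum>j'<k. R * real (c j))" by (intro sum_mono *) auto
  finally show "real n \<le> real k * R * real (c j)" by simp
qed

lemma mean_entry:
  assumes "i < n" "l < n"
  shows "P i l = (if i = l then 0 else base_mean + (if \<Psi> i = \<Psi> l then extra_mean (\<Psi> i) else 0))"
  using assms d_ge_2 by (cases "i = l") (auto simp: similarity_mean_weight base_mean_def extra_mean_def)

lemma P_bounds: "0 \<le> P i l" "P i l \<le> p * D / n"
proof -
  show "0 \<le> P i l" by (intro similarity_nonneg mean_weight_nonneg)
  show "P i l \<le> p * D / n"
  proof (cases "i < n \<and> l < n")
    case True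
    have "P i l = (\<Sum>e\<in>E. \<mu> e * pair_count {i} {l} e)" using sum_similarity[where S = "{i}" and T = "{l}" and w = \<mu>] by simp
    also have "\<dots> \<le> p * D * (card {i} * card {l} / n)" using True by (intro sum_mean_pair_count_le) auto
    finally show ?thesis by simp
  next
    case False
    then show ?thesis using similarity_outside[OF False, of d \<mu>] p_pos degree_scale_nonneg by simp
  qed
qed

lemma sum_cluster_mean:
  assumes i: "i < n" and j: "j < k"
  shows "(\<Sum>l\<in>cluster n \<Psi> j. P i l) = base_mean * c j + (if \<Psi> i = j then extra_mean j * (real (c j) - 1) - base_mean else 0)"
proof (cases "\<Psi> i = j")
  case True
  have mem: "i \<in> cluster n \<Psi> j" using True i by (simp add: cluster_def)
  have "(\<Sum>l\<in>cluster n \<Psi> j. P i l) = (\<Sum>l\<in>cluster n \<Psi> j - {i}. base_mean + extra_mean j)"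
  proof (rule sum.mono_neutral_cong_right)
    show "\<forall>l\<in>cluster n \<Psi> j - (cluster n \<Psi> j - {i}). P i l = 0" by simp
    show "P i l = base_mean + extra_mean j" if "l \<in> cluster n \<Psi> j - {i}" for l
      using that i True mean_entry[of i l] by (auto simp: cluster_def)
  qed auto
  also have "\<dots> = (real (c j) - 1) * (base_mean + extra_mean j)"
    using mem cluster_size(1)[OF j] by (simp add: card_Diff_singleton of_nat_diff)
  finally show ?thesis using True by (simp add: algebra_simps)
next
  case False
  have "(\<Sum>l\<in>cluster n \<Psi> j. P i l) = (\<Sum>l\<in>cluster n \<Psi> j. base_mean)"
    using i False mean_entry by (intro sum.cong refl) (auto simp: cluster_def)
  then show ?thesis using False by simp
qed

definition row_mean :: "nat \<Rightarrow> real" where "row_mean i = (\<Sum>l<n. P i l)"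

lemma row_mean_eq:
  assumes i: "i < n"
  shows "row_mean i = base_mean * (real n - 1) + extra_mean (\<Psi> i) * (real (c (\<Psi> i)) - 1)"
proof -
  have "row_mean i = (\<Sum>j<k. \<Sum>l\<in>cluster n \<Psi> j. P i l)"
    unfolding row_mean_def by (rule sum_clusters[OF partition, symmetric])
  also have "\<dots> = (\<Sum>j<k. base_mean * c j + (if j = \<Psi> i then extra_mean j * (real (c j) - 1) - base_mean else 0))"
    using sum_cluster_mean[OF i] by (intro sum.cong refl) auto
  also have "\<dots> = base_mean * (\<Sum>j<k. real (c j)) + (extra_mean (\<Psi> i) * (real (c (\<Psi> i)) - 1) - base_mean)"
    using \<Psi>_less[OF i] by (simp add: sum.distrib sum_distrib_left)
  also have "(\<Sum>j<k. real (c j)) = real n" using sum_clusters[OF partition, of "\<lambda>_. 1::real"] by simp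
  finally show ?thesis by (simp add: algebra_simps)
qed

lemma row_mean_le: "i < n \<Longrightarrow> row_mean i \<le> p * D"
proof -
  assume "i < n"
  have "row_mean i \<le> (\<Sum>l<n. p * D / n)" unfolding row_mean_def by (intro sum_mono P_bounds)
  then show ?thesis using n_pos by simp
qed

text \<open>
  The second inequality bounds the diagonal part of the block form \<open>B\<close> defined below; subtracting
  \<open>base_mean\<close> accounts for the zero diagonal of the similarity matrix.
\<close>

lemma cluster_signal:
  assumes j: "j < k"
  shows "2 * \<kappa> * D \<le> extra_mean j * (real (c j) - 1)" "\<kappa> * D \<le> extra_mean j * (real (c j) - 1) - base_mean"
proof -
  define X where "X = (2 * real d * (real k * R)) ^ d"
  have kR: "1 \<le> real k * R" using mult_mono[of 1 "real k" 1 R] k_pos R by simp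
  have X: "X > 0" unfolding X_def using kR d_ge_2 by simp
  have cj: "real (c j) \<ge> 4" "real (c j) > 0" using cluster_size(1)[OF j] by auto
  have ch: "real ((n - 2) choose (d - 2)) \<le> X * real ((c j - 2) choose (d - 2))"
    unfolding X_def using cluster_size[OF j] kR d_ge_2 by (intro choose_ratio_le) auto
  have \<kappa>X: "\<kappa> * (4 * real k * R * X) = p - q"
    using X R k_pos unfolding \<kappa>_def gap_const_def X_def[symmetric] by simp
  have "D * (p - q) = (p - q) * \<alpha> * (real n * real ((n - 2) choose (d - 2)))" by (simp add: degree_scale_def)
  also have "\<dots> \<le> (p - q) * \<alpha> * ((real k * R * real (c j)) * (X * real ((c j - 2) choose (d - 2))))"
    using q_less_p scale_pos cluster_size(4)[OF j] ch kR by (intro mult_left_mono mult_mono) auto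
  also have "\<dots> = (real k * R * X) * (extra_mean j * real (c j))" by (simp add: extra_mean_def)
  also have "\<dots> \<le> (real k * R * X) * (extra_mean j * (2 * (real (c j) - 1)))"
    using cj kR X extra_mean_nonneg by (intro mult_left_mono) auto
  finally have "D * (\<kappa> * (4 * real k * R * X)) \<le> (real k * R * X) * (extra_mean j * (2 * (real (c j) - 1)))"
    unfolding \<kappa>X .
  moreover have "D * (\<kappa> * (4 * real k * R * X)) = (2 * (real k * R * X)) * (2 * \<kappa> * D)" by simp
  moreover have "(real k * R * X) * (extra_mean j * (2 * (real (c j) - 1))) = (2 * (real k * R * X)) * (extra_mean j * (real (c j) - 1))"
    by simp
  ultimately have "(2 * (real k * R * X)) * (2 * \<kappa> * D) \<le> (2 * (real k * R * X)) * (extra_mean j * (real (c j) - 1))"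
    by (simp only:)
  then show 1: "2 * \<kappa> * D \<le> extra_mean j * (real (c j) - 1)"
    using kR X by (subst (asm) mult_le_cancel_left_pos) auto
  have "base_mean \<le> p * \<alpha> * real ((n - 2) choose (d - 2))"
    unfolding base_mean_def using q_less_p scale_pos by (intro mult_right_mono) auto
  also have "\<dots> \<le> (real n * \<kappa>) * \<alpha> * real ((n - 2) choose (d - 2))"
    using n_large scale_pos by (intro mult_right_mono) (auto simp: \<kappa>_def)
  also have "\<dots> = \<kappa> * D" by (simp add: degree_scale_def)
  finally show "\<kappa> * D \<le> extra_mean j * (real (c j) - 1) - base_mean" using 1 by simp
qed

lemma row_mean_ge:
  assumes "i < n"
  shows "row_mean i \<ge> 2 * \<kappa> * D"
proof -
  have "0 \<le> base_mean * (real n - 1)" using base_mean_nonneg n_pos by simp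
  then show ?thesis
    using cluster_signal(1)[OF \<Psi>_less[OF assms]] unfolding row_mean_eq[OF assms] by linarith
qed

lemma row_mean_ratio:
  assumes i: "i < n" and l: "l < n"
  shows "4 * row_mean i \<le> h * row_mean l"
proof -
  define X where "X = (2 * real d * R) ^ d"
  have X: "X > 0" unfolding X_def using R d_ge_2 by simp
  note ki = \<Psi>_less[OF i] and kl = \<Psi>_less[OF l]
  have cl: "real (c (\<Psi> l)) \<ge> 4" and ci: "real (c (\<Psi> i)) \<ge> 4" using cluster_size(1) ki kl by auto
  have ch: "real ((c (\<Psi> i) - 2) choose (d - 2)) \<le> X * real ((c (\<Psi> l) - 2) choose (d - 2))"
    unfolding X_def using cluster_size[OF kl] ki R d_ge_2 by (intro choose_ratio_le) auto
  have "extra_mean (\<Psi> i) \<le> (p - q) * \<alpha> * (X * real ((c (\<Psi> l) - 2) choose (d - 2)))"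
    unfolding extra_mean_def using ch q_less_p scale_pos by (intro mult_left_mono) auto
  also have "\<dots> = X * extra_mean (\<Psi> l)" by (simp add: extra_mean_def)
  finally have 1: "extra_mean (\<Psi> i) \<le> X * extra_mean (\<Psi> l)" .
  have "real (c (\<Psi> i)) - 1 \<le> R * real (c (\<Psi> l))" using cluster_size(3)[OF kl ki] by simp
  also have "\<dots> \<le> R * (2 * (real (c (\<Psi> l)) - 1))" using R cl by (intro mult_left_mono) auto
  finally have 2: "real (c (\<Psi> i)) - 1 \<le> R * (2 * (real (c (\<Psi> l)) - 1))" .
  have "extra_mean (\<Psi> i) * (real (c (\<Psi> i)) - 1) \<le> (X * extra_mean (\<Psi> l)) * (R * (2 * (real (c (\<Psi> l)) - 1)))"
    using 1 2 X extra_mean_nonneg ci by (intro mult_mono) auto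
  also have "\<dots> = 2 * R * X * (extra_mean (\<Psi> l) * (real (c (\<Psi> l)) - 1))" by simp
  finally have "4 * (extra_mean (\<Psi> i) * (real (c (\<Psi> i)) - 1)) \<le> h * (extra_mean (\<Psi> l) * (real (c (\<Psi> l)) - 1))"
    unfolding h_def threshold_const_def X_def[symmetric] by (simp add: mult_ac)
  moreover have "4 * (base_mean * (real n - 1)) \<le> h * (base_mean * (real n - 1))"
    using h base_mean_nonneg n_pos by (intro mult_right_mono) auto
  ultimately show ?thesis by (simp add: row_mean_eq i l algebra_simps)
qed

end

section \<open>Error of spectral clustering on a good sample\<close>

text \<open>
  All randomness is fixed here: \<open>\<omega>\<close> is an outcome with the discrepancy and second moment properties,
  and everything that follows is deterministic.
\<close>

locale good_sample = balanced_SBM +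
  fixes \<omega> :: 'a and t \<delta> \<theta> K0 K1 \<gamma> :: real
  assumes tuning: "t > 0" "\<delta> > 0" "0 < K0" "K0\<^sup>2 * \<theta> = 1" "K0 \<le> K1" "0 < \<gamma>" "\<gamma> \<le> gap_const k d R p q"
      "4 * \<gamma> * K1\<^sup>2 + t * \<delta> + 2 * threshold_const d R * p / t + 4 * threshold_const d R * p * K0 / K1 + 2 * p / K1
        \<le> gap_const k d R p q / 2"
    and scale: "degree_scale > 0"
    and unit: "\<And>e. e \<in> hyperedges n d \<Longrightarrow> W e \<omega> \<in> {0..1}"
    and cut: "\<And>S T. S \<subseteq> {..<n} \<Longrightarrow> T \<subseteq> {..<n} \<Longrightarrow> \<bar>cut_dev S T \<omega>\<bar> \<le> \<gamma> * degree_scale * n"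
    and sparse: "\<And>S. S \<subseteq> {..<n} \<Longrightarrow> S \<noteq> {} \<Longrightarrow> real (card S) \<le> \<theta> * n \<Longrightarrow>
       (\<Sum>e\<in>hyperedges n d. W e \<omega> * pair_count S S e) \<le> \<delta> * degree_scale * card S"
    and cross: "\<And>C. C \<in> insert {..<n} (cluster n \<Psi> ` {..<k}) \<Longrightarrow> \<bar>cross_term C \<omega>\<bar> \<le> degree_scale * n"
begin

definition A :: "nat \<Rightarrow> nat \<Rightarrow> real" where "A = similarity n d (\<lambda>e. W e \<omega>)"
definition deg :: "nat \<Rightarrow> real" where "deg i = (\<Sum>j<n. A i j)"
text \<open>
  The nodes that survive trimming.
\<close>

definition G :: "nat set" where "G = {i. i < n \<and> \<not> deg i > h * (1 / real n) * (\<Sum>i'<n. deg i')}"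
definition A0 :: "nat \<Rightarrow> nat \<Rightarrow> real" where "A0 i j = (if i \<in> G \<and> j \<in> G then A i j else 0)"
definition row_dev_const :: real where "row_dev_const = 3 * p * real d ^ 3 + 1"
definition resid_const :: real where "resid_const = row_dev_const * (2 + 8 * h * p / \<kappa> + p\<^sup>2 / \<kappa>\<^sup>2)"

lemma \<gamma>: "0 < \<gamma>" "\<gamma> \<le> \<kappa>" using tuning by (auto simp: \<kappa>_def)

lemma A_nonneg: "A i j \<ge> 0" unfolding A_def using unit by (intro similarity_nonneg) auto

lemma cut_dev_A: "cut_dev S T \<omega> = (\<Sum>i\<in>S. \<Sum>j\<in>T. A i j - P i j)"
  by (simp add: cut_dev_def A_def)

text \<open>
  The diagonal part of \<open>sum_square_row_dev\<close> is at most \<open>d\<^sup>3\<close> times the total weight plus its mean, because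
  the square of a difference of two numbers in the unit interval is at most their sum. The total weight
  is read off from the cut deviation of the full node set.
\<close>

lemma row_dev_sum:
  assumes C: "C \<in> insert {..<n} (cluster n \<Psi> ` {..<k})"
  shows "(\<Sum>i<n. (cut_dev {i} C \<omega>)\<^sup>2) \<le> row_dev_const * n * D"
proof -
  have Csub: "C \<subseteq> {..<n}" using C by (auto simp: cluster_def)
  let ?N = "{..<n}"
  have pc: "1 \<le> pair_count ?N ?N e" if e: "e \<in> E" for e
  proof (rule pair_count_ge_1)
    have "e \<subseteq> ?N" "card e \<ge> 2" using hyperedgeD[OF e] d_ge_2 by auto
    then obtain i j where ij: "i \<in> e" "j \<in> e" "i \<noteq> j"
      by (metis card_2_iff' card_le_Suc0_iff_eq hyperedgeD[OF e] not_less_eq_eq numeral_2_eq_2)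
    have "1 \<le> (\<Sum>j\<in>?N. if i \<noteq> j \<and> {i, j} \<subseteq> e then 1 else (0::real))"
      using ij \<open>e \<subseteq> ?N\<close> member_le_sum[of j ?N "\<lambda>j. if i \<noteq> j \<and> {i, j} \<subseteq> e then 1 else (0::real)"] by auto
    also have "\<dots> \<le> pair_count ?N ?N e"
      unfolding pair_count_def using ij \<open>e \<subseteq> ?N\<close>
      by (intro member_le_sum[of i ?N "\<lambda>i. \<Sum>j\<in>?N. if i \<noteq> j \<and> {i, j} \<subseteq> e then 1 else (0::real)"]) (auto intro: sum_nonneg)
    finally show "pair_count ?N ?N e \<noteq> 0" by simp
  qed auto
  have mean: "(\<Sum>e\<in>E. \<mu> e) \<le> p * D * n"
  proof -
    have "(\<Sum>e\<in>E. \<mu> e) \<le> (\<Sum>e\<in>E. \<mu> e * pair_count ?N ?N e)"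
    proof (rule sum_mono)
      fix e assume "e \<in> E"
      then show "\<mu> e \<le> \<mu> e * pair_count ?N ?N e" using mult_left_mono[OF pc mean_weight_nonneg[of e]] by simp
    qed
    then show ?thesis using sum_mean_pair_count_le_total[of ?N ?N] by simp
  qed
  have weight: "(\<Sum>e\<in>E. W e \<omega>) \<le> p * D * n + \<gamma> * D * n"
  proof -
    have "(\<Sum>e\<in>E. W e \<omega>) \<le> (\<Sum>e\<in>E. W e \<omega> * pair_count ?N ?N e)"
    proof (rule sum_mono)
      fix e assume e: "e \<in> E"
      then show "W e \<omega> \<le> W e \<omega> * pair_count ?N ?N e" using mult_left_mono[OF pc[OF e], of "W e \<omega>"] unit[OF e] by simp
    qed
    also have "\<dots> = cut_dev ?N ?N \<omega> + (\<Sum>e\<in>E. \<mu> e * pair_count ?N ?N e)"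
      unfolding cut_dev_eq by (simp add: sum.distrib[symmetric] algebra_simps)
    also have "\<dots> \<le> \<gamma> * D * n + p * D * n"
      using cut[of ?N ?N] sum_mean_pair_count_le_total[of ?N ?N] by (intro add_mono) auto
    finally show ?thesis by simp
  qed
  have "(\<Sum>e\<in>E. (W e \<omega> - \<mu> e)\<^sup>2 * (\<Sum>i<n. (pair_count {i} C e)\<^sup>2)) \<le> (\<Sum>e\<in>E. (W e \<omega> + \<mu> e) * real d ^ 3)"
  proof (rule sum_mono)
    fix e assume e: "e \<in> E"
    have x: "0 \<le> W e \<omega>" "W e \<omega> \<le> 1" "0 \<le> \<mu> e" "\<mu> e \<le> 1" using unit[OF e] mean_weight_unit[OF e] by auto
    have "(W e \<omega> - \<mu> e)\<^sup>2 = \<bar>W e \<omega> - \<mu> e\<bar> * \<bar>W e \<omega> - \<mu> e\<bar>" by (simp add: power2_eq_square)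
    also have "\<dots> \<le> (W e \<omega> + \<mu> e) * 1" using x by (intro mult_mono) auto
    finally have "(W e \<omega> - \<mu> e)\<^sup>2 \<le> W e \<omega> + \<mu> e" by simp
    then show "(W e \<omega> - \<mu> e)\<^sup>2 * (\<Sum>i<n. (pair_count {i} C e)\<^sup>2) \<le> (W e \<omega> + \<mu> e) * real d ^ 3"
      using sum_pair_count_sq_le[OF Csub e] x by (intro mult_mono) (auto intro: sum_nonneg)
  qed
  also have "\<dots> = ((\<Sum>e\<in>E. W e \<omega>) + (\<Sum>e\<in>E. \<mu> e)) * real d ^ 3"
    by (simp only: sum_distrib_right[symmetric] sum.distrib)
  also have "\<dots> \<le> (3 * p * D * n) * real d ^ 3"
  proof (rule mult_right_mono)
    have "\<gamma> * (D * n) \<le> p * (D * n)" using \<gamma> \<kappa> scale by (intro mult_right_mono) auto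
    then show "(\<Sum>e\<in>E. W e \<omega>) + (\<Sum>e\<in>E. \<mu> e) \<le> 3 * p * D * n" using mean weight by (simp add: mult.assoc)
  qed simp
  finally have "(\<Sum>i<n. (cut_dev {i} C \<omega>)\<^sup>2) \<le> (3 * p * D * n) * real d ^ 3 + D * n"
    using cross[OF C] unfolding sum_square_row_dev by linarith
  then show ?thesis by (simp add: row_dev_const_def algebra_simps)
qed

lemma row_dev_const_pos: "row_dev_const > 0" unfolding row_dev_const_def using p_pos by (simp add: add_nonneg_pos)

lemma deg_eq: "deg i = row_mean i + cut_dev {i} {..<n} \<omega>"
  by (simp add: deg_def row_mean_def cut_dev_A sum_subtractf)

lemma total_degree:
  shows "(\<Sum>i<n. row_mean i) / 2 \<le> (\<Sum>i<n. deg i)" "(\<Sum>i<n. deg i) \<le> 2 * p * D * n"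
proof -
  have eq: "(\<Sum>i<n. deg i) = (\<Sum>i<n. row_mean i) + cut_dev {..<n} {..<n} \<omega>"
    by (simp add: deg_def row_mean_def cut_dev_A sum_subtractf)
  have dev: "\<bar>cut_dev {..<n} {..<n} \<omega>\<bar> \<le> \<gamma> * D * n" by (rule cut) auto
  have "(\<Sum>i<n. 2 * \<kappa> * D) \<le> (\<Sum>i<n. row_mean i)" by (intro sum_mono row_mean_ge) auto
  then have lo: "2 * (\<kappa> * (D * n)) \<le> (\<Sum>i<n. row_mean i)" by (simp add: mult_ac)
  have "(\<Sum>i<n. row_mean i) \<le> (\<Sum>i<n. p * D)" by (intro sum_mono row_mean_le) auto
  then have hi: "(\<Sum>i<n. row_mean i) \<le> p * (D * n)" by (simp add: mult_ac)
  have g: "\<gamma> * (D * n) \<le> \<kappa> * (D * n)" "\<kappa> * (D * n) \<le> p * (D * n)"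
    using \<gamma> \<kappa> scale by (auto intro!: mult_right_mono)
  show "(\<Sum>i<n. row_mean i) / 2 \<le> (\<Sum>i<n. deg i)" using eq dev lo g by (simp add: mult.assoc abs_le_iff)
  show "(\<Sum>i<n. deg i) \<le> 2 * p * D * n" using eq dev hi g by (simp add: mult.assoc abs_le_iff)
qed

lemma deg_kept: "i \<in> G \<Longrightarrow> deg i \<le> 2 * h * p * D"
proof -
  assume "i \<in> G"
  then have "deg i \<le> h * (1 / real n) * (\<Sum>i'<n. deg i')" by (auto simp: G_def)
  also have "\<dots> \<le> h * (1 / real n) * (2 * p * D * n)" using h by (intro mult_left_mono total_degree) auto
  finally show ?thesis using n_pos by simp
qed

text \<open>
  The threshold exceeds twice the mean degree of every node, so at least half of the degree of a trimmed
  node is deviation from its mean.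
\<close>

lemma removed_dev:
  assumes i: "i < n" "i \<notin> G"
  shows "deg i \<le> 2 * cut_dev {i} {..<n} \<omega>" "\<kappa> * D \<le> cut_dev {i} {..<n} \<omega>"
proof -
  have "(\<Sum>l<n. 4 * row_mean i) \<le> (\<Sum>l<n. h * row_mean l)" using row_mean_ratio[OF i(1)] by (intro sum_mono) auto
  then have "4 * row_mean i * n \<le> h * (\<Sum>l<n. row_mean l)" by (simp add: sum_distrib_left mult_ac)
  also have "\<dots> \<le> h * (2 * (\<Sum>l<n. deg l))" using total_degree(1) h by (intro mult_left_mono) auto
  finally have "2 * row_mean i \<le> h * (1 / real n) * (\<Sum>i'<n. deg i')" using n_pos by (simp add: field_simps)
  also have "\<dots> < deg i" using i by (auto simp: G_def)
  finally have "2 * row_mean i < deg i" .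
  then show "deg i \<le> 2 * cut_dev {i} {..<n} \<omega>" using deg_eq[of i] by simp
  have "row_mean i \<le> cut_dev {i} {..<n} \<omega>" using \<open>2 * row_mean i < deg i\<close> deg_eq[of i] by simp
  moreover have "0 \<le> \<kappa> * D" using \<kappa> scale by simp
  ultimately show "\<kappa> * D \<le> cut_dev {i} {..<n} \<omega>" using row_mean_ge[OF i(1)] by simp
qed

text \<open>
  Trimmed nodes have deviation at least \<open>\<kappa> D\<close>, and the squared deviations sum to \<open>O(n D)\<close>.
\<close>

lemma removed_totals:
  shows "(\<Sum>l\<in>{..<n} - G. deg l) \<le> 2 * row_dev_const * n / \<kappa>"
    and "real (card ({..<n} - G)) \<le> row_dev_const * n / (\<kappa>\<^sup>2 * D)"
proof -
  define x where "x = (\<lambda>l. cut_dev {l} {..<n} \<omega>)"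
  have kD: "\<kappa> * D > 0" using \<kappa> scale by simp
  have sq: "(\<Sum>l\<in>{..<n} - G. (x l)\<^sup>2) \<le> row_dev_const * n * D"
  proof -
    have "(\<Sum>l\<in>{..<n} - G. (x l)\<^sup>2) \<le> (\<Sum>l<n. (x l)\<^sup>2)" by (intro sum_mono2) auto
    also have "\<dots> \<le> row_dev_const * n * D" unfolding x_def by (rule row_dev_sum) simp
    finally show ?thesis .
  qed
  have "(\<Sum>l\<in>{..<n} - G. deg l) \<le> (\<Sum>l\<in>{..<n} - G. 2 * (x l)\<^sup>2 / (\<kappa> * D))"
  proof (rule sum_mono)
    fix l assume "l \<in> {..<n} - G"
    then have l: "deg l \<le> 2 * x l" "\<kappa> * D \<le> x l" using removed_dev[of l] by (auto simp: x_def)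
    then have "(\<kappa> * D) * x l \<le> x l * x l" using kD by (intro mult_right_mono) auto
    then have "x l \<le> (x l)\<^sup>2 / (\<kappa> * D)" using kD by (simp add: le_divide_eq power2_eq_square mult_ac)
    then show "deg l \<le> 2 * (x l)\<^sup>2 / (\<kappa> * D)" using l by simp
  qed
  also have "\<dots> = 2 * (\<Sum>l\<in>{..<n} - G. (x l)\<^sup>2) / (\<kappa> * D)" by (simp add: sum_distrib_left sum_divide_distrib)
  also have "\<dots> \<le> 2 * (row_dev_const * n * D) / (\<kappa> * D)" using sq kD by (intro divide_right_mono mult_left_mono) auto
  also have "\<dots> = 2 * row_dev_const * n / \<kappa>" using scale by simp
  finally show "(\<Sum>l\<in>{..<n} - G. deg l) \<le> 2 * row_dev_const * n / \<kappa>" .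
  have "real (card ({..<n} - G)) * (\<kappa> * D)\<^sup>2 = (\<Sum>l\<in>{..<n} - G. (\<kappa> * D)\<^sup>2)" by simp
  also have "\<dots> \<le> (\<Sum>l\<in>{..<n} - G. (x l)\<^sup>2)"
    using removed_dev kD by (intro sum_mono power_mono) (auto simp: x_def)
  also have "\<dots> \<le> row_dev_const * n * D" by (rule sq)
  finally have "(real (card ({..<n} - G)) * (\<kappa>\<^sup>2 * D)) * D \<le> (row_dev_const * n) * D" by (simp add: power_mult_distrib power2_eq_square mult_ac)
  then have "real (card ({..<n} - G)) * (\<kappa>\<^sup>2 * D) \<le> row_dev_const * n" using scale by (subst (asm) mult_le_cancel_right_pos)
  then show "real (card ({..<n} - G)) \<le> row_dev_const * n / (\<kappa>\<^sup>2 * D)" using \<kappa> scale by (simp add: le_divide_eq)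
qed

text \<open>
  The matrix of the mean similarities in the basis of the normalised indicators. The diagonal
  correction is block-constant, so the zero diagonal does not destroy invariance of their span.
\<close>

definition B :: "nat \<Rightarrow> nat \<Rightarrow> real" where
  "B j m = (if j = m then extra_mean j * (real (c j) - 1) - base_mean else 0) + base_mean * sqrt (c j) * sqrt (c m)"

definition resid :: "nat \<Rightarrow> nat \<Rightarrow> real" where
  "resid j i = ((\<Sum>l\<in>cluster n \<Psi> j. A0 i l) - (\<Sum>l\<in>cluster n \<Psi> j. P i l)) / sqrt (c j)"

lemma B_form: "\<kappa> * D * (\<Sum>j<k. (z j)\<^sup>2) \<le> (\<Sum>j<k. \<Sum>m<k. B j m * z j * z m)"
proof -
  define g where "g = (\<lambda>j. extra_mean j * (real (c j) - 1) - base_mean)"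
  have Bg: "B j m = (if j = m then g j else 0) + base_mean * sqrt (c j) * sqrt (c m)" for j m
    by (simp add: B_def g_def)
  have "(\<Sum>j<k. \<Sum>m<k. B j m * z j * z m)
     = (\<Sum>j<k. \<Sum>m<k. (if j = m then g j * (z j)\<^sup>2 else 0)) + (\<Sum>j<k. \<Sum>m<k. base_mean * ((sqrt (c j) * z j) * (sqrt (c m) * z m)))"
    unfolding sum.distrib[symmetric] Bg
    by (intro sum.cong refl) (auto simp: power2_eq_square algebra_simps)
  also have "(\<Sum>j<k. \<Sum>m<k. (if j = m then g j * (z j)\<^sup>2 else 0)) = (\<Sum>j<k. g j * (z j)\<^sup>2)" by simp
  also have "(\<Sum>j<k. \<Sum>m<k. base_mean * ((sqrt (c j) * z j) * (sqrt (c m) * z m))) = base_mean * (\<Sum>j<k. sqrt (c j) * z j)\<^sup>2"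
    unfolding power2_eq_square sum_product by (simp only: sum_distrib_left)
  also have "(\<Sum>j<k. g j * (z j)\<^sup>2) + base_mean * (\<Sum>j<k. sqrt (c j) * z j)\<^sup>2 \<ge> (\<Sum>j<k. \<kappa> * D * (z j)\<^sup>2) + 0"
    using cluster_signal(2) base_mean_nonneg unfolding g_def by (intro add_mono sum_mono mult_right_mono) auto
  finally show ?thesis by (simp add: sum_distrib_left)
qed

lemma resid_eq:
  assumes j: "j < k" and i: "i < n"
  shows "(\<Sum>m<n. A0 i m * unit_indicator n \<Psi> j m) = (\<Sum>m<k. B j m * unit_indicator n \<Psi> m i) + resid j i"
proof -
  have cj: "real (c j) > 0" using cluster_size(1)[OF j] by simp
  have ci: "real (c (\<Psi> i)) > 0" using cluster_size(1)[OF \<Psi>_less[OF i]] by simp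
  have "(\<Sum>m<k. B j m * unit_indicator n \<Psi> m i) = (\<Sum>m<k. if m = \<Psi> i then B j m / sqrt (c m) else 0)"
    by (intro sum.cong refl) (auto simp: unit_indicator_def)
  also have "\<dots> = B j (\<Psi> i) / sqrt (c (\<Psi> i))" using \<Psi>_less[OF i] by simp
  also have "\<dots> = (\<Sum>l\<in>cluster n \<Psi> j. P i l) / sqrt (c j)"
  proof -
    have "base_mean * sqrt (c j) * sqrt (c (\<Psi> i)) / sqrt (c (\<Psi> i)) = base_mean * c j / sqrt (c j)"
    proof -
      have "b * s * sqrt x / sqrt x = b * s" if "x > 0" for b s x :: real using that by simp
      then have "base_mean * sqrt (c j) * sqrt (c (\<Psi> i)) / sqrt (c (\<Psi> i)) = base_mean * sqrt (c j)" using ci by blast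
      also have "\<dots> = base_mean * (c j / sqrt (c j))" by (simp add: real_div_sqrt)
      finally show ?thesis by simp
    qed
    then show ?thesis
      unfolding sum_cluster_mean[OF i j] B_def by (cases "\<Psi> i = j") (auto simp: add_divide_distrib)
  qed
  finally show ?thesis by (simp add: sum_unit_indicator resid_def diff_divide_distrib)
qed

text \<open>
  For a kept node the residual consists of the row deviation and of the weight to trimmed nodes; the
  square of the latter is at most the degree bound times the weight itself, which is summable by
  \<open>removed_totals\<close>. Each trimmed node loses its whole mean row, at most \<open>p D\<close>, and there are
  \<open>O(n / D)\<close> of them.
\<close>

lemma resid_sum:
  assumes j: "j < k"
  shows "(\<Sum>i<n. (resid j i)\<^sup>2) \<le> real k * R * resid_const * D"
proof -
  let ?Cj = "cluster n \<Psi> j"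
  define Q where "Q = (\<lambda>i. (\<Sum>l\<in>?Cj. A0 i l) - (\<Sum>l\<in>?Cj. P i l))"
  define lost where "lost = (\<lambda>i. \<Sum>l\<in>{..<n} - G. A i l)"
  have Csub: "?Cj \<subseteq> {..<n}" by (auto simp: cluster_def)
  have lost0: "0 \<le> lost i" for i unfolding lost_def by (intro sum_nonneg A_nonneg)
  have kept: "(Q i)\<^sup>2 \<le> 2 * (cut_dev {i} ?Cj \<omega>)\<^sup>2 + 2 * (2 * h * p * D) * lost i" if i: "i \<in> G" for i
  proof -
    have "(\<Sum>l\<in>?Cj. A0 i l) = (\<Sum>l\<in>?Cj. A i l) - (\<Sum>l\<in>?Cj - G. A i l)"
    proof -
      have "(\<Sum>l\<in>?Cj. A0 i l) = (\<Sum>l\<in>?Cj. A i l - (if l \<in> ?Cj - G then A i l else 0))"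
        using i by (intro sum.cong refl) (auto simp: A0_def)
      also have "\<dots> = (\<Sum>l\<in>?Cj. A i l) - (\<Sum>l\<in>?Cj - G. A i l)"
      proof -
        have "(\<Sum>l\<in>?Cj. if l \<in> ?Cj - G then A i l else 0) = (\<Sum>l\<in>?Cj - G. A i l)"
          by (rule sum.mono_neutral_cong_right) auto
        then show ?thesis by (simp only: sum_subtractf)
      qed
      finally show ?thesis .
    qed
    then have Q: "Q i = cut_dev {i} ?Cj \<omega> + - (\<Sum>l\<in>?Cj - G. A i l)"
      by (simp add: Q_def cut_dev_A sum_subtractf)
    have "(Q i)\<^sup>2 \<le> 2 * (cut_dev {i} ?Cj \<omega>)\<^sup>2 + 2 * (- (\<Sum>l\<in>?Cj - G. A i l))\<^sup>2"
      unfolding Q by (rule sum_sq_le_twice)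
    moreover have "(- (\<Sum>l\<in>?Cj - G. A i l))\<^sup>2 \<le> (2 * h * p * D) * lost i"
    proof -
      have 0: "0 \<le> (\<Sum>l\<in>?Cj - G. A i l)" by (intro sum_nonneg A_nonneg)
      have 1: "(\<Sum>l\<in>?Cj - G. A i l) \<le> lost i" unfolding lost_def using Csub by (intro sum_mono2 A_nonneg) auto
      have "(\<Sum>l\<in>?Cj - G. A i l) \<le> deg i" unfolding deg_def using Csub by (intro sum_mono2 A_nonneg) auto
      then have 2: "(\<Sum>l\<in>?Cj - G. A i l) \<le> 2 * h * p * D" using deg_kept[OF i] by linarith
      have "(\<Sum>l\<in>?Cj - G. A i l) * (\<Sum>l\<in>?Cj - G. A i l) \<le> (2 * h * p * D) * lost i"
        using 0 2 by (intro mult_mono 0 1 2) linarith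
      then show ?thesis by (simp add: power2_eq_square)
    qed
    ultimately show ?thesis by simp
  qed
  have removed: "(Q i)\<^sup>2 \<le> (p * D)\<^sup>2" if i: "i < n" "i \<notin> G" for i
  proof -
    have "Q i = - (\<Sum>l\<in>?Cj. P i l)" using i by (simp add: Q_def A0_def)
    moreover have "0 \<le> (\<Sum>l\<in>?Cj. P i l)" by (intro sum_nonneg P_bounds)
    moreover have "(\<Sum>l\<in>?Cj. P i l) \<le> row_mean i" unfolding row_mean_def using Csub by (intro sum_mono2 P_bounds) auto
    ultimately show ?thesis using row_mean_le[OF i(1)] by (simp add: power_mono)
  qed
  have Gsub: "G \<subseteq> {..<n}" by (auto simp: G_def)
  have "(\<Sum>i<n. (Q i)\<^sup>2) = (\<Sum>i\<in>G. (Q i)\<^sup>2) + (\<Sum>i\<in>{..<n} - G. (Q i)\<^sup>2)"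
    using Gsub by (metis add.commute finite_lessThan sum.subset_diff)
  also have "(\<Sum>i\<in>G. (Q i)\<^sup>2) \<le> (\<Sum>i\<in>G. 2 * (cut_dev {i} ?Cj \<omega>)\<^sup>2 + 2 * (2 * h * p * D) * lost i)"
    by (intro sum_mono kept)
  also have "\<dots> \<le> (\<Sum>i<n. 2 * (cut_dev {i} ?Cj \<omega>)\<^sup>2 + 2 * (2 * h * p * D) * lost i)"
    using Gsub h p_pos scale lost0 by (intro sum_mono2) auto
  also have "\<dots> = 2 * (\<Sum>i<n. (cut_dev {i} ?Cj \<omega>)\<^sup>2) + 2 * (2 * h * p * D) * (\<Sum>i<n. lost i)"
    by (simp add: sum.distrib sum_distrib_left)
  also have "(\<Sum>i<n. lost i) = (\<Sum>l\<in>{..<n} - G. deg l)"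
    unfolding lost_def deg_def A_def by (subst sum.swap) (simp only: similarity_commute)
  also have "2 * (\<Sum>i<n. (cut_dev {i} ?Cj \<omega>)\<^sup>2) + 2 * (2 * h * p * D) * (\<Sum>l\<in>{..<n} - G. deg l)
      \<le> 2 * (row_dev_const * n * D) + 2 * (2 * h * p * D) * (2 * row_dev_const * n / \<kappa>)"
    using h p_pos scale j by (intro add_mono mult_left_mono row_dev_sum removed_totals) auto
  also have "(\<Sum>i\<in>{..<n} - G. (Q i)\<^sup>2) \<le> (\<Sum>i\<in>{..<n} - G. (p * D)\<^sup>2)" by (intro sum_mono removed) auto
  also have "(\<Sum>i\<in>{..<n} - G. (p * D)\<^sup>2) = real (card ({..<n} - G)) * (p * D)\<^sup>2" by simp
  also have "\<dots> \<le> row_dev_const * n / (\<kappa>\<^sup>2 * D) * (p * D)\<^sup>2" by (intro mult_right_mono removed_totals) auto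
  finally have Qsum: "(\<Sum>i<n. (Q i)\<^sup>2) \<le> 2 * (row_dev_const * n * D) + 2 * (2 * h * p * D) * (2 * row_dev_const * n / \<kappa>) + row_dev_const * n / (\<kappa>\<^sup>2 * D) * (p * D)\<^sup>2"
    by simp
  also have "\<dots> = real n * (resid_const * D)"
    using scale \<kappa> by (simp add: resid_const_def power_mult_distrib power2_eq_square field_simps)
  finally have Qsum: "(\<Sum>i<n. (Q i)\<^sup>2) \<le> real n * (resid_const * D)" .
  have cj: "real (c j) > 0" using cluster_size(1)[OF j] by simp
  have "(\<Sum>i<n. (resid j i)\<^sup>2) = (\<Sum>i<n. (Q i)\<^sup>2) / c j"
    using cj by (simp add: resid_def Q_def power_divide sum_divide_distrib)
  also have "\<dots> \<le> (real n * (resid_const * D)) / c j" using Qsum by (intro divide_right_mono) auto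
  also have "\<dots> \<le> ((real k * R * c j) * (resid_const * D)) / c j"
  proof (intro divide_right_mono mult_right_mono cluster_size(4) j)
    show "0 \<le> resid_const * D" unfolding resid_const_def using row_dev_const_pos h p_pos \<kappa> scale by simp
  qed simp
  also have "\<dots> = real k * R * resid_const * D"
  proof -
    have "a * x * (b * y) / x = a * b * y" if "x > 0" for a b x y :: real using that by simp
    then show ?thesis using cj by blast
  qed
  finally show ?thesis .
qed

text \<open>
  On vectors supported on the kept nodes and orthogonal to the clusters, the block matrix vanishes and
  only its negated diagonal remains, so the form of \<open>P\<close> is nonpositive and \<open>A\<close> may be replaced by
  \<open>A - P\<close>.
\<close>

lemma constrained_form:
  assumes x: "\<And>j. j < k \<Longrightarrow> (\<Sum>i<n. (if i \<in> G \<and> \<Psi> i = j then 1 else 0) * x i) = 0"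
  shows "(\<Sum>i<n. \<Sum>l<n. A0 i l * x i * x l) \<le> \<kappa> * D / 2 * (\<Sum>i<n. (x i)\<^sup>2)"
proof -
  define y where "y = (\<lambda>i. if i \<in> G then x i else 0)"
  have cl: "(\<Sum>i\<in>cluster n \<Psi> j. y i) = 0" if j: "j < k" for j
  proof -
    have "(\<Sum>i\<in>cluster n \<Psi> j. y i) = (\<Sum>i<n. (if i \<in> G \<and> \<Psi> i = j then 1 else 0) * x i)"
      by (rule sum.mono_neutral_cong_left) (auto simp: cluster_def y_def)
    then show ?thesis using x[OF j] by simp
  qed
  have tot: "(\<Sum>i<n. y i) = 0"
    using sum_clusters[OF partition, of y] cl by simp
  have A0y: "(\<Sum>i<n. \<Sum>l<n. A0 i l * x i * x l) = (\<Sum>i<n. \<Sum>l<n. A i l * y i * y l)"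
    by (intro sum.cong refl) (auto simp: A0_def y_def)
  have Pform: "(\<Sum>i<n. \<Sum>l<n. P i l * y i * y l) \<le> 0"
  proof -
    have inner: "(\<Sum>l<n. P i l * y i * y l) = - ((base_mean + extra_mean (\<Psi> i)) * (y i)\<^sup>2)" if i: "i < n" for i
    proof -
      have "(\<Sum>l<n. P i l * y i * y l) = (\<Sum>l<n. base_mean * y i * y l
         + (extra_mean (\<Psi> i) * y i) * (if \<Psi> l = \<Psi> i then y l else 0)
         - (if l = i then (base_mean + extra_mean (\<Psi> i)) * (y i)\<^sup>2 else 0))"
        using i by (intro sum.cong refl) (auto simp: mean_entry power2_eq_square algebra_simps)
      also have "\<dots> = base_mean * y i * (\<Sum>l<n. y l) + (extra_mean (\<Psi> i) * y i) * (\<Sum>l<n. if \<Psi> l = \<Psi> i then y l else 0)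
         - (base_mean + extra_mean (\<Psi> i)) * (y i)\<^sup>2"
        using i by (simp add: sum_subtractf sum.distrib sum_distrib_left)
      also have "(\<Sum>l<n. if \<Psi> l = \<Psi> i then y l else 0) = (\<Sum>l\<in>cluster n \<Psi> (\<Psi> i). y l)"
        by (rule sum.mono_neutral_cong_right) (auto simp: cluster_def)
      finally show ?thesis using tot cl[OF \<Psi>_less[OF i]] by simp
    qed
    have "(\<Sum>i<n. \<Sum>l<n. P i l * y i * y l) = (\<Sum>i<n. - ((base_mean + extra_mean (\<Psi> i)) * (y i)\<^sup>2))"
      by (intro sum.cong refl inner) simp
    also have "\<dots> \<le> 0" using base_mean_nonneg extra_mean_nonneg by (intro sum_nonpos) (simp add: add_nonneg_nonneg)
    finally show ?thesis .
  qed
  have K1: "K1 > 0" using tuning by simp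
  have "(\<Sum>i<n. \<Sum>l<n. (A i l - P i l) * y i * y l)
     \<le> (4 * (\<gamma> * D * n) * K1\<^sup>2 / n + t * (\<delta> * D) + (2 * h * p * D) / t + 2 * (2 * h * p * D) * K0 / K1 + 2 * (p * D / n) * n / K1) * (\<Sum>i<n. (y i)\<^sup>2)"
  proof (rule quadratic_form_le_of_discrepancy)
    show "A i j = A j i" for i j unfolding A_def by (rule similarity_commute)
    show "A i i = 0" for i by (simp add: A_def)
    show "(\<Sum>j<n. A i j) \<le> 2 * h * p * D" if "i < n" "y i \<noteq> 0" for i
      using deg_kept[of i] that by (auto simp: y_def deg_def split: if_splits)
    show "\<bar>\<Sum>i\<in>S. \<Sum>j\<in>T. A i j - P i j\<bar> \<le> \<gamma> * D * n" if "S \<subseteq> {..<n}" "T \<subseteq> {..<n}" for S T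
      using cut[OF that] by (simp add: cut_dev_A)
    show "(\<Sum>i\<in>S. \<Sum>j\<in>S. A i j) \<le> \<delta> * D * card S" if S: "S \<subseteq> {..<n}" "real (card S) * K0\<^sup>2 \<le> real n" for S
    proof (cases "S = {}")
      case False
      have \<theta>: "\<theta> \<ge> 0"
      proof -
        have "\<theta> = 1 / K0\<^sup>2" using tuning(3,4) by (simp add: field_simps)
        then show ?thesis by simp
      qed
      have "real (card S) = (real (card S) * K0\<^sup>2) * \<theta>" using tuning(4) by (simp add: mult.assoc)
      also have "\<dots> \<le> real n * \<theta>" using S(2) \<theta> by (rule mult_right_mono)
      finally have "real (card S) \<le> \<theta> * n" by (simp add: mult.commute)
      then show ?thesis using sparse[OF S(1) False] unfolding A_def sum_similarity by simp
    qed simp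
  qed (use n_pos tuning A_nonneg P_bounds h p_pos scale in auto)
  also have "\<dots> = D * (4 * \<gamma> * K1\<^sup>2 + t * \<delta> + 2 * h * p / t + 4 * h * p * K0 / K1 + 2 * p / K1) * (\<Sum>i<n. (y i)\<^sup>2)"
    using n_pos by (simp add: algebra_simps)
  also have "\<dots> \<le> D * (\<kappa> / 2) * (\<Sum>i<n. (y i)\<^sup>2)"
    using tuning(8) scale by (intro mult_right_mono mult_left_mono sum_nonneg) (auto simp: h_def \<kappa>_def)
  also have "\<dots> \<le> D * (\<kappa> / 2) * (\<Sum>i<n. (x i)\<^sup>2)"
    using scale \<kappa> by (intro mult_left_mono sum_mono) (auto simp: y_def)
  finally have "(\<Sum>i<n. \<Sum>l<n. (A i l - P i l) * y i * y l) \<le> \<kappa> * D / 2 * (\<Sum>i<n. (x i)\<^sup>2)" by (simp add: mult_ac)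
  moreover have "(\<Sum>i<n. \<Sum>l<n. (A i l - P i l) * y i * y l)
      = (\<Sum>i<n. \<Sum>l<n. A i l * y i * y l) - (\<Sum>i<n. \<Sum>l<n. P i l * y i * y l)"
    by (simp only: left_diff_distrib sum_subtractf)
  ultimately show ?thesis using Pform A0y by linarith
qed

lemma processed_entry:
  assumes "i < n" "j < n"
  shows "processed_matrix h (similarity_matrix n d (\<lambda>e. W e \<omega>)) $$ (i, j) = A0 i j"
proof -
  let ?S = "similarity_matrix n d (\<lambda>e. W e \<omega>)"
  have dim: "dim_row ?S = n" "dim_col ?S = n" by (auto simp: similarity_matrix_def)
  have entry: "?S $$ (i, j) = A i j" if "i < n" "j < n" for i j
    using that by (simp add: similarity_matrix_def A_def similarity_def)
  have row: "row_sum ?S i = deg i" if "i < n" for i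
    unfolding row_sum_def deg_def dim using entry that by (intro sum.cong) auto
  have "exceeds_threshold h ?S i \<longleftrightarrow> i \<notin> G" if "i < n" for i
    using that row unfolding exceeds_threshold_def dim G_def by simp
  then show ?thesis using assms entry by (auto simp: processed_matrix_def dim A0_def)
qed

text \<open>
  Half of the gap \<open>\<kappa> D\<close> is spent on the eigenvalue number \<open>k + 1\<close>, which explains the factor 4 in
  \<open>proj_const\<close>. The two lower bounds on \<open>D\<close> are the conditions of \<open>err_le_of_projection\<close>.
\<close>

lemma HSC_error:
  assumes out: "HSC_output h \<epsilon> n d k (\<lambda>e. W e \<omega>) \<Phi>" and \<epsilon>: "\<epsilon> > 0"
    and proj_const: "proj_const = 4 * real k ^ 2 * R * resid_const / \<kappa>\<^sup>2"
    and big: "2 * proj_const \<le> D" "8 * (2 + \<epsilon>) * R * proj_const < D"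
  shows "err n k \<Psi> \<Phi> \<le> 8 * (2 + \<epsilon>) * proj_const / D"
proof -
  let ?S = "processed_matrix h (similarity_matrix n d (\<lambda>e. W e \<omega>))"
  obtain U where top: "top_eigenvectors k ?S U" and km: "approx_kmeans k \<epsilon> U \<Phi>"
    using out unfolding HSC_output_def by blast
  have carrier: "?S \<in> carrier_mat n n" by (simp add: processed_matrix_def similarity_matrix_def)
  have sym0: "A0 i j = A0 j i" for i j by (simp add: A0_def A_def similarity_commute)
  have sym: "?S $$ (i, j) = ?S $$ (j, i)" if "i < n" "j < n" for i j
    using that processed_entry sym0 by simp
  obtain v ev where basis: "symmetric_eigenbasis n v (\<lambda>i j. ?S $$ (i, j)) ev"
    and U: "\<And>i l. i < n \<Longrightarrow> l < k \<Longrightarrow> U $$ (i, l) = v l i" "U \<in> carrier_mat n k" and kn: "k \<le> n"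
    using top_eigenvectors_basis[OF top carrier sym] by metis
  interpret symmetric_eigenbasis n v "\<lambda>i j. ?S $$ (i, j)" ev by (rule basis)
  have top_le: "ev k \<le> \<kappa> * D / 2"
  proof (rule eigenvalue_le_of_constrained_form[where g = "\<lambda>j i. if i \<in> G \<and> \<Psi> i = j then 1 else 0"])
    show "k < n" by (rule n_large)
    fix x :: "nat \<Rightarrow> real"
    assume "\<And>j. j < k \<Longrightarrow> (\<Sum>i<n. (if i \<in> G \<and> \<Psi> i = j then 1 else 0) * x i) = 0"
    then have "(\<Sum>i<n. \<Sum>l<n. A0 i l * x i * x l) \<le> \<kappa> * D / 2 * (\<Sum>i<n. (x i)\<^sup>2)" by (rule constrained_form)
    then show "(\<Sum>i<n. \<Sum>j<n. ?S $$ (i, j) * x i * x j) \<le> \<kappa> * D / 2 * (\<Sum>i<n. (x i)\<^sup>2)"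
      by (simp add: processed_entry)
  qed
  have kD: "\<kappa> * D > 0" using \<kappa> scale by simp
  define \<Xi> where "\<Xi> = (\<Sum>j<k. \<Sum>l\<in>{k..<n}. (coord l (unit_indicator n \<Psi> j))\<^sup>2)"
  have "(\<kappa> * D - \<kappa> * D / 2)\<^sup>2 * \<Xi> \<le> (\<Sum>j<k. \<Sum>i<n. (resid j i)\<^sup>2)"
    unfolding \<Xi>_def
  proof (rule sin_theta_bound[OF top_le _ B_form])
    show "\<kappa> * D / 2 < \<kappa> * D" using kD by linarith
    show "(\<Sum>m<n. ?S $$ (i, m) * unit_indicator n \<Psi> j m) = (\<Sum>m<k. B j m * unit_indicator n \<Psi> m i) + resid j i"
      if "j < k" "i < n" for j i
      using resid_eq[OF that] that by (simp add: processed_entry)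
  qed
  also have "\<dots> \<le> (\<Sum>j<k. real k * R * resid_const * D)" by (intro sum_mono resid_sum) auto
  also have "\<dots> = real k ^ 2 * R * resid_const * D" by (simp add: power2_eq_square)
  finally have "(\<kappa>\<^sup>2 * D * \<Xi>) * D \<le> (4 * real k ^ 2 * R * resid_const) * D"
    by (simp add: power2_eq_square field_simps)
  then have "\<kappa>\<^sup>2 * D * \<Xi> \<le> 4 * real k ^ 2 * R * resid_const" using scale by (subst (asm) mult_le_cancel_right_pos)
  then have \<Xi>: "\<Xi> \<le> proj_const / D" unfolding proj_const using \<kappa> scale by (simp add: field_simps)
  have proj_const_nonneg: "proj_const \<ge> 0" unfolding proj_const resid_const_def using R row_dev_const_pos h p_pos \<kappa> by simp
  have nmin: "real (n_min n k \<Psi>) > 0" using clusters_large by simp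
  have nmax: "real (n_max n k \<Psi>) \<le> n"
  proof -
    have "n_max n k \<Psi> \<in> (\<lambda>j. card (cluster n \<Psi> j)) ` {..<k}"
      unfolding n_max_def using k_pos by (intro Max_in) (auto simp: lessThan_empty_iff)
    then obtain j where "n_max n k \<Psi> = c j" by blast
    moreover have "c j \<le> card {..<n}" by (intro card_mono) (auto simp: cluster_def)
    ultimately show ?thesis by simp
  qed
  have "err n k \<Psi> \<Phi> \<le> 8 * (2 + \<epsilon>) * n_max n k \<Psi> * (proj_const / D) / n"
  proof (rule err_le_of_projection[OF U(2,1) kn km _ partition])
    show "(\<Sum>j<k. \<Sum>l\<in>{k..<n}. (coord l (unit_indicator n \<Psi> j))\<^sup>2) \<le> proj_const / D" using \<Xi> by (simp add: \<Xi>_def)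
    show "proj_const / D \<le> 1 / 2" using big(1) scale by (simp add: field_simps)
    have "8 * (2 + \<epsilon>) * n_max n k \<Psi> * (proj_const / D) \<le> 8 * (2 + \<epsilon>) * (R * n_min n k \<Psi>) * (proj_const / D)"
      using balanced \<epsilon> proj_const_nonneg scale by (intro mult_right_mono mult_left_mono) auto
    also have "\<dots> = (8 * (2 + \<epsilon>) * R * proj_const / D) * n_min n k \<Psi>" by simp
    also have "\<dots> < 1 * real (n_min n k \<Psi>)"
      using big(2) scale nmin by (intro mult_strict_right_mono) (auto simp: divide_less_eq)
    finally show "8 * (2 + \<epsilon>) * n_max n k \<Psi> * (proj_const / D) < n_min n k \<Psi>" by simp
  qed (use \<epsilon> nmin n_pos in auto)
  also have "\<dots> \<le> 8 * (2 + \<epsilon>) * n * (proj_const / D) / n"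
    using nmax \<epsilon> proj_const_nonneg scale by (intro divide_right_mono mult_right_mono mult_left_mono) auto
  also have "\<dots> = 8 * (2 + \<epsilon>) * proj_const / D" using n_pos by simp
  finally show ?thesis .
qed

end

section \<open>Probability of a good sample and the error bound\<close>

lemma (in weighted_SBM) n_le_n_max: "real n \<le> real k * real (n_max n k \<Psi>)"
proof -
  have "real n = (\<Sum>j<k. real (card (cluster n \<Psi> j)))"
    using sum_clusters[OF partition, of "\<lambda>_. 1::real"] by simp
  also have "\<dots> \<le> (\<Sum>j<k. real (n_max n k \<Psi>))"
    using card_cluster_bounds(2)[of _ k n \<Psi>] by (intro sum_mono) auto
  finally show ?thesis by simp
qed

text \<open>
  The cross terms are needed for each cluster and for the set of all nodes; the latter controls degrees.
\<close>

lemma (in balanced_SBM) prob_good_samples: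
  fixes \<gamma> \<theta> \<delta> :: real
  assumes \<gamma>: "0 < \<gamma>" "\<gamma> \<le> p" "degree_scale * \<gamma>\<^sup>2 \<ge> 16 * real d ^ 2 * p"
    and \<theta>: "0 < \<theta>" "\<theta> \<le> 1 / 6" and \<delta>: "\<delta> > 0"
    and ln\<theta>: "ln (1 / \<theta>) \<ge> 2 * p * real d ^ 2 / \<delta>" and D: "degree_scale \<ge> 6 * real d ^ 2 / \<delta>"
      "degree_scale > 0"
  obtains Good where "Good \<in> events" "prob Good \<ge> 1 - (3 + (real k + 1) * (2 * p\<^sup>2 * real d ^ 3)) / n"
    and "\<And>\<omega>. \<omega> \<in> Good \<Longrightarrow> \<omega> \<in> space M \<and> (\<forall>e\<in>E. W e \<omega> \<in> {0..1}) \<and> \<omega> \<in> cut_event \<gamma> \<and> \<omega> \<in> sparse_event \<theta> \<delta>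
       \<and> (\<forall>C\<in>insert {..<n} (cluster n \<Psi> ` {..<k}). \<bar>cross_term C \<omega>\<bar> < degree_scale * n)"
proof -
  let ?\<C> = "insert {..<n} (cluster n \<Psi> ` {..<k})"
  define BadW where "BadW = {\<omega> \<in> space M. \<not> (\<forall>e\<in>E. W e \<omega> \<in> {0..1})}"
  define BadX where "BadX = (\<Union>C\<in>?\<C>. {\<omega> \<in> space M. \<bar>cross_term C \<omega>\<bar> \<ge> degree_scale * n})"
  define Bad where "Bad = BadW \<union> ((space M - cut_event \<gamma>) \<union> ((space M - sparse_event \<theta> \<delta>) \<union> BadX))"
  have [measurable]: "BadW \<in> events"
    unfolding BadW_def by (intro sets.sets_Collect_neg sets.sets_Collect_finite_All) auto
  have [measurable]: "BadX \<in> events" unfolding BadX_def by (intro sets.finite_UN) auto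
  have Bad: "Bad \<in> events" unfolding Bad_def by measurable
  have "prob BadW = 0"
  proof -
    have "AE \<omega> in M. \<forall>e\<in>E. W e \<omega> \<in> {0..1}" using weight_range by (intro AE_finite_allI) auto
    then have "AE \<omega> in M. \<omega> \<notin> BadW" by eventually_elim (auto simp: BadW_def)
    then show ?thesis by (simp add: prob_eq_0)
  qed
  moreover have "prob BadX \<le> (real k + 1) * (2 * p\<^sup>2 * real d ^ 3 / n)"
  proof -
    have "prob BadX \<le> (\<Sum>C\<in>?\<C>. prob {\<omega> \<in> space M. \<bar>cross_term C \<omega>\<bar> \<ge> degree_scale * n})"
      unfolding BadX_def by (intro measure_UNION_le) auto
    also have "\<dots> \<le> (\<Sum>C\<in>?\<C>. 2 * p\<^sup>2 * real d ^ 3 / n)"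
      using D by (intro sum_mono prob_cross_term) (auto simp: cluster_def)
    also have "\<dots> = real (card ?\<C>) * (2 * p\<^sup>2 * real d ^ 3 / n)" by simp
    also have "\<dots> \<le> (real k + 1) * (2 * p\<^sup>2 * real d ^ 3 / n)"
    proof (rule mult_right_mono)
      have "card ?\<C> \<le> Suc (card (cluster n \<Psi> ` {..<k}))" by (rule card_insert_le_m1) auto
      also have "card (cluster n \<Psi> ` {..<k}) \<le> k" using card_image_le[of "{..<k}" "cluster n \<Psi>"] by simp
      finally show "real (card ?\<C>) \<le> real k + 1" by simp
    qed simp
    finally show ?thesis .
  qed
  moreover have "prob Bad \<le> prob BadW + (prob (space M - cut_event \<gamma>) + (prob (space M - sparse_event \<theta> \<delta>) + prob BadX))"
    unfolding Bad_def by (intro order_trans[OF measure_Un_le] add_left_mono) auto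
  moreover have "prob (space M - cut_event \<gamma>) \<le> 1 / n" by (rule prob_cut_event[OF \<gamma>])
  moreover have "prob (space M - sparse_event \<theta> \<delta>) \<le> 2 / n" by (rule prob_sparse_event[OF \<theta> \<delta> ln\<theta> D(1)])
  ultimately have bad: "prob Bad \<le> (3 + (real k + 1) * (2 * p\<^sup>2 * real d ^ 3)) / n"
    by (simp add: add_divide_distrib)
  show ?thesis
  proof (rule that[of "space M - Bad"])
    show "space M - Bad \<in> events" using Bad by auto
    show "prob (space M - Bad) \<ge> 1 - (3 + (real k + 1) * (2 * p\<^sup>2 * real d ^ 3)) / n"
      using bad prob_compl[OF Bad] by simp
    show "\<omega> \<in> space M \<and> (\<forall>e\<in>E. W e \<omega> \<in> {0..1}) \<and> \<omega> \<in> cut_event \<gamma> \<and> \<omega> \<in> sparse_event \<theta> \<delta>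
       \<and> (\<forall>C\<in>?\<C>. \<bar>cross_term C \<omega>\<bar> < degree_scale * n)" if "\<omega> \<in> space M - Bad" for \<omega>
      using that unfolding Bad_def BadW_def BadX_def by (auto simp: not_le[symmetric])
  qed
qed

text \<open>
  The constant in \<open>\<xi> \<le> projection_const / D\<close>: four times the bound of \<open>resid_sum\<close>, summed over the
  clusters and measured in units of \<open>D\<close>, over the squared \<open>gap_const\<close>.
\<close>

definition projection_const :: "nat \<Rightarrow> nat \<Rightarrow> real \<Rightarrow> real \<Rightarrow> real \<Rightarrow> real" where
  "projection_const k d R p q = 4 * real k ^ 2 * R * ((3 * p * real d ^ 3 + 1)
     * (2 + 8 * threshold_const d R * p / gap_const k d R p q + p\<^sup>2 / (gap_const k d R p q)\<^sup>2)) / (gap_const k d R p q)\<^sup>2"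

lemma projection_const_pos:
  assumes "R \<ge> 1" "d \<ge> 2" "k \<ge> 1" "0 \<le> q" "q < p"
  shows "projection_const k d R p q > 0"
proof -
  have g: "gap_const k d R p q > 0" using assms by (rule gap_const_bounds)
  have h: "threshold_const d R > 0" using threshold_const_ge[OF assms(1,2)] by simp
  have "3 * p * real d ^ 3 + 1 > 0" using assms by (intro add_nonneg_pos) auto
  moreover have "2 + 8 * threshold_const d R * p / gap_const k d R p q + p\<^sup>2 / (gap_const k d R p q)\<^sup>2 > 0"
    using g h assms by (intro add_pos_nonneg) auto
  ultimately show ?thesis unfolding projection_const_def using g assms by simp
qed

theorem theorem1:
  fixes d :: nat and B :: real
  assumes "d \<ge> 2"
  shows "\<exists>c_thr>0. \<forall>(k::nat) (p::real) (q::real) (\<epsilon>::real).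
    k \<ge> 1 \<and> 0 \<le> q \<and> q < p \<and> \<epsilon> > 0 \<longrightarrow>
    (\<exists>c0>0. \<exists>c1>0. \<exists>C>0.
      \<forall>(n::nat) (\<alpha>::real) (\<Psi> :: nat \<Rightarrow> nat) (M :: 'a measure)
        (W :: nat set \<Rightarrow> 'a \<Rightarrow> real) (\<Phi>_HSC :: 'a \<Rightarrow> nat \<Rightarrow> nat).
        n \<ge> 1 \<and>
        weighted_SBM M n d k p q \<alpha> \<Psi> W \<and>
        n_min n k \<Psi> > 0 \<and>
        real (n_max n k \<Psi>) / real (n_min n k \<Psi>) \<le> B \<and>
        (\<forall>\<omega>\<in>space M. HSC_output c_thr \<epsilon> n d k (\<lambda>e. W e \<omega>) (\<Phi>_HSC \<omega>)) \<and>
        real (n choose d) * \<alpha> \<ge> c0 * real n \<and>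
        c1 * real k * (real n ^ 3 /
          (real d * (real d - 1) * real (n_min n k \<Psi>) ^ 2 * real (n choose d) * \<alpha>)) < 1
        \<longrightarrow>
        (\<exists>E\<in>sets M.
          E \<subseteq> {\<omega> \<in> space M.
            err n k \<Psi> (\<Phi>_HSC \<omega>) \<le> c1 * real k * (real n ^ 3 /
              (real d * (real d - 1) * real (n_min n k \<Psi>) ^ 2 * real (n choose d) * \<alpha>))} \<and>
          measure M E \<ge> 1 - C / real n))"
proof -
  define R where "R = max B 1"
  have R: "R \<ge> 1" "B \<le> R" by (auto simp: R_def)
  have thr: "threshold_const d R > 0" using threshold_const_ge[OF R(1) assms] by simp
  show ?thesis
  proof (rule exI[of _ "threshold_const d R"], intro conjI thr allI impI)
    fix k :: nat and p q \<epsilon> :: real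
    assume "k \<ge> 1 \<and> 0 \<le> q \<and> q < p \<and> \<epsilon> > 0"
    then have k: "k \<ge> 1" and q: "0 \<le> q" "q < p" and \<epsilon>: "\<epsilon> > 0" by auto
    have p: "p > 0" using q by simp
    define g where "g = gap_const k d R p q"
    have g: "g > 0" "g \<le> p" unfolding g_def using gap_const_bounds[OF R(1) assms k q] by auto
    define proj_const where "proj_const = projection_const k d R p q"
    have proj_const: "proj_const > 0" unfolding proj_const_def by (rule projection_const_pos[OF R(1) assms k q])
    obtain t \<delta> \<theta> K0 K1 \<gamma> :: real where tune:
      "t > 0" "\<delta> > 0" "0 < \<theta>" "\<theta> \<le> 1 / 6" "2 * p * (real d)\<^sup>2 / \<delta> \<le> ln (1 / \<theta>)"
      "0 < K0" "K0\<^sup>2 * \<theta> = 1" "K0 \<le> K1" "0 < \<gamma>" "\<gamma> \<le> g"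
      "4 * \<gamma> * K1\<^sup>2 + t * \<delta> + 2 * threshold_const d R * p / t + 4 * threshold_const d R * p * K0 / K1 + 2 * p / K1 \<le> g / 2"
    proof -
      have "real d > 0" using assms by simp
      then show ?thesis by (rule discrepancy_constants_exist[OF g(1) p thr _ that])
    qed
    \<comment> \<open>\<open>c0\<close> collects all lower bounds required of \<open>D\<close>, and \<open>C\<close> all those required of \<open>n\<close>.\<close>
    define c0 where "c0 = 1 + 16 * real d ^ 2 * p / \<gamma>\<^sup>2 + 6 * real d ^ 2 / \<delta> + 2 * proj_const + 8 * (2 + \<epsilon>) * R * proj_const"
    define c1 where "c1 = 8 * (2 + \<epsilon>) * proj_const"
    define C where "C = 2 + real k * R * (4 + real d) + p / g + real k + (3 + (real k + 1) * (2 * p\<^sup>2 * real d ^ 3))"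
    have parts0: "0 \<le> 16 * real d ^ 2 * p / \<gamma>\<^sup>2" "0 \<le> 6 * real d ^ 2 / \<delta>" "0 \<le> 2 * proj_const" "0 \<le> 8 * (2 + \<epsilon>) * R * proj_const"
      using p tune proj_const \<epsilon> R by auto
    have partsC: "0 \<le> real k * R * (4 + real d)" "0 \<le> p / g" "0 \<le> (real k + 1) * (2 * p\<^sup>2 * real d ^ 3)"
      using p g R by auto
    show "\<exists>c0>0. \<exists>c1>0. \<exists>C>0.
      \<forall>(n::nat) (\<alpha>::real) (\<Psi> :: nat \<Rightarrow> nat) (M :: 'a measure)
        (W :: nat set \<Rightarrow> 'a \<Rightarrow> real) (\<Phi>_HSC :: 'a \<Rightarrow> nat \<Rightarrow> nat).
        n \<ge> 1 \<and>
        weighted_SBM M n d k p q \<alpha> \<Psi> W \<and>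
        n_min n k \<Psi> > 0 \<and>
        real (n_max n k \<Psi>) / real (n_min n k \<Psi>) \<le> B \<and>
        (\<forall>\<omega>\<in>space M. HSC_output (threshold_const d R) \<epsilon> n d k (\<lambda>e. W e \<omega>) (\<Phi>_HSC \<omega>)) \<and>
        real (n choose d) * \<alpha> \<ge> c0 * real n \<and>
        c1 * real k * (real n ^ 3 /
          (real d * (real d - 1) * real (n_min n k \<Psi>) ^ 2 * real (n choose d) * \<alpha>)) < 1
        \<longrightarrow>
        (\<exists>E\<in>sets M.
          E \<subseteq> {\<omega> \<in> space M.
            err n k \<Psi> (\<Phi>_HSC \<omega>) \<le> c1 * real k * (real n ^ 3 /
              (real d * (real d - 1) * real (n_min n k \<Psi>) ^ 2 * real (n choose d) * \<alpha>))} \<and>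
          measure M E \<ge> 1 - C / real n)"
    proof (intro exI conjI allI impI)
      show "c0 > 0" using parts0 unfolding c0_def by linarith
      show "c1 > 0" using proj_const \<epsilon> by (simp add: c1_def)
      show "C > 0" using partsC unfolding C_def by linarith
      fix n :: nat and \<alpha> :: real and \<Psi> :: "nat \<Rightarrow> nat" and M :: "'a measure"
        and W :: "nat set \<Rightarrow> 'a \<Rightarrow> real" and \<Phi>_HSC :: "'a \<Rightarrow> nat \<Rightarrow> nat"
      let ?bound = "c1 * real k * (real n ^ 3 /
              (real d * (real d - 1) * real (n_min n k \<Psi>) ^ 2 * real (n choose d) * \<alpha>))"
      assume hyp: "n \<ge> 1 \<and>
        weighted_SBM M n d k p q \<alpha> \<Psi> W \<and>
        n_min n k \<Psi> > 0 \<and>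
        real (n_max n k \<Psi>) / real (n_min n k \<Psi>) \<le> B \<and>
        (\<forall>\<omega>\<in>space M. HSC_output (threshold_const d R) \<epsilon> n d k (\<lambda>e. W e \<omega>) (\<Phi>_HSC \<omega>)) \<and>
        real (n choose d) * \<alpha> \<ge> c0 * real n \<and> ?bound < 1"
      then have n: "n \<ge> 1" and sbm: "weighted_SBM M n d k p q \<alpha> \<Psi> W" and nmin: "n_min n k \<Psi> > 0"
        and ratio: "real (n_max n k \<Psi>) / real (n_min n k \<Psi>) \<le> B"
        and out: "\<And>\<omega>. \<omega> \<in> space M \<Longrightarrow> HSC_output (threshold_const d R) \<epsilon> n d k (\<lambda>e. W e \<omega>) (\<Phi>_HSC \<omega>)"
        and edges: "real (n choose d) * \<alpha> \<ge> c0 * real n"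
        by auto
      interpret weighted_SBM M n d k p q \<alpha> \<Psi> W by (rule sbm)
      show "\<exists>E\<in>sets M. E \<subseteq> {\<omega> \<in> space M. err n k \<Psi> (\<Phi>_HSC \<omega>) \<le> ?bound} \<and> measure M E \<ge> 1 - C / real n"
      proof (cases "real n \<le> C")
        case True
        \<comment> \<open>For small \<open>n\<close> the probability bound is not positive and the empty event will do.\<close>
        then have "1 - C / real n \<le> measure M {}" using n by (simp add: field_simps)
        then show ?thesis by (intro bexI[of _ "{}"]) auto
      next
        case False
        then have nC: "real n > C" by simp
        have nbig: "real n > real k * R * (4 + real d)" "real n > p / g" "real n > real k" "real n \<ge> 2"
          using nC partsC unfolding C_def by linarith+
        have bal: "real (n_max n k \<Psi>) \<le> R * real (n_min n k \<Psi>)"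
        proof -
          have "real (n_max n k \<Psi>) \<le> B * real (n_min n k \<Psi>)" using ratio nmin by (simp add: divide_le_eq)
          also have "\<dots> \<le> R * real (n_min n k \<Psi>)" using R by (intro mult_right_mono) auto
          finally show ?thesis .
        qed
        have "real k * R * (4 + real d) < real k * R * real (n_min n k \<Psi>)"
        proof -
          have "real n \<le> real k * (R * real (n_min n k \<Psi>))"
            using n_le_n_max mult_left_mono[OF bal, of "real k"] by linarith
          then show ?thesis using nbig(1) by (simp add: mult.assoc)
        qed
        then have "4 + real d < real (n_min n k \<Psi>)" using k R by (subst (asm) mult_less_cancel_left_pos) auto
        then have nmin_large: "n_min n k \<Psi> \<ge> 4" "n_min n k \<Psi> \<ge> d" by linarith+
        interpret balanced_SBM M n d k p q \<alpha> \<Psi> W R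
        proof unfold_locales
          show "d \<ge> 2" by (rule assms)
          show "real n * gap_const k d R p q \<ge> p" using nbig(2) g by (simp add: g_def divide_less_eq)
        qed (use n k q R bal nmin_large nbig in auto)
        have pairs: "real d * (real d - 1) * real (n choose d) * \<alpha> = (real n - 1) * degree_scale"
          using choose_pair_identity[OF assms, of n] nbig(4) by (simp add: degree_scale_def)
        have D: "c0 \<le> degree_scale"
        proof -
          have dd: "1 \<le> real d * (real d - 1)" using mult_mono[of 1 "real d" 1 "real d - 1"] assms by simp
          have "c0 * real n \<le> 1 * (real (n choose d) * \<alpha>)" using edges by simp
          also have "\<dots> \<le> real d * (real d - 1) * (real (n choose d) * \<alpha>)"
            using dd scale_pos by (intro mult_right_mono) auto
          also have "\<dots> = (real n - 1) * degree_scale" using pairs by (simp only: mult.assoc)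
          also have "\<dots> \<le> real n * degree_scale" using degree_scale_nonneg by (intro mult_right_mono) auto
          finally show ?thesis using n_pos by (simp add: mult.commute)
        qed
        have Dparts: "degree_scale > 0" "16 * real d ^ 2 * p / \<gamma>\<^sup>2 \<le> degree_scale" "6 * real d ^ 2 / \<delta> \<le> degree_scale"
          "2 * proj_const \<le> degree_scale" "8 * (2 + \<epsilon>) * R * proj_const < degree_scale"
          using D parts0 unfolding c0_def by linarith+
        obtain Good where Good: "Good \<in> events"
            "prob Good \<ge> 1 - (3 + (real k + 1) * (2 * p\<^sup>2 * real d ^ 3)) / n"
          and sample: "\<And>\<omega>. \<omega> \<in> Good \<Longrightarrow> \<omega> \<in> space M \<and> (\<forall>e\<in>E. W e \<omega> \<in> {0..1}) \<and> \<omega> \<in> cut_event \<gamma>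
             \<and> \<omega> \<in> sparse_event \<theta> \<delta>
             \<and> (\<forall>C\<in>insert {..<n} (cluster n \<Psi> ` {..<k}). \<bar>cross_term C \<omega>\<bar> < degree_scale * n)"
        proof (rule prob_good_samples[of \<gamma> \<theta> \<delta>])
          show "16 * real d ^ 2 * p \<le> degree_scale * \<gamma>\<^sup>2" using Dparts(2) tune(9) by (simp add: divide_le_eq)
        qed (use tune g Dparts in auto)
        show ?thesis
        proof (intro bexI[of _ Good] conjI Good(1) subsetI CollectI)
          have "(3 + (real k + 1) * (2 * p\<^sup>2 * real d ^ 3)) / n \<le> C / n"
            using partsC unfolding C_def by (intro divide_right_mono) linarith+
          then show "1 - C / real n \<le> prob Good" using Good(2) by linarith
          fix \<omega> assume \<omega>: "\<omega> \<in> Good"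
          have unit: "\<forall>e\<in>E. W e \<omega> \<in> {0..1}" and in_cut: "\<omega> \<in> cut_event \<gamma>"
            and in_sparse: "\<omega> \<in> sparse_event \<theta> \<delta>"
            and cross: "\<forall>C\<in>insert {..<n} (cluster n \<Psi> ` {..<k}). \<bar>cross_term C \<omega>\<bar> < degree_scale * n"
            and space: "\<omega> \<in> space M"
            using sample[OF \<omega>] by blast+
          show "\<omega> \<in> space M" by (rule space)
          interpret good_sample M n d k p q \<alpha> \<Psi> W R \<omega> t \<delta> \<theta> K0 K1 \<gamma>
          proof
            fix S T assume "S \<subseteq> {..<n}" "T \<subseteq> {..<n}"
            then have "\<not> \<bar>cut_dev S T \<omega>\<bar> \<ge> \<gamma> * degree_scale * n"
              using in_cut unfolding cut_event_def by blast
            then show "\<bar>cut_dev S T \<omega>\<bar> \<le> \<gamma> * degree_scale * n" by simp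
          next
            fix S assume "S \<subseteq> {..<n}" "S \<noteq> {}" "real (card S) \<le> \<theta> * n"
            then have "\<not> (\<Sum>e\<in>E. W e \<omega> * pair_count S S e) \<ge> \<delta> * degree_scale * card S"
              using in_sparse unfolding sparse_event_def by blast
            then show "(\<Sum>e\<in>E. W e \<omega> * pair_count S S e) \<le> \<delta> * degree_scale * card S" by simp
          next
            fix C assume "C \<in> insert {..<n} (cluster n \<Psi> ` {..<k})"
            then have "\<bar>cross_term C \<omega>\<bar> < degree_scale * n" using cross by blast
            then show "\<bar>cross_term C \<omega>\<bar> \<le> degree_scale * n" by simp
          next
            fix e assume "e \<in> E"
            then show "W e \<omega> \<in> {0..1}" using unit by blast
          qed (use tune Dparts in \<open>simp_all add: g_def\<close>)
          have "err n k \<Psi> (\<Phi>_HSC \<omega>) \<le> 8 * (2 + \<epsilon>) * proj_const / degree_scale"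
          proof (rule HSC_error)
            show "HSC_output h \<epsilon> n d k (\<lambda>e. W e \<omega>) (\<Phi>_HSC \<omega>)"
              unfolding h_def using out space by blast
            show "proj_const = 4 * real k ^ 2 * R * resid_const / \<kappa>\<^sup>2"
              unfolding proj_const_def projection_const_def resid_const_def row_dev_const_def h_def \<kappa>_def by (rule refl)
          qed (use \<epsilon> Dparts in auto)
          also have "\<dots> = c1 * (1 / degree_scale)" by (simp add: c1_def)
          also have "\<dots> \<le> c1 * (real k * (real n ^ 3 / (real (n_min n k \<Psi>) ^ 2 * ((real n - 1) * degree_scale))))"
          proof (rule mult_left_mono)
            have nm: "real (n_min n k \<Psi>) \<le> real n"
            proof -
              have "n_min n k \<Psi> \<le> card (cluster n \<Psi> 0)" using k by (intro card_cluster_bounds) simp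
              also have "\<dots> \<le> card {..<n}" by (intro card_mono) (auto simp: cluster_def)
              finally show ?thesis by simp
            qed
            have "real (n_min n k \<Psi>) ^ 2 * (real n - 1) \<le> real n ^ 2 * real n"
              using nm nbig(4) by (intro mult_mono power_mono) auto
            then have le: "real (n_min n k \<Psi>) ^ 2 * (real n - 1) \<le> real n ^ 3" by (simp add: power3_eq_cube power2_eq_square)
            have pos: "real (n_min n k \<Psi>) ^ 2 * (real n - 1) > 0" using nmin nbig(4) by simp
            have "1 / degree_scale \<le> (real n ^ 3 / (real (n_min n k \<Psi>) ^ 2 * (real n - 1))) / degree_scale"
              using le pos Dparts(1) by (intro divide_right_mono) (auto simp: le_divide_eq)
            also have "\<dots> = 1 * (real n ^ 3 / (real (n_min n k \<Psi>) ^ 2 * ((real n - 1) * degree_scale)))"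
              by (simp add: mult.assoc)
            also have "\<dots> \<le> real k * (real n ^ 3 / (real (n_min n k \<Psi>) ^ 2 * ((real n - 1) * degree_scale)))"
              using k nbig(4) Dparts(1) by (intro mult_right_mono) auto
            finally show "1 / degree_scale \<le> real k * (real n ^ 3 / (real (n_min n k \<Psi>) ^ 2 * ((real n - 1) * degree_scale)))" .
          qed (use proj_const \<epsilon> in \<open>simp add: c1_def\<close>)
          also have "\<dots> = ?bound" unfolding pairs[symmetric] by (simp only: mult_ac)
          finally show "err n k \<Psi> (\<Phi>_HSC \<omega>) \<le> ?bound" .
        qed
      qed
    qed
  qed
qed

end
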